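(* Let $G$ be a simple planar graph with $\Delta(G)\ge 9$. If $H$ is the line graph of $G$ and $L$ is a $(\Delta(G)+1)$-assignment for $H$, then all $L$-colorings of $H$ are $L$-equivalent.
   Context: A list assignment $L$ for a graph $H$ assigns to each vertex $v$ a set $L(v)$ of colors; it is a $k$-assignment if $|L(v)|=k$ for all $v$. An $L$-coloring is a proper coloring $\varphi$ with $\varphi(v)\in L(v)$ for all $v$. For a proper coloring and distinct colors $\alpha,\beta$, an $\alpha,\beta$-Kempe swap interchanges the colors $\alpha$ and $\beta$ on one connected component of the subgraph induced by the vertices colored $\alpha$ or $\beta$. A Kempe swap is $L$-valid for an $L$-coloring $\varphi$ if performing it on $\varphi$ yields another $L$-coloring. Two $L$-colorings are $L$-equivalent if one can be transformed into the other by a sequence of $L$-valid Kempe swaps. The line graph of $G$ has vertex set $E(G)$, two edges adjacent iff they share an endpoint. $\Delta(G)$ is the maximum degree. *)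

theory Defs
  imports "HOL-Analysis.Analysis" "HOL-Combinatorics.Transposition"
begin

record 'v ugraph =
  verts :: "'v set"
  edges :: "'v set set"

definition simple_graph :: "'v ugraph \<Rightarrow> bool" where
  "simple_graph G \<longleftrightarrow> finite (verts G) \<and> (\<forall>e\<in>edges G. e \<subseteq> verts G \<and> card e = 2)"

definition vertex_degree :: "'v ugraph \<Rightarrow> 'v \<Rightarrow> nat" where
  "vertex_degree G v = card {e \<in> edges G. v \<in> e}"

text \<open>The inserted \<open>0\<close> only fixes the value for the graph without vertices.\<close>

definition max_degree :: "'v ugraph \<Rightarrow> nat" where
  "max_degree G = Max (insert 0 (vertex_degree G ` verts G))"

text \<open>
  Topological planarity: vertices are distinct points of the plane, every edge is an arc joining
  its two ends, and the interior of an edge (\<open>path_image (\<gamma> e) - p ` e\<close>) contains no vertex and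
  no point of any other edge. The plane is the type \<^typ>\<open>complex\<close>, as in the library's Jordan
  curve theorem.
\<close>

definition plane_drawing :: "'v ugraph \<Rightarrow> ('v \<Rightarrow> complex) \<Rightarrow> ('v set \<Rightarrow> real \<Rightarrow> complex) \<Rightarrow> bool" where
  "plane_drawing G p \<gamma> \<longleftrightarrow>
     inj_on p (verts G) \<and>
     (\<forall>e\<in>edges G. arc (\<gamma> e) \<and> {pathstart (\<gamma> e), pathfinish (\<gamma> e)} = p ` e) \<and>
     (\<forall>e\<in>edges G. (path_image (\<gamma> e) - p ` e) \<inter> p ` verts G = {}) \<and>
     (\<forall>e\<in>edges G. \<forall>f\<in>edges G. e \<noteq> f \<longrightarrow> (path_image (\<gamma> e) - p ` e) \<inter> path_image (\<gamma> f) = {})"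

definition planar :: "'v ugraph \<Rightarrow> bool" where
  "planar G \<longleftrightarrow> (\<exists>p \<gamma>. plane_drawing G p \<gamma>)"

definition line_graph :: "'v ugraph \<Rightarrow> 'v set ugraph" where
  "line_graph G =
     \<lparr>verts = edges G,
      edges = {{e, f} | e f. e \<in> edges G \<and> f \<in> edges G \<and> e \<noteq> f \<and> e \<inter> f \<noteq> {}}\<rparr>"

lemma simple_graph_line_graph:
  assumes "simple_graph G"
  shows "simple_graph (line_graph G)"
proof -
  have "finite (edges G)"
    by (rule finite_subset[of _ "Pow (verts G)"]) (use assms in \<open>auto simp: simple_graph_def\<close>)
  then show ?thesis
    by (fastforce simp: simple_graph_def line_graph_def card_2_iff)
qed

definition induced_subgraph :: "'v ugraph \<Rightarrow> 'v set \<Rightarrow> 'v ugraph" where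
  "induced_subgraph G S = \<lparr>verts = verts G \<inter> S, edges = {e \<in> edges G. e \<subseteq> S}\<rparr>"

definition graph_components :: "'v ugraph \<Rightarrow> 'v set set" where
  "graph_components G =
     {{w \<in> verts G. (v, w) \<in> {(x, y). {x, y} \<in> edges G}\<^sup>*} | v. v \<in> verts G}"

definition k_assignment :: "'v ugraph \<Rightarrow> nat \<Rightarrow> ('v \<Rightarrow> 'c set) \<Rightarrow> bool" where
  "k_assignment H k L \<longleftrightarrow> (\<forall>v\<in>verts H. finite (L v) \<and> card (L v) = k)"

text \<open>
  Colorings are extensional functions (\<open>undefined\<close> off the vertex set), so that equality of
  colorings is equality of functions on the vertices.
\<close>

definition list_coloring :: "'v ugraph \<Rightarrow> ('v \<Rightarrow> 'c set) \<Rightarrow> ('v \<Rightarrow> 'c) \<Rightarrow> bool" where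
  "list_coloring H L \<phi> \<longleftrightarrow>
     \<phi> \<in> (\<Pi>\<^sub>E v\<in>verts H. L v) \<and> (\<forall>u v. {u, v} \<in> edges H \<longrightarrow> \<phi> u \<noteq> \<phi> v)"

definition kempe_swap :: "'v ugraph \<Rightarrow> ('v \<Rightarrow> 'c) \<Rightarrow> ('v \<Rightarrow> 'c) \<Rightarrow> bool" where
  "kempe_swap H \<phi> \<psi> \<longleftrightarrow>
     (\<exists>\<alpha> \<beta> K. \<alpha> \<noteq> \<beta> \<and>
        K \<in> graph_components (induced_subgraph H {v \<in> verts H. \<phi> v \<in> {\<alpha>, \<beta>}}) \<and>
        \<psi> = (\<lambda>v. if v \<in> K then Transposition.transpose \<alpha> \<beta> (\<phi> v) else \<phi> v))"

definition valid_kempe_swap ::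
    "'v ugraph \<Rightarrow> ('v \<Rightarrow> 'c set) \<Rightarrow> ('v \<Rightarrow> 'c) \<Rightarrow> ('v \<Rightarrow> 'c) \<Rightarrow> bool" where
  "valid_kempe_swap H L \<phi> \<psi> \<longleftrightarrow>
     list_coloring H L \<phi> \<and> kempe_swap H \<phi> \<psi> \<and> list_coloring H L \<psi>"

definition L_equivalent ::
    "'v ugraph \<Rightarrow> ('v \<Rightarrow> 'c set) \<Rightarrow> ('v \<Rightarrow> 'c) \<Rightarrow> ('v \<Rightarrow> 'c) \<Rightarrow> bool" where
  "L_equivalent H L = (valid_kempe_swap H L)\<^sup>*\<^sup>*"

end

theory Submission
  imports Defs
begin

text \<open>
  Induct on the number of edges, over all subgraphs of \<open>G\<close>, with \<open>k = \<Delta> + 1\<close>. An edge \<open>uv\<close> with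
  \<open>d(u) + d(v) \<le> k + 1\<close> has fewer than \<open>k\<close> neighbors in the line graph, so every valid swap of the
  remaining edges can be simulated after at most one recoloring of \<open>uv\<close>. If there is no such edge,
  then Euler's formula and discharging give a cycle \<open>C\<close> on which vertices of degree \<open>3\<close> and \<open>\<Delta>\<close>
  alternate: a vertex starts with charge \<open>d - 4\<close>, a triangular face needs \<open>1\<close>, and if the edges
  at vertices of degree \<open>3\<close> formed a forest, the vertices of degree \<open>\<Delta>\<close> could pay for those of
  degree \<open>3\<close>.

  Given a coloring of the other edges, every edge of \<open>C\<close> keeps at least two colors. A swap of the
  other edges lifts after a suitable recoloring of \<open>C\<close>. The extensions of one outer coloring to \<open>C\<close>
  need not be equivalent (the lists may be \<open>{a_i, a_{i+1}}\<close> around the cycle), but they are if some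
  edge of \<open>C\<close> keeps three colors. An outer coloring of this kind is obtained by prescribing one color
  on at most two disjoint edges; it extends because in the discharging argument the (at most
  four) ends of these edges lose less than the total charge \<open>- 8\<close>.
\<close>

section \<open>Kempe swaps on unions of components\<close>

text \<open>The obstacle in lifting a swap is that the swapped component may run from the outer
  edges into \<open>C\<close>, along it and out elsewhere, or meet a list without one of the two
  colors. So \<open>C\<close> is first recolored such that, in a fixed direction, every position
  after the first in a run of swap colors keeps just these two colors, hence has no outer neighbor
  in them. A first position with exactly two colors left has outer neighbors of distinct colors, so
  the way in is the only way out. The recoloring uses moves that hold one color next to a list
  lacking it, which cuts \<open>C\<close> open to a path. Prescribed edges are deleted;
  \<open>Z\<close> collects their ends, where degrees are corrected by 1 and lists are one color
  shorter. With n3 and nD vertices of degree 3 and \<Delta>, a forest gives 3 n3 < n3 + nD up to an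
  error of 4, while Euler's formula gives nD + 16 <= 2 n3 up to an error of 8. The bound 9 makes
  degrees across an edge add up to at least 12, as triangles require, and leaves 1/2 at a vertex of
  degree \<Delta> after its payments.\<close>

definition coloring :: "('a \<Rightarrow> 'a \<Rightarrow> bool) \<Rightarrow> 'a set \<Rightarrow> ('a \<Rightarrow> 'c set) \<Rightarrow> ('a \<Rightarrow> 'c) \<Rightarrow> bool" where
  "coloring adj W L \<phi> \<longleftrightarrow> \<phi> \<in> (\<Pi>\<^sub>E v\<in>W. L v) \<and> (\<forall>u\<in>W. \<forall>v\<in>W. adj u v \<longrightarrow> \<phi> u \<noteq> \<phi> v)"

text \<open>Closed sets are unions of Kempe components; unlike components they need no connectivity argument.\<close>

definition kempe_closed :: "('a \<Rightarrow> 'a \<Rightarrow> bool) \<Rightarrow> 'a set \<Rightarrow> ('a \<Rightarrow> 'c) \<Rightarrow> 'c \<Rightarrow> 'c \<Rightarrow> 'a set \<Rightarrow> bool" where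
  "kempe_closed adj W \<phi> \<alpha> \<beta> K \<longleftrightarrow>
     K \<subseteq> {v \<in> W. \<phi> v \<in> {\<alpha>, \<beta>}} \<and>
     (\<forall>u\<in>K. \<forall>v\<in>W. adj u v \<and> \<phi> v \<in> {\<alpha>, \<beta>} \<longrightarrow> v \<in> K)"

definition swap_on :: "'c \<Rightarrow> 'c \<Rightarrow> 'a set \<Rightarrow> ('a \<Rightarrow> 'c) \<Rightarrow> 'a \<Rightarrow> 'c" where
  "swap_on \<alpha> \<beta> K \<phi> = (\<lambda>v. if v \<in> K then Transposition.transpose \<alpha> \<beta> (\<phi> v) else \<phi> v)"

definition kempe_step :: "('a \<Rightarrow> 'a \<Rightarrow> bool) \<Rightarrow> 'a set \<Rightarrow> ('a \<Rightarrow> 'c set) \<Rightarrow> ('a \<Rightarrow> 'c) \<Rightarrow> ('a \<Rightarrow> 'c) \<Rightarrow> bool" where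
  "kempe_step adj W L \<phi> \<psi> \<longleftrightarrow> coloring adj W L \<phi> \<and> coloring adj W L \<psi> \<and>
     (\<exists>\<alpha> \<beta> K. kempe_closed adj W \<phi> \<alpha> \<beta> K \<and> \<psi> = swap_on \<alpha> \<beta> K \<phi>)"

abbreviation kempe_equiv :: "('a \<Rightarrow> 'a \<Rightarrow> bool) \<Rightarrow> 'a set \<Rightarrow> ('a \<Rightarrow> 'c set) \<Rightarrow> ('a \<Rightarrow> 'c) \<Rightarrow> ('a \<Rightarrow> 'c) \<Rightarrow> bool" where
  "kempe_equiv adj W L \<equiv> (kempe_step adj W L)\<^sup>*\<^sup>*"

definition swappable :: "('a \<Rightarrow> 'a \<Rightarrow> bool) \<Rightarrow> 'a set \<Rightarrow> ('a \<Rightarrow> 'c set) \<Rightarrow> bool" where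
  "swappable adj W L \<longleftrightarrow>
     (\<forall>\<phi> \<psi>. coloring adj W L \<phi> \<longrightarrow> coloring adj W L \<psi> \<longrightarrow> kempe_equiv adj W L \<phi> \<psi>)"

lemma coloring_in: "coloring adj W L \<phi> \<Longrightarrow> v \<in> W \<Longrightarrow> \<phi> v \<in> L v"
  by (auto simp: coloring_def)

lemma coloring_neq: "coloring adj W L \<phi> \<Longrightarrow> u \<in> W \<Longrightarrow> v \<in> W \<Longrightarrow> adj u v \<Longrightarrow> \<phi> u \<noteq> \<phi> v"
  by (auto simp: coloring_def)

lemma coloring_restrict: "coloring adj W L \<phi> \<Longrightarrow> W' \<subseteq> W \<Longrightarrow> coloring adj W' L (restrict \<phi> W')"
  by (auto simp: coloring_def PiE_def Pi_def subset_iff)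

lemma coloring_mono: "coloring adj W L' \<phi> \<Longrightarrow> (\<And>v. v \<in> W \<Longrightarrow> L' v \<subseteq> L v) \<Longrightarrow> coloring adj W L \<phi>"
  by (auto simp: coloring_def PiE_def Pi_def)

lemma coloring_eqI:
  assumes "coloring adj W L \<phi>" "coloring adj W L' \<psi>" "\<And>v. v \<in> W \<Longrightarrow> \<phi> v = \<psi> v"
  shows "\<phi> = \<psi>"
  using assms by (intro extensionalityI[of \<phi> W \<psi>]) (auto simp: coloring_def PiE_def)

lemma kempe_equiv_mono:
  assumes "kempe_equiv adj W L' \<phi> \<psi>" "\<And>v. v \<in> W \<Longrightarrow> L' v \<subseteq> L v"
  shows "kempe_equiv adj W L \<phi> \<psi>"
proof -
  have "kempe_step adj W L' \<le> kempe_step adj W L"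
  proof (rule predicate2I)
    fix \<phi> \<psi> assume "kempe_step adj W L' \<phi> \<psi>"
    then show "kempe_step adj W L \<phi> \<psi>"
      unfolding kempe_step_def using coloring_mono[of adj W L' _ L] assms(2) by blast
  qed
  then show ?thesis using assms(1) rtranclp_mono by blast
qed

lemma swap_on_mem_iff: "swap_on \<alpha> \<beta> K \<phi> v \<in> {\<alpha>, \<beta>} \<longleftrightarrow> \<phi> v \<in> {\<alpha>, \<beta>}"
  unfolding swap_on_def by (auto simp: Transposition.transpose_def)

lemma swap_on_swap_on: "swap_on \<alpha> \<beta> K (swap_on \<alpha> \<beta> K \<phi>) = \<phi>"
  by (auto simp: swap_on_def)

lemma kempe_closed_swap_on:
  "kempe_closed adj W \<phi> \<alpha> \<beta> K \<Longrightarrow> kempe_closed adj W (swap_on \<alpha> \<beta> K' \<phi>) \<alpha> \<beta> K"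
  unfolding kempe_closed_def swap_on_mem_iff by simp

lemma swap_on_commute: "swap_on \<alpha> \<beta> K \<phi> = swap_on \<beta> \<alpha> K \<phi>"
  by (auto simp: swap_on_def Transposition.transpose_def fun_eq_iff)

lemma kempe_closed_commute: "kempe_closed adj W \<phi> \<alpha> \<beta> K \<longleftrightarrow> kempe_closed adj W \<phi> \<beta> \<alpha> K"
  by (auto simp: kempe_closed_def)

lemma kempe_step_sym: "kempe_step adj W L \<phi> \<psi> \<Longrightarrow> kempe_step adj W L \<psi> \<phi>"
  unfolding kempe_step_def using kempe_closed_swap_on swap_on_swap_on by metis

lemma kempe_equiv_sym: "kempe_equiv adj W L \<phi> \<psi> \<Longrightarrow> kempe_equiv adj W L \<psi> \<phi>"
  by (induction rule: rtranclp_induct) (auto intro: kempe_step_sym converse_rtranclp_into_rtranclp)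

lemma kempe_equiv_coloring:
  "kempe_equiv adj W L \<phi> \<psi> \<Longrightarrow> coloring adj W L \<phi> \<Longrightarrow> coloring adj W L \<psi>"
  by (induction rule: rtranclp_induct) (auto simp: kempe_step_def)

text \<open>Subgraphs arise by varying the vertex set \<open>W\<close> under one fixed adjacency
  relation, so deletions need no new graph objects.\<close>

locale sym_adj =
  fixes adj :: "'a \<Rightarrow> 'a \<Rightarrow> bool"
  assumes adj_sym: "adj u v \<Longrightarrow> adj v u" and adj_irrefl: "\<not> adj u u"
begin

text \<open>An edge leaving \<open>K\<close> has its outer end colored outside {\<alpha>, \<beta>},
  so no conflict arises across the border of \<open>K\<close>; what remains to be checked is list
  membership inside \<open>K\<close>.\<close>

lemma coloring_swap_on:
  assumes \<phi>: "coloring adj W L \<phi>" and K: "kempe_closed adj W \<phi> \<alpha> \<beta> K"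
    and L: "\<And>v. v \<in> K \<Longrightarrow> swap_on \<alpha> \<beta> K \<phi> v \<in> L v"
  shows "coloring adj W L (swap_on \<alpha> \<beta> K \<phi>)"
proof -
  have KW: "K \<subseteq> W" using K by (auto simp: kempe_closed_def)
  have "swap_on \<alpha> \<beta> K \<phi> v \<in> L v" if "v \<in> W" for v
    using L[of v] coloring_in[OF \<phi> that] by (cases "v \<in> K") (auto simp: swap_on_def)
  moreover have "swap_on \<alpha> \<beta> K \<phi> v = undefined" if "v \<notin> W" for v
    using that KW \<phi> by (auto simp: swap_on_def coloring_def)
  moreover have "swap_on \<alpha> \<beta> K \<phi> u \<noteq> swap_on \<alpha> \<beta> K \<phi> v" if uv: "u \<in> W" "v \<in> W" "adj u v" for u v
  proof
    assume eq: "swap_on \<alpha> \<beta> K \<phi> u = swap_on \<alpha> \<beta> K \<phi> v"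
    have ne: "\<phi> u \<noteq> \<phi> v" using coloring_neq[OF \<phi>] uv by blast
    have "u \<in> K \<longleftrightarrow> v \<in> K"
    proof (rule ccontr)
      assume *: "\<not> (u \<in> K \<longleftrightarrow> v \<in> K)"
      have "\<phi> u \<in> {\<alpha>, \<beta>} \<longleftrightarrow> \<phi> v \<in> {\<alpha>, \<beta>}"
        using eq swap_on_mem_iff[of \<alpha> \<beta> K \<phi>] by metis
      then show False using K * uv adj_sym unfolding kempe_closed_def by blast
    qed
    then show False using eq ne by (auto simp: swap_on_def transpose_eq_iff split: if_splits)
  qed
  ultimately show ?thesis by (auto simp: coloring_def PiE_def extensional_def)
qed

lemma kempe_step_swap_on:
  assumes "coloring adj W L \<phi>" "kempe_closed adj W \<phi> \<alpha> \<beta> K"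
    "\<And>v. v \<in> K \<Longrightarrow> swap_on \<alpha> \<beta> K \<phi> v \<in> L v"
  shows "kempe_step adj W L \<phi> (swap_on \<alpha> \<beta> K \<phi>)"
  using assms coloring_swap_on kempe_step_def by metis

text \<open>If no neighbor of \<open>v\<close> has color \<gamma>, then {v} is closed for the colors
  \<open>\<phi> v\<close> and \<gamma>.\<close>

lemma kempe_step_recolor:
  assumes \<phi>: "coloring adj W L \<phi>" and v: "v \<in> W" and \<gamma>: "\<gamma> \<in> L v"
    and free: "\<And>u. u \<in> W \<Longrightarrow> adj v u \<Longrightarrow> \<phi> u \<noteq> \<gamma>"
  shows "kempe_step adj W L \<phi> (\<phi>(v := \<gamma>))"
proof -
  have eq: "\<phi>(v := \<gamma>) = swap_on (\<phi> v) \<gamma> {v} \<phi>" by (auto simp: swap_on_def)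
  have "kempe_closed adj W \<phi> (\<phi> v) \<gamma> {v}"
    unfolding kempe_closed_def using v free coloring_neq[OF \<phi> v] by fastforce
  then show ?thesis unfolding eq
    using \<phi> \<gamma> by (intro kempe_step_swap_on) (auto simp: swap_on_def)
qed

text \<open>The step hypothesis ranges over all colorings above the current one, because a lifted
  step may recolor vertices outside \<open>W'\<close> and so leaves an unknown lift to the next
  step.\<close>

lemma lift_kempe_equiv:
  assumes "kempe_equiv adj W' L \<phi> \<phi>'"
    and "coloring adj W L \<eta>" "restrict \<eta> W' = \<phi>"
    and step: "\<And>\<phi> \<phi>' \<eta>. kempe_step adj W' L \<phi> \<phi>' \<Longrightarrow> coloring adj W L \<eta> \<Longrightarrow> restrict \<eta> W' = \<phi> \<Longrightarrow>
       \<exists>\<eta>'. kempe_equiv adj W L \<eta> \<eta>' \<and> restrict \<eta>' W' = \<phi>'"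
  shows "\<exists>\<eta>'. kempe_equiv adj W L \<eta> \<eta>' \<and> restrict \<eta>' W' = \<phi>'"
  using assms(1-3)
proof (induction rule: rtranclp_induct)
  case base
  then show ?case by blast
next
  case (step \<psi> \<psi>')
  then obtain \<eta>1 where 1: "kempe_equiv adj W L \<eta> \<eta>1" "restrict \<eta>1 W' = \<psi>" by blast
  then obtain \<eta>2 where "kempe_equiv adj W L \<eta>1 \<eta>2" "restrict \<eta>2 W' = \<psi>'"
    using assms(4)[OF step.hyps(2), of \<eta>1] kempe_equiv_coloring step.prems(1) by blast
  moreover have "kempe_equiv adj W L \<eta> \<eta>2"
    using 1(1) calculation(1) by (rule rtranclp_trans)
  ultimately show ?case by blast
qed

text \<open>
  Neighbors with a list disjoint from that of \<open>v\<close> are not counted, so that colors can be fixed on part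
  of the graph by shrinking lists to singletons.
\<close>

lemma swappable_insert:
  assumes v: "v \<notin> W'" and fin: "finite W'" "finite (L v)"
    and deg: "card {u \<in> W'. adj v u \<and> L u \<inter> L v \<noteq> {}} < card (L v)"
    and sw: "swappable adj W' L"
  shows "swappable adj (insert v W') L"
proof -
  let ?W = "insert v W'"
  let ?N = "{u \<in> W'. adj v u \<and> L u \<inter> L v \<noteq> {}}"
  have lift0: "\<exists>\<eta>'. kempe_step adj ?W L \<eta> \<eta>' \<and> restrict \<eta>' W' = swap_on \<alpha> \<beta> K (restrict \<eta> W')"
    if \<eta>: "coloring adj ?W L \<eta>" and K: "kempe_closed adj ?W \<eta> \<alpha> \<beta> K'" and K': "K' - {v} = K"
      and L: "\<And>w. w \<in> K' \<Longrightarrow> swap_on \<alpha> \<beta> K' \<eta> w \<in> L w" for \<eta> \<alpha> \<beta> K K'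
  proof (intro exI conjI)
    show "kempe_step adj ?W L \<eta> (swap_on \<alpha> \<beta> K' \<eta>)" using \<eta> K L by (rule kempe_step_swap_on)
    have "K \<subseteq> W'" using K K' v by (auto simp: kempe_closed_def)
    then show "restrict (swap_on \<alpha> \<beta> K' \<eta>) W' = swap_on \<alpha> \<beta> K (restrict \<eta> W')"
      using K' v by (auto simp: swap_on_def fun_eq_iff)
  qed
  \<comment> \<open>Assuming \<open>\<eta> v \<noteq> \<beta>\<close> loses nothing, since \<alpha>
    and \<beta> can be exchanged; only \<alpha> needs care at \<open>v\<close>.\<close>
  have lift1: "\<exists>\<eta>'. kempe_equiv adj ?W L \<eta> \<eta>' \<and> restrict \<eta>' W' = swap_on \<alpha> \<beta> K (restrict \<eta> W')"
    if \<eta>: "coloring adj ?W L \<eta>" and K: "kempe_closed adj W' (restrict \<eta> W') \<alpha> \<beta> K"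
      and s: "coloring adj W' L (swap_on \<alpha> \<beta> K (restrict \<eta> W'))"
      and ncol: "\<eta> v \<noteq> \<beta>" for \<eta> \<alpha> \<beta> K
  proof -
    have KW: "K \<subseteq> W'" using K by (auto simp: kempe_closed_def)
    have colK: "\<eta> u \<in> {\<alpha>, \<beta>}" if "u \<in> K" for u using K that KW by (auto simp: kempe_closed_def)
    have LK: "Transposition.transpose \<alpha> \<beta> (\<eta> u) \<in> L u" if "u \<in> K" for u
      using coloring_in[OF s, of u] that KW by (auto simp: swap_on_def)
    have clos: "w \<in> K" if "u \<in> K" "w \<in> W'" "adj u w" "\<eta> w \<in> {\<alpha>, \<beta>}" for u w
      using K that KW by (auto simp: kempe_closed_def)
    have easy: "\<exists>\<eta>'. kempe_equiv adj ?W L \<eta>1 \<eta>' \<and> restrict \<eta>' W' = swap_on \<alpha> \<beta> K (restrict \<eta> W')"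
      if "coloring adj ?W L \<eta>1" "restrict \<eta>1 W' = restrict \<eta> W'"
        and nb: "\<eta>1 v \<notin> {\<alpha>, \<beta>} \<or> (\<forall>u\<in>K. \<not> adj u v)" for \<eta>1
    proof -
      have e: "\<eta>1 u = \<eta> u" if "u \<in> W'" for u
        using \<open>restrict \<eta>1 W' = restrict \<eta> W'\<close> that by (metis restrict_apply')
      have "kempe_closed adj ?W \<eta>1 \<alpha> \<beta> K"
        unfolding kempe_closed_def
      proof (intro conjI ballI impI)
        show "K \<subseteq> {w \<in> ?W. \<eta>1 w \<in> {\<alpha>, \<beta>}}"
        proof
          fix w assume "w \<in> K"
          then show "w \<in> {w \<in> ?W. \<eta>1 w \<in> {\<alpha>, \<beta>}}" using colK[of w] e[of w] KW by auto
        qed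
        fix a b assume ab: "a \<in> K" "b \<in> ?W" "adj a b \<and> \<eta>1 b \<in> {\<alpha>, \<beta>}"
        then have "b \<noteq> v" using nb by blast
        then have "b \<in> W'" using ab by blast
        then show "b \<in> K" using clos[of a b] e[of b] ab by simp
      qed
      moreover have "K - {v} = K" using KW v by blast
      moreover have "swap_on \<alpha> \<beta> K \<eta>1 w \<in> L w" if "w \<in> K" for w
        using that LK[OF that] e[of w] KW by (auto simp: swap_on_def)
      ultimately obtain \<eta>' where "kempe_step adj ?W L \<eta>1 \<eta>'"
          "restrict \<eta>' W' = swap_on \<alpha> \<beta> K (restrict \<eta>1 W')"
        using lift0[OF \<open>coloring adj ?W L \<eta>1\<close>, of \<alpha> \<beta> K K] by blast
      then show ?thesis using \<open>restrict \<eta>1 W' = restrict \<eta> W'\<close> by (metis r_into_rtranclp)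
    qed
    show ?thesis
    proof (cases "\<eta> v = \<alpha> \<and> (\<exists>u\<in>K. adj u v)")
      case False
      then show ?thesis using easy[OF \<eta>] ncol by auto
    next
      case True
      then obtain u where u: "u \<in> K" "adj u v" and va: "\<eta> v = \<alpha>" by blast
      have uW: "u \<in> W'" using u KW by blast
      have ub: "\<eta> u = \<beta>" using colK[OF u(1)] coloring_neq[OF \<eta> _ _ u(2)] uW va by auto
      \<comment> \<open>If \<beta> is in the list of \<open>v\<close> and all its neighbors of color
        \<beta> are swapped, then \<open>v\<close> joins the swap. Otherwise it is moved to a third
        color first.\<close>
      show ?thesis
      proof (cases "\<beta> \<in> L v \<and> (\<forall>u'\<in>W'. adj u' v \<and> \<eta> u' = \<beta> \<longrightarrow> u' \<in> K)")
        case T: True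
        have "kempe_closed adj ?W \<eta> \<alpha> \<beta> (insert v K)"
          unfolding kempe_closed_def
        proof (intro conjI ballI impI)
          show "insert v K \<subseteq> {w \<in> ?W. \<eta> w \<in> {\<alpha>, \<beta>}}" using KW colK va by auto
          fix a b assume ab: "a \<in> insert v K" "b \<in> ?W" "adj a b \<and> \<eta> b \<in> {\<alpha>, \<beta>}"
          show "b \<in> insert v K"
          proof (cases "a = v")
            case True
            then have "\<eta> b \<noteq> \<alpha>" using coloring_neq[OF \<eta>, of v b] ab va by auto
            then show ?thesis using T ab adj_sym True by auto
          next
            case False
            then show ?thesis using ab clos by auto
          qed
        qed
        moreover have "insert v K - {v} = K" using KW v by auto
        moreover have "swap_on \<alpha> \<beta> (insert v K) \<eta> w \<in> L w" if "w \<in> insert v K" for w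
          using that LK T va by (auto simp: swap_on_def)
        ultimately obtain \<eta>' where "kempe_step adj ?W L \<eta> \<eta>'"
            "restrict \<eta>' W' = swap_on \<alpha> \<beta> K (restrict \<eta> W')"
          using lift0[OF \<eta>, of \<alpha> \<beta> "insert v K" K] by blast
        then show ?thesis by blast
      next
        case F: False
        \<comment> \<open>The neighbor \<open>u\<close> blocks no color of its own at
          \<open>v\<close>: its color \<beta> is missing from \<open>L v\<close>, or is also blocked
          by a neighbor outside \<open>K\<close>. Yet \<open>u\<close> counts in \<open>?N\<close>,
          since its list and \<open>L v\<close> share \<alpha>. So a color other than \<alpha> is
          free.\<close>
        have sub: "L v \<inter> \<eta> ` {u \<in> W'. adj v u} \<subseteq> \<eta> ` (?N - {u}) \<and> u \<in> ?N"
        proof -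
          have uN: "u \<in> ?N"
            using uW u adj_sym LK[OF u(1)] ub coloring_in[OF \<eta>, of v] va by auto
          have "\<eta> a \<in> \<eta> ` (?N - {u})" if a: "a \<in> W'" "adj v a" "\<eta> a \<in> L v" for a
          proof (cases "a = u")
            case False
            then show ?thesis using a coloring_in[OF \<eta>, of a] by auto
          next
            case True
            then have "\<beta> \<in> L v" using a ub by simp
            then obtain u' where u': "u' \<in> W'" "adj u' v" "\<eta> u' = \<beta>" "u' \<notin> K" using F by blast
            then have "u' \<in> ?N - {u}"
              using u(1) adj_sym coloring_in[OF \<eta>, of u'] \<open>\<beta> \<in> L v\<close> by auto
            moreover have "\<eta> a = \<eta> u'" using u' ub True by simp
            ultimately show ?thesis by (intro image_eqI)
          qed
          then have "L v \<inter> \<eta> ` {u \<in> W'. adj v u} \<subseteq> \<eta> ` (?N - {u})" by auto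
          then show ?thesis using uN by (rule conjI)
        qed
        have "card (L v \<inter> \<eta> ` {u \<in> W'. adj v u}) \<le> card (\<eta> ` (?N - {u}))"
          using sub fin by (intro card_mono) auto
        also have "\<dots> \<le> card (?N - {u})" using fin by (intro card_image_le) auto
        also have "\<dots> < card ?N" using sub fin by (intro psubset_card_mono) auto
        finally have "card (L v \<inter> \<eta> ` {u \<in> W'. adj v u}) + 1 < card (L v)" using deg by linarith
        then have "card (insert \<alpha> (L v \<inter> \<eta> ` {u \<in> W'. adj v u})) < card (L v)"
          using card_insert_le_m1[of "card (L v)"] fin card_insert_if[of "L v \<inter> \<eta> ` {u \<in> W'. adj v u}" \<alpha>] by simp
        then have "\<not> L v \<subseteq> insert \<alpha> (L v \<inter> \<eta> ` {u \<in> W'. adj v u})"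
          using card_mono[of "insert \<alpha> (L v \<inter> \<eta> ` {u \<in> W'. adj v u})" "L v"] fin by auto
        then obtain \<gamma> where \<gamma>: "\<gamma> \<in> L v" "\<gamma> \<noteq> \<alpha>" "\<gamma> \<notin> \<eta> ` {u \<in> W'. adj v u}" by blast
        let ?\<eta>1 = "\<eta>(v := \<gamma>)"
        have st: "kempe_step adj ?W L \<eta> ?\<eta>1"
          using \<gamma> adj_irrefl by (intro kempe_step_recolor[OF \<eta>]) auto
        have "\<gamma> \<noteq> \<beta>" using \<gamma>(3) uW u(2) ub adj_sym by auto
        then have "\<exists>\<eta>'. kempe_equiv adj ?W L ?\<eta>1 \<eta>' \<and> restrict \<eta>' W' = swap_on \<alpha> \<beta> K (restrict \<eta> W')"
          using st v \<gamma>(2) by (intro easy) (auto simp: kempe_step_def)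
        then show ?thesis using st by (meson converse_rtranclp_into_rtranclp)
      qed
    qed
  qed
  have lift: "\<exists>\<eta>'. kempe_equiv adj ?W L \<eta> \<eta>' \<and> restrict \<eta>' W' = \<phi>'"
    if st: "kempe_step adj W' L \<phi> \<phi>'" and \<eta>: "coloring adj ?W L \<eta>" and r: "restrict \<eta> W' = \<phi>" for \<phi> \<phi>' \<eta>
  proof -
    obtain \<alpha> \<beta> K where K: "kempe_closed adj W' \<phi> \<alpha> \<beta> K" "\<phi>' = swap_on \<alpha> \<beta> K \<phi>" "coloring adj W' L \<phi>'"
      using st unfolding kempe_step_def by blast
    show ?thesis
    proof (cases "\<eta> v = \<beta>")
      case False
      then show ?thesis using lift1[OF \<eta>, of \<alpha> \<beta> K] K r by auto
    next
      case True
      show ?thesis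
      proof (cases "\<alpha> = \<beta>")
        case True
        then have "\<phi>' = \<phi>" using K by (auto simp: swap_on_def)
        then show ?thesis using r by blast
      next
        case False
        then show ?thesis using lift1[OF \<eta>, of \<beta> \<alpha> K] K r True
          by (metis kempe_closed_commute swap_on_commute)
      qed
    qed
  qed
  show ?thesis unfolding swappable_def
  proof (intro allI impI)
    fix \<eta>1 \<eta>2 assume c: "coloring adj ?W L \<eta>1" "coloring adj ?W L \<eta>2"
    have "kempe_equiv adj W' L (restrict \<eta>1 W') (restrict \<eta>2 W')"
      using sw coloring_restrict[OF c(1), of W'] coloring_restrict[OF c(2), of W']
      unfolding swappable_def by blast
    then obtain \<eta>' where \<eta>': "kempe_equiv adj ?W L \<eta>1 \<eta>'" "restrict \<eta>' W' = restrict \<eta>2 W'"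
      using lift_kempe_equiv[OF _ c(1) refl] lift by blast
    have c': "coloring adj ?W L \<eta>'" using kempe_equiv_coloring \<eta>' c by blast
    have e: "\<eta>' u = \<eta>2 u" if "u \<in> W'" for u using \<eta>'(2) that by (metis restrict_apply')
    have "\<eta>2 w = (\<eta>'(v := \<eta>2 v)) w" for w
      using e c c' by (cases "w \<in> ?W") (auto simp: coloring_def PiE_def extensional_def)
    then have "\<eta>2 = \<eta>'(v := \<eta>2 v)" by (rule ext)
    moreover have "kempe_step adj ?W L \<eta>' (\<eta>'(v := \<eta>2 v))"
    proof (rule kempe_step_recolor[OF c'])
      show "\<eta>2 v \<in> L v" using coloring_in[OF c(2)] by auto
      fix u assume "u \<in> ?W" "adj v u"
      then show "\<eta>' u \<noteq> \<eta>2 v" using e coloring_neq[OF c(2), of v u] adj_irrefl by auto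
    qed simp
    ultimately show "kempe_equiv adj ?W L \<eta>1 \<eta>2" using \<eta>'(1) by (metis rtranclp.rtrancl_into_rtrancl)
  qed
qed

end

section \<open>Cyclic lists of size two\<close>

lemma periodic_mult:
  fixes f :: "int \<Rightarrow> 'b"
  assumes "\<And>i. f (i + n) = f i"
  shows "f (i + k * n) = f i"
proof (induction k arbitrary: i rule: int_induct[where k = 0])
  case (step1 k)
  have "f (i + (k + 1) * n) = f (i + k * n + n)" by (simp add: algebra_simps)
  then show ?case using assms step1 by simp
next
  case (step2 k)
  have "f (i + (k - 1) * n) = f (i + (k - 1) * n + n)" using assms by simp
  also have "\<dots> = f (i + k * n)" by (simp add: algebra_simps)
  finally show ?case using step2 by simp
qed simp

lemma periodic_mod:
  fixes f :: "int \<Rightarrow> 'b"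
  assumes "\<And>i. f (i + n) = f i"
  shows "f (i mod n) = f i"
  using periodic_mult[of f n "i mod n" "i div n", OF assms] by simp

text \<open>Positions on the cycle are all integers, read with period \<open>n\<close>; rotation and
  reflection then become index substitutions.\<close>

locale cyclic_lists =
  fixes n :: int and M :: "int \<Rightarrow> 'c set"
  assumes n_even: "even n" and n_ge: "n \<ge> 2" and M_periodic: "M (i + n) = M i" and M_card: "card (M i) = 2"
begin

definition pcol :: "(int \<Rightarrow> 'c) \<Rightarrow> bool" where
  "pcol c \<longleftrightarrow> (\<forall>i. c (i + n) = c i \<and> c i \<in> M i \<and> c i \<noteq> c (i + 1))"

lemma pcol_periodic: "pcol c \<Longrightarrow> c (i + n) = c i" and pcol_in: "pcol c \<Longrightarrow> c i \<in> M i"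
  and pcol_neq: "pcol c \<Longrightarrow> c i \<noteq> c (i + 1)"
  by (auto simp: pcol_def)

lemma M_mod: "M (i mod n) = M i"
  by (rule periodic_mod) (rule M_periodic)

lemma M_minus1: "M (n - 1) = M (- 1)"
  using M_periodic[of "-1"] by simp

lemma pcol_minus1: "pcol c \<Longrightarrow> c (n - 1) = c (- 1)"
  using pcol_periodic[of c "-1"] by simp

lemma other_in_list:
  assumes "u \<in> M i"
  obtains v where "v \<noteq> u" "M i = {u, v}"
  using M_card[of i] assms by (metis card_2_iff doubleton_eq_iff insertE singletonD)

lemma succ_mod:
  obtains (step) "i mod n < n - 1" "(i + 1) mod n = i mod n + 1"
  | (wrap) "i mod n = n - 1" "(i + 1) mod n = 0"
proof (cases "i mod n < n - 1")
  case True
  then have "(i mod n + 1) mod n = i mod n + 1" using n_ge by (intro mod_pos_pos_trivial) auto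
  then show ?thesis using step True by (metis mod_add_left_eq)
next
  case False
  then have "i mod n = n - 1" using n_ge pos_mod_bound[of n i] by linarith
  moreover then have "(i + 1) mod n = 0" by (metis diff_add_cancel mod_add_left_eq mod_self)
  ultimately show ?thesis by (rule wrap)
qed

lemma pcolI:
  assumes "\<And>j. 0 \<le> j \<Longrightarrow> j < n \<Longrightarrow> h j \<in> M j"
    and "\<And>j. 0 \<le> j \<Longrightarrow> j < n - 1 \<Longrightarrow> h j \<noteq> h (j + 1)" and "h (n - 1) \<noteq> h 0"
  shows "pcol (\<lambda>i. h (i mod n))"
  unfolding pcol_def
proof (intro allI conjI)
  fix i
  have b: "0 \<le> i mod n" "i mod n < n" using n_ge by auto
  show "h ((i + n) mod n) = h (i mod n)" by simp
  show "h (i mod n) \<in> M i" using assms(1)[OF b] M_mod by simp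
  show "h (i mod n) \<noteq> h ((i + 1) mod n)"
    by (cases i rule: succ_mod) (use assms(2)[OF b(1)] assms(3) in auto)
qed

text \<open>Coloring onward from position 0 never gets stuck, and the last color cannot clash with
  \<open>u\<close> because its list lacks \<open>u\<close>. After a color in \<open>S\<close>, a
  list not inside \<open>S\<close> offers a color outside \<open>S\<close>, which is automatically
  different. The one step without such a choice is the closing one, onto position 0.\<close>

lemma greedy0:
  assumes u: "u \<in> M 0" "u \<notin> M (- 1)"
  obtains c where "pcol c" "c 0 = u"
    "\<And>i. c i \<in> S \<Longrightarrow> c (i + 1) \<in> S \<Longrightarrow> \<not> n dvd i + 1 \<Longrightarrow> M (i + 1) \<subseteq> S"
proof -
  let ?P = "\<lambda>i x. x \<in> M (int i) \<and> (i = 0 \<longrightarrow> x = u)"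
  let ?Q = "\<lambda>i x y. y \<noteq> x \<and> (x \<in> S \<and> y \<in> S \<longrightarrow> M (int (Suc i)) \<subseteq> S)"
  have "\<exists>g. \<forall>i. ?P i (g i) \<and> ?Q i (g i) (g (Suc i))"
  proof (rule dependent_nat_choice)
    show "\<exists>x. ?P 0 x" using u by auto
    fix x i assume "?P i x"
    show "\<exists>y. ?P (Suc i) y \<and> ?Q i x y"
    proof (cases "x \<in> S \<and> \<not> M (int (Suc i)) \<subseteq> S")
      case True
      then show ?thesis by auto
    next
      case False
      obtain a b where "M (int (Suc i)) = {a, b}" "a \<noteq> b" using M_card by (meson card_2_iff)
      then have "\<exists>y. y \<in> M (int (Suc i)) \<and> y \<noteq> x" by auto
      then show ?thesis using False by auto
    qed
  qed
  then obtain g where g: "\<And>i. ?P i (g i)" "\<And>i. ?Q i (g i) (g (Suc i))" by blast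
  define h where "h = (\<lambda>j. g (nat j))"
  have hM: "h j \<in> M j" if "0 \<le> j" for j using g(1)[of "nat j"] that by (simp add: h_def)
  have hs: "h (j + 1) \<noteq> h j \<and> (h j \<in> S \<and> h (j + 1) \<in> S \<longrightarrow> M (j + 1) \<subseteq> S)" if "0 \<le> j" for j
    using g(2)[of "nat j"] that by (auto simp: h_def nat_add_distrib add.commute)
  have h0: "h 0 = u" using g(1)[of 0] by (simp add: h_def)
  show ?thesis
  proof (rule that[of "\<lambda>i. h (i mod n)"])
    have "h (n - 1) \<noteq> h 0" using hM[of "n - 1"] n_ge u h0 M_minus1 by auto
    then show "pcol (\<lambda>i. h (i mod n))" using hM hs by (intro pcolI) (auto simp: eq_commute)
    show "h (0 mod n) = u" using h0 by simp
    fix i assume *: "h (i mod n) \<in> S" "h ((i + 1) mod n) \<in> S" "\<not> n dvd i + 1"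
    show "M (i + 1) \<subseteq> S"
    proof (cases i rule: succ_mod)
      case step
      then show ?thesis using * hs[of "i mod n"] n_ge M_mod[of "i + 1"] by auto
    next
      case wrap
      then show ?thesis using * by auto
    qed
  qed
qed

end

lemma cyclic_lists_shift: "cyclic_lists n M \<Longrightarrow> cyclic_lists n (\<lambda>i. M (i + p))"
  unfolding cyclic_lists_def by (metis add.assoc add.commute)

lemma cyclic_lists_reflect: "cyclic_lists n M \<Longrightarrow> cyclic_lists n (\<lambda>i. M (- i))"
  unfolding cyclic_lists_def by (metis add.commute add_uminus_conv_diff diff_add_cancel minus_add_distrib)

lemma pcol_shift:
  "cyclic_lists n M \<Longrightarrow> cyclic_lists.pcol n M c \<Longrightarrow> cyclic_lists.pcol n (\<lambda>i. M (i + p)) (\<lambda>i. c (i + p))"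
  using cyclic_lists_shift[of n M p] by (simp add: cyclic_lists.pcol_def) (metis add.assoc add.commute)

lemma pcol_reflect:
  assumes "cyclic_lists n M" "cyclic_lists.pcol n M c"
  shows "cyclic_lists.pcol n (\<lambda>i. M (- i)) (\<lambda>i. c (- i))"
proof -
  interpret cyclic_lists n M by fact
  have "c (- (i + n)) = c (- i)" "c (- i) \<noteq> c (- (i + 1))" for i
    using pcol_periodic[OF assms(2), of "- (i + n)"] pcol_neq[OF assms(2), of "- (i + 1)"] by auto
  then show ?thesis
    using cyclic_lists_reflect[OF assms(1)] pcol_in[OF assms(2)] by (simp add: cyclic_lists.pcol_def)
qed

section \<open>Reaching colorings of the cycle in which runs of two swap colors are
  controlled\<close>

context cyclic_lists
begin

lemma greedy:
  assumes u: "u \<in> M p" "u \<notin> M (p - 1)"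
  obtains c where "pcol c" "c p = u"
    "\<And>i. c i \<in> S \<Longrightarrow> c (i + 1) \<in> S \<Longrightarrow> \<not> n dvd i + 1 - p \<Longrightarrow> M (i + 1) \<subseteq> S"
proof -
  interpret s: cyclic_lists n "\<lambda>i. M (i + p)" by (rule cyclic_lists_shift) unfold_locales
  obtain c where c: "s.pcol c" "c 0 = u"
    "\<And>i. c i \<in> S \<Longrightarrow> c (i + 1) \<in> S \<Longrightarrow> \<not> n dvd i + 1 \<Longrightarrow> M (i + 1 + p) \<subseteq> S"
    using s.greedy0[of u S] u by auto
  show ?thesis
  proof (rule that[of "\<lambda>i. c (i - p)"])
    show "pcol (\<lambda>i. c (i - p))"
      using pcol_shift[OF cyclic_lists_shift[OF cyclic_lists_axioms, of p] c(1), of "- p"] by simp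
    show "c (p - p) = u" using c by simp
    show "M (i + 1) \<subseteq> S" if "c (i - p) \<in> S" "c (i + 1 - p) \<in> S" "\<not> n dvd i + 1 - p" for i
      using c(3)[of "i - p"] that by (simp add: algebra_simps)
  qed
qed

text \<open>
  In a good coloring every run of colors from \<open>S\<close> contains at most one position whose list is not
  inside \<open>S\<close>. Hence a lifted Kempe component that enters the cycle has no way out.
\<close>

definition good :: "'c set \<Rightarrow> (int \<Rightarrow> 'c) \<Rightarrow> bool" where
  "good S c \<longleftrightarrow>
     (\<forall>i. c i \<in> S \<and> c (i + 1) \<in> S \<longrightarrow> M (i + 1) \<subseteq> S) \<or>
     (\<forall>i. c i \<in> S \<and> c (i - 1) \<in> S \<longrightarrow> M (i - 1) \<subseteq> S)"

lemma good_reflect: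
  assumes "cyclic_lists.good (\<lambda>i. M (- i)) S (\<lambda>i. c (- i))"
  shows "good S c"
proof -
  interpret r: cyclic_lists n "\<lambda>i. M (- i)" by (rule cyclic_lists_reflect) unfold_locales
  consider "\<And>i. c (- i) \<in> S \<Longrightarrow> c (- (i + 1)) \<in> S \<Longrightarrow> M (- (i + 1)) \<subseteq> S"
    | "\<And>i. c (- i) \<in> S \<Longrightarrow> c (- (i - 1)) \<in> S \<Longrightarrow> M (- (i - 1)) \<subseteq> S"
    using assms unfolding r.good_def by blast
  then show ?thesis
  proof cases
    case 1
    then have "M (i - 1) \<subseteq> S" if "c i \<in> S" "c (i - 1) \<in> S" for i
      using 1[of "- i"] that by simp
    then show ?thesis by (auto simp: good_def)
  next
    case 2
    then have "M (i + 1) \<subseteq> S" if "c i \<in> S" "c (i + 1) \<in> S" for i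
      using 2[of "- i"] that by (simp add: add.commute)
    then show ?thesis by (auto simp: good_def)
  qed
qed

text \<open>\<open>greedy\<close> leaves one step uncontrolled, the closing step from
  \<open>p - 1\<close> to \<open>p\<close>; the second disjunct is its failure.\<close>

lemma greedy_good:
  assumes u: "u \<in> M p" "u \<notin> M (p - 1)"
  obtains c where "pcol c" "c p = u" "good S c \<or> u \<in> S \<and> c (p - 1) \<in> S \<and> \<not> M p \<subseteq> S"
proof -
  obtain c where c: "pcol c" "c p = u"
    "\<And>i. c i \<in> S \<Longrightarrow> c (i + 1) \<in> S \<Longrightarrow> \<not> n dvd i + 1 - p \<Longrightarrow> M (i + 1) \<subseteq> S"
    using greedy[OF u] by blast
  have "good S c" if "\<not> (u \<in> S \<and> c (p - 1) \<in> S \<and> \<not> M p \<subseteq> S)"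
    unfolding good_def
  proof (intro disjI1 allI impI)
    fix i assume i: "c i \<in> S \<and> c (i + 1) \<in> S"
    show "M (i + 1) \<subseteq> S"
    proof (cases "n dvd i + 1 - p")
      case True
      then obtain k where k: "i + 1 - p = k * n" by (metis dvd_def mult.commute)
      then have i: "i = p - 1 + k * n" "i + 1 = p + k * n" by simp_all
      have "M (i + 1) = M p" "c (i + 1) = c p"
        unfolding i(2) using periodic_mult[of M n p k] periodic_mult[of c n p k]
          M_periodic pcol_periodic[OF c(1)] by simp_all
      moreover have "c i = c (p - 1)"
        unfolding i(1) by (rule periodic_mult) (rule pcol_periodic[OF c(1)])
      ultimately show ?thesis using that \<open>c i \<in> S \<and> c (i + 1) \<in> S\<close> c(2) by auto
    qed (use i c(3) in blast)
  qed
  then show ?thesis using that c by blast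
qed

lemma greedy_good_reflect:
  assumes u: "u \<in> M p" "u \<notin> M (p + 1)"
  obtains c where "pcol c" "c p = u" "good S c \<or> u \<in> S \<and> c (p + 1) \<in> S \<and> \<not> M p \<subseteq> S"
proof -
  interpret r: cyclic_lists n "\<lambda>i. M (- i)" by (rule cyclic_lists_reflect) unfold_locales
  obtain c where c: "r.pcol c" "c (- p) = u" "r.good S c \<or> u \<in> S \<and> c (- p - 1) \<in> S \<and> \<not> M p \<subseteq> S"
    using r.greedy_good[of u "- p" S] u by (auto simp: add.commute)
  show ?thesis
  proof (rule that[of "\<lambda>i. c (- i)"])
    show "pcol (\<lambda>i. c (- i))" using pcol_reflect[OF r.cyclic_lists_axioms c(1)] by simp
    show "c (- p) = u" by fact
    show "good S (\<lambda>i. c (- i)) \<or> u \<in> S \<and> c (- (p + 1)) \<in> S \<and> \<not> M p \<subseteq> S"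
      using c(3) good_reflect[of S "\<lambda>i. c (- i)"] by auto
  qed
qed

text \<open>Delaying all colors by one position after a place where the coloring is not forced.\<close>

lemma delay_colors:
  assumes c: "pcol c" "c 0 \<notin> M (- 1)" and ex: "\<exists>i. 1 \<le> i \<and> i \<le> n - 1 \<and> M i \<noteq> {c (i - 1), c i}"
  obtains c' where "pcol c'" "c' 0 = c 0" "c' (- 1) \<noteq> c (- 1)"
proof -
  define A where "A = {i. 1 \<le> i \<and> i \<le> n - 1 \<and> M i \<noteq> {c (i - 1), c i}}"
  have fin: "finite A" by (rule finite_subset[of _ "{1..n}"]) (auto simp: A_def)
  define i where "i = Max A"
  have iA: "i \<in> A" unfolding i_def using fin ex by (intro Max_in) (auto simp: A_def)
  have later: "M j = {c (j - 1), c j}" if "i < j" "j \<le> n - 1" for j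
    using Max_ge[OF fin, of j] that iA unfolding i_def A_def by fastforce
  have i: "1 \<le> i" "i \<le> n - 1" "M i \<noteq> {c (i - 1), c i}" using iA by (auto simp: A_def)
  obtain w where w: "w \<noteq> c i" "M i = {c i, w}" using other_in_list[OF pcol_in[OF c(1)]] by metis
  have w': "w \<noteq> c (i - 1)" using w i by auto
  \<comment> \<open>After the last unforced position \<open>i\<close> every list is
    \<open>{c (j - 1), c j}\<close>, so \<open>c (j - 1)\<close> may be used at \<open>j\<close>.
    The switch is made at \<open>i\<close> with the other color \<open>w\<close>, which differs from
    \<open>c (i - 1)\<close> because \<open>i\<close> is unforced.\<close>
  define h where "h = (\<lambda>j. if j < i then c j else if j = i then w else c (j - 1))"
  have hM: "h j \<in> M j" if "j \<le> n - 1" for j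
    using that later[of j] w pcol_in[OF c(1)] by (auto simp: h_def)
  have hn: "h j \<noteq> h (j + 1)" for j
    using w w' pcol_neq[OF c(1), of j] pcol_neq[OF c(1), of "j - 1"]
    by (cases "j + 1 < i"; cases "j + 1 = i"; cases "j = i"; force simp: h_def)
  have h0: "h 0 = c 0" using i by (simp add: h_def)
  have hl: "h (n - 1) \<noteq> c (n - 1)"
    using w i pcol_neq[OF c(1), of "n - 2"] by (auto simp: h_def)
  show ?thesis
  proof (rule that[of "\<lambda>i. h (i mod n)"])
    have "h (n - 1) \<noteq> h 0" using hM[of "n - 1"] c(2) M_minus1 h0 by auto
    then show "pcol (\<lambda>i. h (i mod n))" using hM hn by (intro pcolI) auto
    show "h (0 mod n) = c 0" using h0 by simp
    have "(- 1) mod n = n - 1" using n_ge by (simp add: zmod_minus1)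
    then show "h ((- 1) mod n) \<noteq> c (- 1)" using hl pcol_minus1[OF c(1)] by simp
  qed
qed

text \<open>Delaying is tried in both directions around the cycle. If both fail, the lists strictly
  between the two ends are forced from both sides, so colors repeat with period two from 0 to
  \<open>n - 1\<close>. As \<open>n\<close> is even, the color at -1 then equals the color at 1 and
  lies in \<open>M 0\<close>, against the hypothesis.\<close>

lemma delay_colors_either:
  assumes c: "pcol c" "c 0 \<notin> M (- 1)" "c (- 1) \<notin> M 0"
  obtains c' where "pcol c'" "c' 0 = c 0" "c' (- 1) \<noteq> c (- 1)"
    | c' where "pcol c'" "c' (- 1) = c (- 1)" "c' 0 \<noteq> c 0"
proof (cases "\<exists>i. 1 \<le> i \<and> i \<le> n - 1 \<and> M i \<noteq> {c (i - 1), c i}")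
  case True
  then show ?thesis using delay_colors[OF c(1,2)] that(1) by blast
next
  case forced: False
  interpret s: cyclic_lists n "\<lambda>i. M (i + - 1)" by (rule cyclic_lists_shift) unfold_locales
  interpret r: cyclic_lists n "\<lambda>i. M (- i + - 1)" by (rule cyclic_lists_reflect) unfold_locales
  let ?d = "\<lambda>i. c (- i + - 1)"
  have d: "r.pcol ?d"
    by (rule pcol_reflect[OF s.cyclic_lists_axioms pcol_shift[OF cyclic_lists_axioms c(1)]])
  have "\<exists>i. 1 \<le> i \<and> i \<le> n - 1 \<and> M (- i + - 1) \<noteq> {?d (i - 1), ?d i}"
  proof (rule ccontr)
    assume no: "\<not> ?thesis"
    have b: "M i = {c (i + 1), c i}" if "0 \<le> i" "i \<le> n - 2" for i
    proof -
      have "1 \<le> n - 1 - i \<and> n - 1 - i \<le> n - 1" using that by auto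
      then have "M (- (n - 1 - i) + - 1) = {?d (n - 1 - i - 1), ?d (n - 1 - i)}"
        using no by blast
      then show ?thesis
        using M_periodic[of "i - n"] pcol_periodic[OF c(1), of "i - n"] pcol_periodic[OF c(1), of "i + 1 - n"]
        by (simp add: algebra_simps)
    qed
    have f: "M i = {c (i - 1), c i}" if "1 \<le> i" "i \<le> n - 1" for i using forced that by auto
    have two: "c (i + 1) = c (i - 1)" if "1 \<le> i" "i \<le> n - 2" for i
      using b[of i] f[of i] that pcol_neq[OF c(1), of i] pcol_neq[OF c(1), of "i - 1"]
      by (auto simp: doubleton_eq_iff)
    have odd_pos: "c (1 + 2 * int j) = c 1" if "1 + 2 * int j \<le> n - 1" for j
      using that
    proof (induction j)
      case (Suc j)
      then show ?case using two[of "2 + 2 * int j"] by (simp add: algebra_simps)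
    qed simp
    obtain m where m: "n = 2 * m" using n_even by blast
    have "1 + 2 * int (nat (m - 1)) = n - 1" using m n_ge by simp
    then have "c (n - 1) = c 1" using odd_pos[of "nat (m - 1)"] by (metis order_refl)
    then show False using b[of 0] n_ge c(3) pcol_minus1[OF c(1)] by simp
  qed
  then obtain d' where d': "r.pcol d'" "d' 0 = ?d 0" "d' (- 1) \<noteq> ?d (- 1)"
    using r.delay_colors[OF d] c(3) by auto
  have "pcol (\<lambda>i. d' (- (i + 1)))"
    using pcol_shift[OF cyclic_lists_reflect[OF r.cyclic_lists_axioms]
        pcol_reflect[OF r.cyclic_lists_axioms d'(1)], of 1] by simp
  then show ?thesis using that(2)[of "\<lambda>i. d' (- (i + 1))"] d' by simp
qed

text \<open>\<open>R\<close> stands for Kempe equivalence of glued colorings. It is granted only for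
  colorings that agree at a position whose color is missing from a list next to it, since holding
  that color cuts the cycle into a path; a good coloring has to be reached by such moves
  alone.\<close>

lemma good_coloring_related:
  assumes c: "pcol c"
    and R: "\<And>d d' p. pcol d \<Longrightarrow> pcol d' \<Longrightarrow> d p = d' p \<Longrightarrow> d p \<notin> M (p - 1) \<or> d p \<notin> M (p + 1) \<Longrightarrow> R d d'"
    and R_refl: "\<And>d. pcol d \<Longrightarrow> R d d" and R_trans: "\<And>d d' d''. R d d' \<Longrightarrow> R d' d'' \<Longrightarrow> R d d''"
  obtains d where "pcol d" "R c d" "good {\<alpha>, \<beta>} d"
proof -
  let ?S = "{\<alpha>, \<beta>}"
  \<comment> \<open>A starting color outside \<open>?S\<close> cannot take part in a failure of the
    closing step.\<close>
  have start: "\<exists>d. pcol d \<and> R c d \<and> good ?S d"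
    if e: "pcol e" "R c e" "e p \<notin> ?S" "e p \<notin> M (p - 1) \<or> e p \<notin> M (p + 1)" for e p
  proof (cases "e p \<notin> M (p - 1)")
    case True
    obtain d where "pcol d" "d p = e p" "good ?S d"
      using greedy_good[OF pcol_in[OF e(1)] True, of ?S] e(3) by auto
    then show ?thesis using R[OF e(1), of d p] e R_trans by metis
  next
    case False
    then have F: "e p \<notin> M (p + 1)" using e by blast
    obtain d where "pcol d" "d p = e p" "good ?S d"
      using greedy_good_reflect[OF pcol_in[OF e(1)] F, of ?S] e(3) by auto
    then show ?thesis using R[OF e(1), of d p] e R_trans by metis
  qed
  \<comment> \<open>The only way the greedy coloring can fail: it closes up with \<open>\<alpha>\<close> and \<open>\<beta>\<close> on adjacent positions.\<close>
  have conflict: "\<exists>d. pcol d \<and> R c d \<and> good ?S d"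
    if e: "pcol e" "R c e" "e p \<in> ?S" "e (p - 1) \<in> ?S" "e p \<notin> M (p - 1)" "e (p - 1) \<notin> M p" for e p
  proof -
    interpret s: cyclic_lists n "\<lambda>i. M (i + p)" by (rule cyclic_lists_shift) unfold_locales
    obtain x where x: "M p = {e p, x}" "x \<noteq> e p" using other_in_list[OF pcol_in[OF e(1)]] by metis
    obtain y where y: "M (p - 1) = {e (p - 1), y}" "y \<noteq> e (p - 1)" using other_in_list[OF pcol_in[OF e(1)]] by metis
    have ne: "e p \<noteq> e (p - 1)" using pcol_neq[OF e(1), of "p - 1"] by simp
    have xS: "x \<notin> ?S" and yS: "y \<notin> ?S" using x y e ne by auto
    have all: "R c d" if d: "pcol d" "d p = e p \<or> d (p - 1) = e (p - 1)" for d
      using d(2)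
    proof
      assume "d p = e p"
      then show ?thesis using R[OF e(1) d(1), of p] e R_trans by metis
    next
      assume "d (p - 1) = e (p - 1)"
      then show ?thesis using R[OF e(1) d(1), of "p - 1"] e R_trans by auto
    qed
    show ?thesis
    proof (cases "x = y")
      case True
      \<comment> \<open>No coloring has \<open>x\<close> at both \<open>p - 1\<close> and
        \<open>p\<close>, so each one keeps \<open>e p\<close> or \<open>e (p - 1)\<close> in place:
        all colorings are related to \<open>c\<close>, and any good one will do.\<close>
      have allR: "R c d" if d: "pcol d" for d
      proof (rule all[OF d])
        show "d p = e p \<or> d (p - 1) = e (p - 1)"
          using pcol_in[OF d, of p] pcol_in[OF d, of "p - 1"] pcol_neq[OF d, of "p - 1"] x y True by auto
      qed
      show ?thesis
      proof (cases "\<exists>q u. u \<in> M q \<and> u \<notin> ?S \<and> (u \<notin> M (q - 1) \<or> u \<notin> M (q + 1))")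
        case True
        then obtain q u where qu: "u \<in> M q" "u \<notin> ?S" "u \<notin> M (q - 1) \<or> u \<notin> M (q + 1)" by blast
        have "\<exists>d. pcol d \<and> d q = u"
          using qu greedy_good[of u q ?S] greedy_good_reflect[of u q ?S] by metis
        then show ?thesis using start[of _ q] allR qu by metis
      next
        case False
        \<comment> \<open>Here every color outside \<open>?S\<close> spreads from a list to both
          neighboring lists, so \<open>x\<close> lies in all of them. With \<open>x\<close> on every
          second position, no two adjacent colors lie in \<open>?S\<close>.\<close>
        have xall: "x \<in> M (p + j)" for j
        proof (induction j rule: int_induct[where k = 0])
          case (step1 i)
          then show ?case using False xS by (metis add.assoc)
        next
          case (step2 i)
          then show ?case using False xS by (metis add_diff_eq)
        qed (use x in simp)
        define h where "h = (\<lambda>j::int. if even j then x else SOME u. u \<in> M j \<and> u \<noteq> x)"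
        have h: "h j \<in> M j \<and> (even j \<longleftrightarrow> h j = x)" for j
        proof -
          have xj: "x \<in> M j" using xall[of "j - p"] by simp
          obtain u where "u \<noteq> x" "M j = {x, u}" using other_in_list[OF xj] .
          then have "\<exists>u. u \<in> M j \<and> u \<noteq> x" by auto
          then show ?thesis using xj someI_ex[of "\<lambda>u. u \<in> M j \<and> u \<noteq> x"] by (auto simp: h_def)
        qed
        have pc: "pcol (\<lambda>i. h (i mod n))"
        proof (rule pcolI)
          show "h j \<in> M j" for j using h by blast
          show "h j \<noteq> h (j + 1)" for j using h[of j] h[of "j + 1"] by auto
          show "h (n - 1) \<noteq> h 0" using h[of "n - 1"] h[of 0] n_even by auto
        qed
        have ev: "even (i mod n) \<longleftrightarrow> even i" for i using n_even by (simp add: dvd_mod_iff)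
        have "good ?S (\<lambda>i. h (i mod n))"
          unfolding good_def
        proof (intro disjI1 allI impI)
          fix i assume "h (i mod n) \<in> ?S \<and> h ((i + 1) mod n) \<in> ?S"
          then have "odd i" "odd (i + 1)" using h[of "i mod n"] h[of "(i + 1) mod n"] ev xS by auto
          then show "M (i + 1) \<subseteq> ?S" by simp
        qed
        then show ?thesis using pc allR by blast
      qed
    next
      case False
      have sp: "s.pcol (\<lambda>i. e (i + p))" by (rule pcol_shift[OF cyclic_lists_axioms e(1)])
      have unshift: "pcol (\<lambda>i. d (i - p))" if "s.pcol d" for d
        using pcol_shift[OF s.cyclic_lists_axioms that, of "- p"] by simp
      \<comment> \<open>Delaying keeps one of the two colors at the closing step and changes the
        other. The changed one becomes \<open>y\<close> or \<open>x\<close>, which is outside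
        \<open>?S\<close> and missing from the list across, so \<open>start\<close> applies
        there.\<close>
      consider d where "s.pcol d" "d 0 = e p" "d (- 1) \<noteq> e (p - 1)"
        | d where "s.pcol d" "d (- 1) = e (p - 1)" "d 0 \<noteq> e p"
        using s.delay_colors_either[OF sp] e(5,6) by (auto simp: add.commute)
      then show ?thesis
      proof cases
        case (1 d)
        let ?f = "\<lambda>i. d (i - p)"
        have f: "pcol ?f" by (rule unshift) fact
        have "?f (p - 1) = y" using pcol_in[OF f, of "p - 1"] y 1 by auto
        moreover have "y \<notin> M p" using x False yS e by auto
        moreover have "R c ?f" using all[OF f] 1 by simp
        ultimately show ?thesis using start[OF f, of "p - 1"] yS by simp
      next
        case (2 d)
        let ?f = "\<lambda>i. d (i - p)"
        have f: "pcol ?f" by (rule unshift) fact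
        have "?f p = x" using pcol_in[OF f, of p] x 2 by auto
        moreover have "x \<notin> M (p - 1)" using y False xS e by auto
        moreover have "R c ?f" using all[OF f] 2 by simp
        ultimately show ?thesis using start[OF f, of p] xS by simp
      qed
    qed
  qed
  have "\<exists>d. pcol d \<and> R c d \<and> good ?S d"
  proof (cases "\<exists>p. c p \<notin> M (p - 1) \<or> c p \<notin> M (p + 1)")
    case False
    \<comment> \<open>If every color also lies in both neighboring lists, then each list consists of
      its own color and the preceding one, hence is inside \<open>?S\<close> once both of these
      are.\<close>
    have "good ?S c"
      unfolding good_def
    proof (intro disjI1 allI impI)
      fix i assume i: "c i \<in> ?S \<and> c (i + 1) \<in> ?S"
      have "c i \<in> M (i + 1)" "c (i + 1) \<in> M (i + 1)" using False pcol_in[OF c] by auto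
      then have "M (i + 1) = {c i, c (i + 1)}"
        using pcol_neq[OF c, of i] other_in_list[of "c i" "i + 1"] by (metis insertE singletonD)
      then show "M (i + 1) \<subseteq> ?S" using i by simp
    qed
    then show ?thesis using c R_refl by blast
  next
    case True
    then obtain p where "c p \<notin> M (p - 1) \<or> c p \<notin> M (p + 1)" by blast
    then show ?thesis
    proof
      assume p: "c p \<notin> M (p - 1)"
      obtain d where d: "pcol d" "d p = c p" "good ?S d \<or> c p \<in> ?S \<and> d (p - 1) \<in> ?S \<and> \<not> M p \<subseteq> ?S"
        using greedy_good[OF pcol_in[OF c] p, of ?S] by blast
      have Rd: "R c d" using R[OF c d(1), of p] d p by auto
      show ?thesis
      proof (cases "good ?S d")
        case False
        then have *: "c p \<in> ?S" "d (p - 1) \<in> ?S" "\<not> M p \<subseteq> ?S" using d by auto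
        obtain x where x: "M p = {c p, x}" using other_in_list[OF pcol_in[OF c]] by metis
        have "d (p - 1) \<notin> M p" using * x pcol_neq[OF d(1), of "p - 1"] d(2) by auto
        then show ?thesis using conflict[of d p] d Rd * p by auto
      qed (use d Rd in blast)
    next
      assume p: "c p \<notin> M (p + 1)"
      obtain d where d: "pcol d" "d p = c p" "good ?S d \<or> c p \<in> ?S \<and> d (p + 1) \<in> ?S \<and> \<not> M p \<subseteq> ?S"
        using greedy_good_reflect[OF pcol_in[OF c] p, of ?S] by blast
      have Rd: "R c d" using R[OF c d(1), of p] d p by auto
      show ?thesis
      proof (cases "good ?S d")
        case False
        then have *: "c p \<in> ?S" "d (p + 1) \<in> ?S" "\<not> M p \<subseteq> ?S" using d by auto
        obtain x where x: "M p = {c p, x}" using other_in_list[OF pcol_in[OF c]] by metis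
        have "d (p + 1) \<notin> M p" using * x pcol_neq[OF d(1), of p] d(2) by auto
        then show ?thesis using conflict[of d "p + 1"] d Rd * p by auto
      qed (use d Rd in blast)
    qed
  qed
  then show ?thesis using that by blast
qed

text \<open>A color missing from the previous list lets the greedy coloring close up. If there is
  none, all lists coincide, and their two colors alternate since \<open>n\<close> is even.\<close>

lemma ex_pcol: "\<exists>c. pcol c"
proof (cases "\<exists>p u. u \<in> M p \<and> u \<notin> M (p - 1)")
  case True
  then show ?thesis using greedy by metis
next
  case False
  obtain a b where ab: "M 0 = {a, b}" "a \<noteq> b" using M_card by (meson card_2_iff)
  have eq: "M (p - 1) = M p" for p
    using False M_card[of p] M_card[of "p - 1"] by (metis card.infinite card_subset_eq subsetI zero_neq_numeral)
  have M: "M i = {a, b}" for i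
  proof (induction i rule: int_induct[where k = 0])
    case (step1 i)
    then show ?case using eq[of "i + 1"] by simp
  qed (use ab eq in auto)
  let ?h = "\<lambda>i::int. if even i then a else b"
  have "pcol (\<lambda>i. ?h (i mod n))" using ab n_even M by (intro pcolI) auto
  then show ?thesis by blast
qed

end

section \<open>Removing an even cycle\<close>

text \<open>Cuts a list down to two colors without separating \<alpha> from \<beta>, unless it has
  only two to begin with. With three or more colors, either two of them avoid \<alpha> and \<beta>,
  or both of these are present.\<close>

lemma two_subset_avoiding:
  assumes "finite A" "card A \<ge> 2" "\<alpha> \<noteq> \<beta>"
  shows "\<exists>T\<subseteq>A. card T = 2 \<and> (card A = 2 \<longrightarrow> T = A) \<and> (card A \<noteq> 2 \<longrightarrow> T \<inter> {\<alpha>, \<beta>} = {} \<or> T = {\<alpha>, \<beta>})"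
proof (cases "card A = 2")
  case False
  show ?thesis
  proof (cases "card (A - {\<alpha>, \<beta>}) \<ge> 2")
    case True
    then obtain T where "T \<subseteq> A - {\<alpha>, \<beta>}" "card T = 2" by (meson obtain_subset_with_card_n)
    then show ?thesis using False by blast
  next
    case small: False
    have "card A = card (A - {\<alpha>, \<beta>}) + card (A \<inter> {\<alpha>, \<beta>})"
      using assms card_Int_Diff[of A "{\<alpha>, \<beta>}"] by simp
    then have "card (A \<inter> {\<alpha>, \<beta>}) \<ge> 2" using assms False small by linarith
    then have "A \<inter> {\<alpha>, \<beta>} = {\<alpha>, \<beta>}"
      using assms by (intro card_seteq) auto
    then show ?thesis using assms False by (intro exI[of _ "{\<alpha>, \<beta>}"]) auto
  qed
qed auto

text \<open>By \<open>adj_v\<close> the cycle is induced, and \<open>degree_le\<close> counts only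
  neighbors outside it: whatever their colors are, two colors remain at every position.\<close>

locale kempe_cycle = sym_adj adj for adj :: "'a \<Rightarrow> 'a \<Rightarrow> bool" +
  fixes n :: int and v :: "int \<Rightarrow> 'a" and W' :: "'a set" and L :: "'a \<Rightarrow> 'c set"
  assumes n_even: "even n" and n_ge: "n \<ge> 4" and v_periodic: "v (i + n) = v i"
    and v_inj: "inj_on v {0..<n}"
    and adj_v: "adj (v i) (v j) \<longleftrightarrow> v j = v (i + 1) \<or> v j = v (i - 1)"
    and v_notin: "v i \<notin> W'" and finite_W': "finite W'" and finite_L: "finite (L (v i))"
    and degree_le: "card {u \<in> W'. adj (v i) u} + 2 \<le> card (L (v i))"
begin

abbreviation "W \<equiv> W' \<union> range v"

definition avail :: "('a \<Rightarrow> 'c) \<Rightarrow> 'a \<Rightarrow> 'c set" where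
  "avail \<phi> x = L x - \<phi> ` {u \<in> W'. adj x u}"

definition glue :: "('a \<Rightarrow> 'c) \<Rightarrow> (int \<Rightarrow> 'c) \<Rightarrow> 'a \<Rightarrow> 'c" where
  "glue \<phi> c = (\<lambda>x. if x \<in> range v then c (SOME i. v i = x) else \<phi> x)"

lemma v_mod: "v (i mod n) = v i"
  by (rule periodic_mod) (rule v_periodic)

lemma v_eq_iff: "v i = v j \<longleftrightarrow> n dvd i - j"
proof
  assume "v i = v j"
  then have "v (i mod n) = v (j mod n)" by (simp add: v_mod)
  then have "i mod n = j mod n" using v_inj n_ge by (auto dest: inj_onD)
  then show "n dvd i - j" by (simp add: mod_eq_dvd_iff)
next
  assume "n dvd i - j"
  then show "v i = v j" using v_mod by (metis mod_eq_dvd_iff)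
qed

lemma card_avail: "card (avail \<phi> (v i)) \<ge> 2"
proof -
  have "card (L (v i)) - card (\<phi> ` {u \<in> W'. adj (v i) u}) \<le> card (avail \<phi> (v i))"
    unfolding avail_def using finite_W' by (intro diff_card_le_card_Diff) auto
  moreover have "card (\<phi> ` {u \<in> W'. adj (v i) u}) \<le> card {u \<in> W'. adj (v i) u}"
    using finite_W' by (intro card_image_le) auto
  ultimately show ?thesis using degree_le[of i] by linarith
qed

text \<open>The equality case of \<open>card_avail\<close>: no color of an outer neighbor is wasted.
  This controls the positions at which a swap from outside can enter the cycle.\<close>

lemma avail_exact:
  assumes "card (avail \<phi> (v i)) = 2"
  shows "inj_on \<phi> {u \<in> W'. adj (v i) u}" "\<phi> ` {u \<in> W'. adj (v i) u} \<subseteq> L (v i)"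
proof -
  let ?N = "{u \<in> W'. adj (v i) u}"
  have fin: "finite ?N" using finite_W' by auto
  have "card (L (v i)) = card (avail \<phi> (v i)) + card (L (v i) \<inter> \<phi> ` ?N)"
    unfolding avail_def using card_Int_Diff[OF finite_L[of i], of "\<phi> ` ?N"] by simp
  then have "card ?N \<le> card (L (v i) \<inter> \<phi> ` ?N)" using degree_le[of i] assms by linarith
  moreover have "card (L (v i) \<inter> \<phi> ` ?N) \<le> card (\<phi> ` ?N)" using fin by (intro card_mono) auto
  moreover have "card (\<phi> ` ?N) \<le> card ?N" using fin by (rule card_image_le)
  ultimately have e: "card (\<phi> ` ?N) = card ?N" "card (\<phi> ` ?N) \<le> card (L (v i) \<inter> \<phi> ` ?N)" by linarith+
  show "inj_on \<phi> ?N" using e fin by (simp add: eq_card_imp_inj_on)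
  have "L (v i) \<inter> \<phi> ` ?N = \<phi> ` ?N" using e fin by (intro card_seteq) auto
  then show "\<phi> ` ?N \<subseteq> L (v i)" by blast
qed

lemma glue_v: "(\<And>i. c (i + n) = c i) \<Longrightarrow> glue \<phi> c (v i) = c i"
proof -
  assume per: "\<And>i. c (i + n) = c i"
  define j where "j = (SOME j. v j = v i)"
  have "v j = v i" unfolding j_def by (rule someI) simp
  then have "j mod n = i mod n" by (simp add: v_eq_iff mod_eq_dvd_iff)
  then have "c j = c i" using periodic_mod[of c n, OF per] by metis
  then show ?thesis by (simp add: glue_def j_def)
qed

lemma glue_outer: "x \<in> W' \<Longrightarrow> glue \<phi> c x = \<phi> x"
  using v_notin by (auto simp: glue_def)

lemma coloring_glue:
  assumes \<phi>: "coloring adj W' L \<phi>" and per: "\<And>i. c (i + n) = c i"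
    and c: "\<And>i. c i \<in> avail \<phi> (v i)" "\<And>i. c i \<noteq> c (i + 1)"
  shows "coloring adj W L (glue \<phi> c)"
proof -
  have "glue \<phi> c x \<in> L x" if "x \<in> W" for x
    using that coloring_in[OF \<phi>] glue_outer glue_v[of c, OF per] c(1) by (auto simp: avail_def)
  moreover have "glue \<phi> c x = undefined" if "x \<notin> W" for x
    using that \<phi> by (auto simp: glue_def coloring_def)
  moreover have "glue \<phi> c x \<noteq> glue \<phi> c y" if xy: "x \<in> W" "y \<in> W" "adj x y" for x y
  proof -
    have mixed: "\<phi> w \<noteq> c i" if "w \<in> W'" "adj (v i) w" for w i
    proof
      assume "\<phi> w = c i"
      then have "c i \<in> \<phi> ` {u \<in> W'. adj (v i) u}" using that by (intro image_eqI[of _ _ w]) auto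
      then show False using c(1)[of i] by (simp add: avail_def)
    qed
    have vv: "c i \<noteq> c j" if "adj (v i) (v j)" for i j
    proof -
      have "c j = c (i + 1) \<or> c j = c (i - 1)"
        using that glue_v[of c, OF per] unfolding adj_v by metis
      then show ?thesis using c(2)[of i] c(2)[of "i - 1"] by auto
    qed
    show ?thesis
      using xy mixed vv coloring_neq[OF \<phi>] glue_outer glue_v[of c, OF per] adj_sym
      by (elim UnE rangeE) (metis+)
  qed
  ultimately show ?thesis by (auto simp: coloring_def PiE_def extensional_def)
qed

lemma coloring_cycle:
  assumes \<eta>: "coloring adj W L \<eta>"
  shows "\<eta> (v i) \<in> avail \<eta> (v i)" "\<eta> (v i) \<noteq> \<eta> (v (i + 1))" "\<eta> (v (i + n)) = \<eta> (v i)"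
proof -
  show "\<eta> (v i) \<in> avail \<eta> (v i)"
    using coloring_in[OF \<eta>] coloring_neq[OF \<eta>] by (fastforce simp: avail_def)
  show "\<eta> (v i) \<noteq> \<eta> (v (i + 1))" using coloring_neq[OF \<eta>] adj_v by blast
  show "\<eta> (v (i + n)) = \<eta> (v i)" by (simp add: v_periodic)
qed

lemma avail_cong: "(\<And>u. u \<in> W' \<Longrightarrow> \<phi> u = \<psi> u) \<Longrightarrow> avail \<phi> x = avail \<psi> x"
  unfolding avail_def by auto

lemma glue_restrict:
  assumes "coloring adj W L \<eta>"
  shows "glue (restrict \<eta> W') (\<lambda>i. \<eta> (v i)) = \<eta>"
proof
  fix x show "glue (restrict \<eta> W') (\<lambda>i. \<eta> (v i)) x = \<eta> x"
  proof (cases "x \<in> range v")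
    case True
    then show ?thesis using glue_v[of "\<lambda>i. \<eta> (v i)"] by (auto simp: v_periodic)
  next
    case False
    then show ?thesis using assms by (auto simp: glue_def coloring_def)
  qed
qed

text \<open>Vertices are added one by one from \<open>p\<close> in direction \<open>s\<close>; each
  has two colors and sees only its predecessor with an intersecting list. The last one,
  \<open>v (p - s)\<close>, is also adjacent to \<open>v p\<close>, so \<open>v p\<close> is either
  left out or has a list disjoint from that of \<open>v (p - s)\<close>.\<close>

lemma swappable_along:
  assumes s: "s = 1 \<or> s = - 1"
    and B: "B = W' \<or> B = insert (v p) W' \<and> L' (v p) \<inter> L' (v (p - s)) = {}"
    and sw: "swappable adj B L'"
    and outer: "\<And>u i. u \<in> W' \<Longrightarrow> adj (v i) u \<Longrightarrow> L' u \<inter> L' (v i) = {}"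
    and L': "\<And>i. v i \<noteq> v p \<Longrightarrow> finite (L' (v i)) \<and> card (L' (v i)) \<ge> 2"
    and m: "int m \<le> n - 1"
  shows "swappable adj (B \<union> (\<lambda>t. v (p + s * t)) ` {1..int m}) L'"
  using m
proof (induction m)
  case 0
  then show ?case using sw by simp
next
  case (Suc m)
  let ?B = "B \<union> (\<lambda>t. v (p + s * t)) ` {1..int m}"
  let ?x = "v (p + s * (int m + 1))"
  have dvd_s: "n dvd s * a \<longleftrightarrow> n dvd a" for a using s by auto
  have eq: "v (p + s * a) = v (p + s * b) \<longleftrightarrow> n dvd a - b" for a b
    unfolding v_eq_iff using dvd_s[of "a - b"] by (simp add: algebra_simps)
  have sm: "\<not> n dvd a" if "0 < a" "a < n" for a using that zdvd_not_zless by blast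
  have xp: "?x \<noteq> v p" using eq[of "int m + 1" 0] sm[of "int m + 1"] Suc.prems by auto
  have fresh: "?x \<notin> ?B"
  proof -
    have "?x \<noteq> v (p + s * t)" if "t \<in> {1..int m}" for t
      unfolding eq using that Suc.prems by (intro sm) auto
    then have "?x \<notin> (\<lambda>t. v (p + s * t)) ` {1..int m}" by blast
    then show ?thesis using B v_notin xp by blast
  qed
  have fin: "finite ?B" using B finite_W' by auto
  have nb: "u = v (p + s * int m)" if u: "u \<in> ?B" "adj ?x u" "L' u \<inter> L' ?x \<noteq> {}" for u
  proof -
    have "u \<notin> W'" using outer u by blast
    then have "u = v p \<and> B \<noteq> W' \<or> (\<exists>t\<in>{1..int m}. u = v (p + s * t))" using u(1) B by blast
    then have "\<exists>t. u = v (p + s * t) \<and> 0 \<le> t \<and> t \<le> int m \<and> (t = 0 \<longrightarrow> B \<noteq> W')"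
    proof
      assume "u = v p \<and> B \<noteq> W'"
      then show ?thesis by (intro exI[of _ 0]) auto
    next
      assume "\<exists>t\<in>{1..int m}. u = v (p + s * t)"
      then obtain t where "t \<in> {1..int m}" "u = v (p + s * t)" by blast
      then show ?thesis by (intro exI[of _ t]) auto
    qed
    then obtain t where t: "u = v (p + s * t)" "0 \<le> t" "t \<le> int m" "t = 0 \<Longrightarrow> B \<noteq> W'" by blast
    have "u = v (p + s * int m) \<or> u = v (p + s * (int m + 2))"
      using u(2) s unfolding t(1) adj_v by (auto simp: algebra_simps)
    \<comment> \<open>The vertex ahead could be present only when the path has come round to
      \<open>v p\<close>, and that pair has disjoint lists.\<close>
    moreover have False if "u = v (p + s * (int m + 2))"
    proof -
      have d: "n dvd int m + 2 - t" using that eq t(1) by metis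
      have "int m + 2 - t = n"
      proof (rule ccontr)
        assume "int m + 2 - t \<noteq> n"
        then have "int m + 2 - t < n" using t Suc.prems by linarith
        then show False using d sm[of "int m + 2 - t"] t by auto
      qed
      then have tm: "t = 0" "int m = n - 2" using t Suc.prems by auto
      have up: "u = v p" using t tm by simp
      have "?x = v (p - s)" unfolding v_eq_iff tm(2) using s by (auto simp: algebra_simps)
      moreover have "L' (v p) \<inter> L' (v (p - s)) = {}" using B t(4) tm by blast
      ultimately show False using u(3) up by simp
    qed
    ultimately show ?thesis by blast
  qed
  have "card {u \<in> ?B. adj ?x u \<and> L' u \<inter> L' ?x \<noteq> {}} \<le> card {v (p + s * int m)}"
    using nb by (intro card_mono) auto
  then have "swappable adj (insert ?x ?B) L'"
    using L'[OF xp] fresh fin Suc by (intro swappable_insert) auto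
  moreover have "insert ?x ?B = B \<union> (\<lambda>t. v (p + s * t)) ` {1..int (Suc m)}"
  proof -
    have "{1..int (Suc m)} = insert (int m + 1) {1..int m}" by auto
    then show ?thesis by auto
  qed
  ultimately show ?case by simp
qed

lemma range_along:
  assumes "s = 1 \<or> s = - 1"
  shows "insert (v p) ((\<lambda>t. v (p + s * t)) ` {1..n - 1}) = range v"
proof (intro equalityI subsetI)
  fix x assume "x \<in> range v"
  then obtain i where i: "x = v i" by blast
  let ?t = "(s * (i - p)) mod n"
  have "n dvd s * (i - p) - ?t" by (simp add: dvd_minus_mod)
  then have "n dvd s * (s * (i - p) - ?t)" by simp
  then have "x = v (p + s * ?t)" unfolding i v_eq_iff using assms by (auto simp: algebra_simps)
  moreover have "0 \<le> ?t" "?t \<le> n - 1" using n_ge pos_mod_bound[of n] by (auto simp: zle_diff1_eq)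
  ultimately show "x \<in> insert (v p) ((\<lambda>t. v (p + s * t)) ` {1..n - 1})"
    by (cases "?t = 0") auto
qed auto

lemma swappable_singletons: "swappable adj B (\<lambda>x. {\<phi> x})"
  unfolding swappable_def
proof (intro allI impI)
  fix \<eta> \<psi> assume "coloring adj B (\<lambda>x. {\<phi> x}) \<eta>" "coloring adj B (\<lambda>x. {\<phi> x}) \<psi>"
  note c = this
  have "\<eta> = \<psi>"
    by (rule coloring_eqI[OF c]) (use coloring_in[OF c(1)] coloring_in[OF c(2)] in auto)
  then show "kempe_equiv adj B (\<lambda>x. {\<phi> x}) \<eta> \<psi>" by simp
qed

lemma swappable_cong:
  assumes "\<And>x. x \<in> B \<Longrightarrow> L1 x = L2 x" "swappable adj B L1"
  shows "swappable adj B L2"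
proof -
  have "coloring adj B L1 = coloring adj B L2"
    using assms(1) by (auto simp: coloring_def fun_eq_iff PiE_def Pi_def)
  then have "kempe_step adj B L1 = kempe_step adj B L2" by (simp add: kempe_step_def fun_eq_iff)
  with \<open>coloring adj B L1 = coloring adj B L2\<close> show ?thesis using assms(2) by (simp add: swappable_def)
qed

text \<open>Freezing \<open>B\<close> with one-color lists turns equivalence of extensions into
  swappability; swaps valid for the smaller lists are valid for \<open>L\<close>.\<close>

lemma kempe_equiv_fixing:
  assumes \<eta>: "coloring adj W L \<eta>" "coloring adj W L \<eta>'"
    and B: "W' \<subseteq> B" "\<And>u. u \<in> B \<Longrightarrow> \<eta> u = \<eta>' u"
    and sw: "swappable adj W (\<lambda>x. if x \<in> B then {\<eta> x} else avail \<eta> x)"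
  shows "kempe_equiv adj W L \<eta> \<eta>'"
proof -
  let ?L = "\<lambda>x. if x \<in> B then {\<eta> x} else avail \<eta> x"
  have "\<psi> x \<in> ?L x" if "coloring adj W L \<psi>" "\<And>u. u \<in> B \<Longrightarrow> \<eta> u = \<psi> u" "x \<in> W" for \<psi> x
  proof (cases "x \<in> B")
    case False
    then have "x \<in> range v" using \<open>x \<in> W\<close> B(1) by blast
    then obtain i where "x = v i" by blast
    moreover have "avail \<eta> x = avail \<psi> x" using that(2) B(1) by (intro avail_cong) blast
    ultimately show ?thesis using False coloring_cycle(1)[OF that(1), of i] by simp
  qed (use that in simp)
  then have "coloring adj W ?L \<eta>" "coloring adj W ?L \<eta>'"
    using \<eta> B(2) by (simp_all add: coloring_def PiE_def Pi_def)
  then have "kempe_equiv adj W ?L \<eta> \<eta>'" using sw by (simp add: swappable_def)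
  then show ?thesis
  proof (rule kempe_equiv_mono)
    show "?L x \<subseteq> L x" if "x \<in> W" for x
      using that coloring_in[OF \<eta>(1), of x] by (auto simp: avail_def)
  qed
qed

lemma kempe_equiv_same_at:
  assumes \<eta>: "coloring adj W L \<eta>" "coloring adj W L \<eta>'"
    and out: "\<And>u. u \<in> W' \<Longrightarrow> \<eta> u = \<eta>' u" and p: "\<eta> (v p) = \<eta>' (v p)"
    and s: "s = 1 \<or> s = - 1" and free: "\<eta> (v p) \<notin> avail \<eta> (v (p - s))"
  shows "kempe_equiv adj W L \<eta> \<eta>'"
proof -
  let ?B = "insert (v p) W'"
  define L' where "L' x = (if x \<in> ?B then {\<eta> x} else avail \<eta> x)" for x
  have "adj (v p) (v (p - s))" using s adj_v by auto
  then have nep: "v (p - s) \<noteq> v p" using adj_irrefl by metis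
  have "swappable adj ?B L'"
    by (rule swappable_cong[OF _ swappable_singletons[of ?B \<eta>]]) (simp add: L'_def)
  moreover have "L' u \<inter> L' (v i) = {}" if "u \<in> W'" "adj (v i) u" for u i
  proof (cases "v i = v p")
    case True
    then show ?thesis using that coloring_neq[OF \<eta>(1), of "v i" u] by (auto simp: L'_def)
  qed (use that v_notin in \<open>auto simp: L'_def avail_def\<close>)
  moreover have "finite (L' (v i)) \<and> card (L' (v i)) \<ge> 2" if "v i \<noteq> v p" for i
    using that v_notin card_avail finite_L by (auto simp: L'_def avail_def)
  moreover have "L' (v p) \<inter> L' (v (p - s)) = {}"
    using nep free v_notin by (auto simp: L'_def)
  ultimately have "swappable adj (?B \<union> (\<lambda>t. v (p + s * t)) ` {1..int (nat (n - 1))}) L'"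
    using n_ge by (intro swappable_along[OF s]) auto
  moreover have "?B \<union> (\<lambda>t. v (p + s * t)) ` {1..int (nat (n - 1))} = W"
    using range_along[OF s, of p] n_ge by auto
  ultimately have "swappable adj W L'" by simp
  then show ?thesis
    unfolding L'_def using out p by (intro kempe_equiv_fixing[OF \<eta>, of ?B]) auto
qed

text \<open>Add \<open>v p\<close> last: it sees two cycle neighbors and has three colors, while
  every other vertex sees at most one and has two.\<close>

lemma kempe_equiv_slack:
  assumes \<eta>: "coloring adj W L \<eta>" "coloring adj W L \<eta>'"
    and out: "\<And>u. u \<in> W' \<Longrightarrow> \<eta> u = \<eta>' u" and slack: "card (avail \<eta> (v p)) \<ge> 3"
  shows "kempe_equiv adj W L \<eta> \<eta>'"
proof -
  define L' where "L' x = (if x \<in> W' then {\<eta> x} else avail \<eta> x)" for x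
  let ?B = "W' \<union> (\<lambda>t. v (p + 1 * t)) ` {1..int (nat (n - 1))}"
  have "swappable adj W' L'"
    by (rule swappable_cong[OF _ swappable_singletons[of W' \<eta>]]) (simp add: L'_def)
  moreover have outer: "L' u \<inter> L' (v i) = {}" if "u \<in> W'" "adj (v i) u" for u i
    using that v_notin by (auto simp: L'_def avail_def)
  moreover have fin: "finite (L' (v i)) \<and> card (L' (v i)) \<ge> 2" for i
    using v_notin card_avail finite_L by (auto simp: L'_def avail_def)
  ultimately have "swappable adj ?B L'" using n_ge by (intro swappable_along) auto
  moreover have "v p \<notin> ?B"
  proof -
    have "v p \<noteq> v (p + 1 * t)" if "t \<in> {1..int (nat (n - 1))}" for t
      unfolding v_eq_iff using that n_ge zdvd_not_zless[of t n] by auto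
    then have "v p \<notin> (\<lambda>t. v (p + 1 * t)) ` {1..int (nat (n - 1))}" by blast
    then show ?thesis using v_notin by blast
  qed
  moreover have "card {u \<in> ?B. adj (v p) u \<and> L' u \<inter> L' (v p) \<noteq> {}} \<le> card {v (p + 1), v (p - 1)}"
    using outer adj_v by (intro card_mono) auto
  moreover have "card {v (p + 1), v (p - 1)} \<le> 2" by (simp add: card_insert_if)
  ultimately have "swappable adj (insert (v p) ?B) L'"
    using slack v_notin fin[of p] finite_W' by (intro swappable_insert) (auto simp: L'_def)
  moreover have "insert (v p) ?B = W"
    using range_along[of 1 p] n_ge by auto
  ultimately have "swappable adj W L'" by simp
  then show ?thesis
    unfolding L'_def using out by (intro kempe_equiv_fixing[OF \<eta>, of W']) auto
qed

text \<open>Once the cycle has a good coloring, the swap is performed on \<open>K\<close> together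
  with the part \<open>Y\<close> of the cycle to which it spreads. Goodness and
  \<open>avail_exact\<close> keep \<open>Y\<close> from leaving the cycle at a new place and put
  both swap colors into every list on \<open>Y\<close>.\<close>

lemma lift_step:
  assumes st: "kempe_step adj W' L \<phi> \<phi>'" and \<eta>: "coloring adj W L \<eta>" and r: "restrict \<eta> W' = \<phi>"
  shows "\<exists>\<eta>'. kempe_equiv adj W L \<eta> \<eta>' \<and> restrict \<eta>' W' = \<phi>'"
proof -
  obtain \<alpha> \<beta> K where K: "kempe_closed adj W' \<phi> \<alpha> \<beta> K" and \<phi>': "\<phi>' = swap_on \<alpha> \<beta> K \<phi>"
    and c\<phi>: "coloring adj W' L \<phi>" and c\<phi>': "coloring adj W' L \<phi>'"
    using st unfolding kempe_step_def by blast
  have e: "\<eta> u = \<phi> u" if "u \<in> W'" for u using r that by (metis restrict_apply')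
  show ?thesis
  proof (cases "\<alpha> = \<beta>")
    case True
    then have "\<phi>' = \<phi>" using \<phi>' by (auto simp: swap_on_def)
    then show ?thesis using r by blast
  next
    case ne: False
    define P where "P A T \<longleftrightarrow> T \<subseteq> A \<and> card T = 2 \<and> (card A = 2 \<longrightarrow> T = A) \<and>
       (card A \<noteq> 2 \<longrightarrow> T \<inter> {\<alpha>, \<beta>} = {} \<or> T = {\<alpha>, \<beta>})" for A T :: "'c set"
    have "\<forall>A. \<exists>T. finite A \<and> 2 \<le> card A \<longrightarrow> P A T"
      unfolding P_def using two_subset_avoiding[OF _ _ ne] by blast
    from choice[OF this] obtain sub where sub: "\<And>A. finite A \<Longrightarrow> 2 \<le> card A \<Longrightarrow> P A (sub A)" by blast
    define M where "M i = sub (avail \<phi> (v i))" for i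
    have "P (avail \<phi> (v i)) (M i)" for i
      unfolding M_def using finite_L by (intro sub card_avail) (simp add: avail_def)
    then have M: "M i \<subseteq> avail \<phi> (v i)" "card (M i) = 2" "card (avail \<phi> (v i)) = 2 \<Longrightarrow> M i = avail \<phi> (v i)"
      "card (avail \<phi> (v i)) \<noteq> 2 \<Longrightarrow> M i \<inter> {\<alpha>, \<beta>} = {} \<or> M i = {\<alpha>, \<beta>}" for i
      unfolding P_def by blast+
    interpret cl: cyclic_lists n M
      by unfold_locales (use n_even n_ge M in \<open>auto simp: M_def v_periodic\<close>)
    have col: "coloring adj W L (glue \<phi> c)" if "cl.pcol c" for c
      using that M(1) by (intro coloring_glue[OF c\<phi>]) (auto simp: cl.pcol_def)
    have gv: "glue \<phi> c (v i) = c i" if "cl.pcol c" for c i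
      using that by (intro glue_v) (auto simp: cl.pcol_def)
    \<comment> \<open>With slack somewhere, all extensions of \<open>\<phi>\<close> are equivalent
      and any good coloring serves. Without slack, \<open>M i\<close> is all of
      \<open>avail \<phi> (v i)\<close>, and a good coloring is reached from \<open>\<eta>\<close>
      by moves that cut the cycle open.\<close>
    obtain d where d: "cl.pcol d" "cl.good {\<alpha>, \<beta>} d" "kempe_equiv adj W L \<eta> (glue \<phi> d)"
    proof (cases "\<exists>p. card (avail \<phi> (v p)) \<ge> 3")
      case True
      then obtain p where p: "card (avail \<phi> (v p)) \<ge> 3" by blast
      obtain c where "cl.pcol c" using cl.ex_pcol by blast
      then obtain d where d: "cl.pcol d" "cl.good {\<alpha>, \<beta>} d"
        using cl.good_coloring_related[of c "\<lambda>_ _. True" \<alpha> \<beta>] by blast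
      have "avail \<eta> (v p) = avail \<phi> (v p)" using e by (rule avail_cong)
      then have "kempe_equiv adj W L \<eta> (glue \<phi> d)"
        using p e glue_outer by (intro kempe_equiv_slack[OF \<eta> col[OF d(1)], of p]) auto
      then show ?thesis using that d by blast
    next
      case False
      have two: "card (avail \<phi> (v i)) = 2" for i
        using False card_avail[of \<phi> i] by (metis Suc_leI eval_nat_numeral(3) le_neq_implies_less)
      let ?c = "\<lambda>i. \<eta> (v i)"
      have "avail \<eta> (v i) = avail \<phi> (v i)" for i using e by (rule avail_cong)
      then have c: "cl.pcol ?c" using coloring_cycle[OF \<eta>] M(3)[OF two] by (simp add: cl.pcol_def)
      let ?R = "\<lambda>d d'. kempe_equiv adj W L (glue \<phi> d) (glue \<phi> d')"
      have R: "?R d d'" if d: "cl.pcol d" "cl.pcol d'" "d p = d' p" "d p \<notin> M (p - 1) \<or> d p \<notin> M (p + 1)" for d d' p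
      proof -
        have av: "avail (glue \<phi> d) (v i) = M i" for i
          using M(3)[OF two] avail_cong[of "glue \<phi> d" \<phi>] glue_outer by metis
        obtain s :: int where s: "s = 1 \<or> s = - 1" "d p \<notin> M (p - s)" using d(4) by force
        show ?thesis
          by (rule kempe_equiv_same_at[OF col[OF d(1)] col[OF d(2)] _ _ s(1), of p])
            (use d s glue_outer gv av in auto)
      qed
      obtain d where "cl.pcol d" "?R ?c d" "cl.good {\<alpha>, \<beta>} d"
        by (rule cl.good_coloring_related[OF c, where R = ?R and \<alpha> = \<alpha> and \<beta> = \<beta>])
          (use R in \<open>auto intro: rtranclp_trans\<close>)
      then show ?thesis using that glue_restrict[OF \<eta>] r by metis
    qed
    let ?\<psi> = "glue \<phi> d"
    let ?S = "{\<alpha>, \<beta>}"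
    obtain s :: int where s: "s = 1 \<or> s = - 1"
      and rule: "\<And>i. d i \<in> ?S \<Longrightarrow> d (i + s) \<in> ?S \<Longrightarrow> M (i + s) \<subseteq> ?S"
    proof -
      have "(\<forall>i. d i \<in> ?S \<and> d (i + 1) \<in> ?S \<longrightarrow> M (i + 1) \<subseteq> ?S) \<or>
            (\<forall>i. d i \<in> ?S \<and> d (i + - 1) \<in> ?S \<longrightarrow> M (i + - 1) \<subseteq> ?S)"
        using d(2) unfolding cl.good_def by simp
      then show ?thesis using that[of 1] that[of "- 1"] by blast
    qed
    have full: "M i = ?S" if "M i \<subseteq> ?S" for i
      using that M(2)[of i] ne by (intro card_seteq) auto
    have dM: "d i \<in> M i" for i using d(1) by (rule cl.pcol_in)
    have dv: "?\<psi> (v i) = d i" for i using gv d(1) by blast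
    have KW: "K \<subseteq> W'" using K by (auto simp: kempe_closed_def)
    have Kcol: "\<phi> u \<in> ?S" if "u \<in> K" for u using K that by (auto simp: kempe_closed_def)
    have outer_neq: "\<phi> u \<noteq> d i" if "u \<in> W'" "adj (v i) u" for i u
    proof
      assume "\<phi> u = d i"
      then have "d i \<in> \<phi> ` {u \<in> W'. adj (v i) u}" using that by (intro image_eqI[of _ _ u]) auto
      then show False using dM[of i] M(1)[of i] by (auto simp: avail_def)
    qed
    have full_no: "\<phi> u \<notin> ?S" if "M i = ?S" "u \<in> W'" "adj (v i) u" for i u
      using M(1)[of i] that by (auto simp: avail_def)
    \<comment> \<open>\<open>v j\<close> is reached if the colors from \<open>j\<close> back to
      \<open>j - s * m\<close> all lie in \<open>?S\<close> and that earlier position touches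
      \<open>K\<close>. One direction suffices: by \<open>rule\<close>, later positions of a run
      have list \<open>?S\<close> and hence no neighbor in \<open>K\<close>.\<close>
    define Y where "Y = {v j |j. \<exists>m::nat. (\<forall>t\<le>m. d (j - s * int t) \<in> ?S) \<and> (\<exists>w\<in>K. adj (v (j - s * int m)) w)}"
    have YD: "d j \<in> ?S \<and> (M j = ?S \<or> card (avail \<phi> (v j)) = 2 \<and> (\<exists>w\<in>K. adj (v j) w))"
      if t: "\<forall>t\<le>m. d (j - s * int t) \<in> ?S" "\<exists>w\<in>K. adj (v (j - s * int m)) w" for j and m :: nat
    proof (cases m)
      case 0
      then have "d j \<in> ?S" "\<exists>w\<in>K. adj (v j) w" using t by auto
      then show ?thesis using M(4)[of j] dM[of j] by blast
    next
      case (Suc m')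
      have "d (j - s) \<in> ?S" "d j \<in> ?S" using t(1)[rule_format, of 1] t(1)[rule_format, of 0] Suc by auto
      then have "M j \<subseteq> ?S" using rule[of "j - s"] by simp
      then show ?thesis using full \<open>d j \<in> ?S\<close> by blast
    qed
    have clos: "kempe_closed adj W ?\<psi> \<alpha> \<beta> (K \<union> Y)"
      unfolding kempe_closed_def
    proof (intro conjI ballI impI)
      show "K \<union> Y \<subseteq> {x \<in> W. ?\<psi> x \<in> ?S}"
      proof
        fix x assume "x \<in> K \<union> Y"
        then show "x \<in> {x \<in> W. ?\<psi> x \<in> ?S}"
        proof
          assume "x \<in> K"
          then show ?thesis using KW Kcol[of x] glue_outer[of x \<phi> d] by auto
        next
          assume "x \<in> Y"
          then obtain j where "x = v j" "d j \<in> ?S" using YD unfolding Y_def by blast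
          then show ?thesis using dv by auto
        qed
      qed
      fix a b assume a: "a \<in> K \<union> Y" and b: "b \<in> W" and ab: "adj a b \<and> ?\<psi> b \<in> ?S"
      show "b \<in> K \<union> Y"
      proof (cases "a \<in> K")
        case True
        show ?thesis
        proof (cases "b \<in> W'")
          case True
          then have "\<phi> b \<in> ?S" using ab glue_outer[OF True, of \<phi> d] by simp
          then show ?thesis using K \<open>a \<in> K\<close> True ab unfolding kempe_closed_def by blast
        next
          case False
          then obtain j where j: "b = v j" using b by blast
          have "(\<forall>t\<le>0. d (j - s * int t) \<in> ?S) \<and> (\<exists>w\<in>K. adj (v (j - s * int 0)) w)"
            using ab dv[of j] j adj_sym \<open>a \<in> K\<close> by auto
          then show ?thesis unfolding Y_def j by blast
        qed
      next
        case False
        then obtain j and m :: nat where j: "a = v j"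
          and m: "\<forall>t\<le>m. d (j - s * int t) \<in> ?S" "\<exists>w\<in>K. adj (v (j - s * int m)) w"
          using a unfolding Y_def by blast
        note yd = YD[OF m]
        show ?thesis
        proof (cases "b \<in> W'")
          case True
          have \<phi>b: "\<phi> b \<in> ?S" using ab glue_outer[OF True, of \<phi> d] by simp
          then have "M j \<noteq> ?S" using full_no[of j b] True ab j by blast
          \<comment> \<open>An outer neighbor \<open>b\<close> in a swap color is \<open>w\<close>
            itself: both have the swap color other than \<open>d j\<close>, and the outer neighbors
            have distinct colors here.\<close>
          then obtain w where w: "w \<in> K" "adj (v j) w" and two: "card (avail \<phi> (v j)) = 2" using yd by blast
          have "\<phi> w \<noteq> d j" "\<phi> b \<noteq> d j"
            using outer_neq[of w j] outer_neq[of b j] w KW True ab j by auto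
          then have "\<phi> w = \<phi> b" using Kcol[OF w(1)] \<phi>b yd by auto
          then have "w = b" using avail_exact(1)[OF two] w KW True ab j by (auto dest: inj_onD)
          then show ?thesis using w by blast
        next
          case False
          then obtain i where i: "b = v i" using b by blast
          have "b = v (j + s) \<or> b = v (j - s)" using ab s unfolding i j adj_v by auto
          then show ?thesis
          proof
            assume bj: "b = v (j + s)"
            have "d (j + s) \<in> ?S" using ab dv[of "j + s"] bj by simp
            have "\<forall>t\<le>Suc m. d (j + s - s * int t) \<in> ?S"
            proof (intro allI impI)
              fix t assume "t \<le> Suc m"
              then show "d (j + s - s * int t) \<in> ?S"
              proof (cases t)
                case 0
                then show ?thesis using \<open>d (j + s) \<in> ?S\<close> by simp
              next
                case (Suc t')
                then show ?thesis using m(1)[rule_format, of t'] \<open>t \<le> Suc m\<close> by (simp add: algebra_simps)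
              qed
            qed
            moreover have "\<exists>w\<in>K. adj (v (j + s - s * int (Suc m))) w" using m(2) by (simp add: algebra_simps)
            ultimately show ?thesis unfolding Y_def bj by blast
          next
            \<comment> \<open>A step back stays in \<open>Y\<close>: two consecutive swap colors
              make \<open>M j\<close> equal to \<open>?S\<close>, so \<open>v j\<close> is not
              adjacent to \<open>K\<close> and \<open>m\<close> is positive.\<close>
            assume bj: "b = v (j - s)"
            have "d (j - s) \<in> ?S" using ab dv[of "j - s"] bj by simp
            then have "M j = ?S" using rule[of "j - s"] yd full by simp
            then have "m \<noteq> 0" using m(2) full_no[of j] KW Kcol by (cases m) auto
            then obtain m' where m': "m = Suc m'" by (cases m) auto
            have "\<forall>t\<le>m'. d (j - s - s * int t) \<in> ?S"
              using m(1)[rule_format, of "Suc _"] m' by (simp add: algebra_simps)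
            moreover have "\<exists>w\<in>K. adj (v (j - s - s * int m')) w" using m(2) m' by (simp add: algebra_simps)
            ultimately show ?thesis unfolding Y_def bj by blast
          qed
        qed
      qed
    qed
    have lists: "swap_on \<alpha> \<beta> (K \<union> Y) ?\<psi> x \<in> L x" if "x \<in> K \<union> Y" for x
    proof (cases "x \<in> K")
      case True
      then have "swap_on \<alpha> \<beta> (K \<union> Y) ?\<psi> x = \<phi>' x"
        using KW glue_outer[of x \<phi> d] by (auto simp: swap_on_def \<phi>')
      then show ?thesis using coloring_in[OF c\<phi>'] True KW by auto
    next
      case False
      then have "x \<in> Y" using \<open>x \<in> K \<union> Y\<close> by blast
      then obtain j and m :: nat where j: "x = v j"
        and m: "\<forall>t\<le>m. d (j - s * int t) \<in> ?S" "\<exists>w\<in>K. adj (v (j - s * int m)) w"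
        unfolding Y_def by blast
      note yd = YD[OF m]
      have "?S \<subseteq> L (v j)"
      proof (cases "M j = ?S")
        case True
        then show ?thesis using M(1)[of j] by (auto simp: avail_def)
      next
        case False
        \<comment> \<open>At an entry position the second color of \<open>?S\<close> is the color of
          \<open>w\<close>, and \<open>avail_exact\<close> places it in the list.\<close>
        then obtain w where w: "w \<in> K" "adj (v j) w" and two: "card (avail \<phi> (v j)) = 2" using yd by blast
        have "\<phi> w \<in> L (v j)" using avail_exact(2)[OF two] w KW by auto
        moreover have "d j \<in> L (v j)" "\<phi> w \<noteq> d j"
          using dM[of j] M(1)[of j] w KW outer_neq[of w j] by (auto simp: avail_def)
        ultimately show ?thesis using Kcol[OF w(1)] yd by auto
      qed
      moreover have "swap_on \<alpha> \<beta> (K \<union> Y) ?\<psi> x \<in> ?S"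
        using swap_on_mem_iff[of \<alpha> \<beta> "K \<union> Y" ?\<psi> x] yd dv[of j] j by simp
      ultimately show ?thesis using j by blast
    qed
    have "kempe_step adj W L ?\<psi> (swap_on \<alpha> \<beta> (K \<union> Y) ?\<psi>)"
      using col[OF d(1)] clos lists by (rule kempe_step_swap_on)
    moreover have "restrict (swap_on \<alpha> \<beta> (K \<union> Y) ?\<psi>) W' = \<phi>'"
    proof
      fix x
      have "x \<notin> Y" if "x \<in> W'" using that v_notin by (auto simp: Y_def)
      then show "restrict (swap_on \<alpha> \<beta> (K \<union> Y) ?\<psi>) W' x = \<phi>' x"
        using KW glue_outer[of x \<phi> d] c\<phi> by (auto simp: swap_on_def \<phi>' coloring_def)
    qed
    moreover have "kempe_equiv adj W L \<eta> (swap_on \<alpha> \<beta> (K \<union> Y) ?\<psi>)"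
      using d(3) r_into_rtranclp[of "kempe_step adj W L", OF calculation(1)] by (rule rtranclp_trans)
    ultimately show ?thesis by blast
  qed
qed

text \<open>All colorings are first moved above the same outer coloring \<open>\<phi>0\<close>;
  there the slack at \<open>v p\<close> makes extensions equivalent.\<close>

theorem swappable_cycle:
  assumes sw: "swappable adj W' L" and \<phi>0: "coloring adj W' L \<phi>0"
    and slack: "card (avail \<phi>0 (v p)) \<ge> 3"
  shows "swappable adj W L"
  unfolding swappable_def
proof (intro allI impI)
  have to: "\<exists>\<eta>'. kempe_equiv adj W L \<eta> \<eta>' \<and> restrict \<eta>' W' = \<phi>0" if \<eta>: "coloring adj W L \<eta>" for \<eta>
  proof (rule lift_kempe_equiv[OF _ \<eta> refl lift_step])
    show "kempe_equiv adj W' L (restrict \<eta> W') \<phi>0"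
      using sw \<phi>0 coloring_restrict[OF \<eta>, of W'] unfolding swappable_def by blast
  qed
  fix \<eta>1 \<eta>2 assume c: "coloring adj W L \<eta>1" "coloring adj W L \<eta>2"
  obtain \<psi>1 \<psi>2 where \<psi>: "kempe_equiv adj W L \<eta>1 \<psi>1" "restrict \<psi>1 W' = \<phi>0"
      "kempe_equiv adj W L \<eta>2 \<psi>2" "restrict \<psi>2 W' = \<phi>0"
    using to c by meson
  have e: "\<psi>1 u = \<phi>0 u" "\<psi>2 u = \<phi>0 u" if "u \<in> W'" for u
    using \<psi>(2,4) that by (metis restrict_apply')+
  have "card (avail \<psi>1 (v p)) \<ge> 3" using slack avail_cong[of \<psi>1 \<phi>0] e by simp
  then have "kempe_equiv adj W L \<psi>1 \<psi>2"
    using e kempe_equiv_coloring[OF \<psi>(1) c(1)] kempe_equiv_coloring[OF \<psi>(3) c(2)]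
    by (intro kempe_equiv_slack[of _ _ p]) auto
  with \<psi>(1) have "kempe_equiv adj W L \<eta>1 \<psi>2" by (rule rtranclp_trans)
  then show "kempe_equiv adj W L \<eta>1 \<eta>2"
    using kempe_equiv_sym[OF \<psi>(3)] by (rule rtranclp_trans)
qed

lemma ex_coloring_cycle:
  assumes "coloring adj W' L \<phi>"
  shows "\<exists>\<eta>. coloring adj W L \<eta>"
proof -
  define sub where "sub A = (SOME T. T \<subseteq> A \<and> card T = 2)" for A :: "'c set"
  define M where "M i = sub (avail \<phi> (v i))" for i
  have M: "M i \<subseteq> avail \<phi> (v i) \<and> card (M i) = 2" for i
    unfolding M_def sub_def using card_avail[of \<phi> i] obtain_subset_with_card_n
    by (metis (mono_tags, lifting) someI_ex)
  interpret cl: cyclic_lists n M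
    by unfold_locales (use n_even n_ge M in \<open>auto simp: M_def v_periodic\<close>)
  obtain c where c: "cl.pcol c" using cl.ex_pcol by blast
  then have "coloring adj W L (glue \<phi> c)"
    using M by (intro coloring_glue[OF assms]) (auto simp: cl.pcol_def)
  then show ?thesis by blast
qed

end

section \<open>Cycles and forests\<close>

lemma sum_card_swap:
  assumes "finite A" "finite B"
  shows "(\<Sum>a\<in>A. card {b \<in> B. R a b}) = (\<Sum>b\<in>B. card {a \<in> A. R a b})"
  by (rule sum_multicount_gen[OF assms]) simp

definition has_cycle :: "'v set set \<Rightarrow> bool" where
  "has_cycle E \<longleftrightarrow> (\<exists>xs. distinct xs \<and> 3 \<le> length xs \<and> successively (\<lambda>a b. {a, b} \<in> E) xs \<and>
     {last xs, hd xs} \<in> E)"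

fun path_edges :: "'v list \<Rightarrow> 'v set set" where
  "path_edges (x # y # ys) = insert {x, y} (path_edges (y # ys))"
| "path_edges _ = {}"

lemma path_edges_subset_iff: "path_edges xs \<subseteq> E \<longleftrightarrow> successively (\<lambda>a b. {a, b} \<in> E) xs"
  by (induction xs rule: path_edges.induct) auto

lemma has_cycle_mono:
  assumes "has_cycle E" "E \<subseteq> E'"
  shows "has_cycle E'"
proof -
  obtain xs where "distinct xs" "3 \<le> length xs" "path_edges xs \<subseteq> E" "{last xs, hd xs} \<in> E"
    using assms(1) unfolding has_cycle_def path_edges_subset_iff by blast
  then have "distinct xs \<and> 3 \<le> length xs \<and> path_edges xs \<subseteq> E' \<and> {last xs, hd xs} \<in> E'"
    using assms(2) by blast
  then show ?thesis unfolding has_cycle_def path_edges_subset_iff by blast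
qed

lemma path_edges_subset_set: "e \<in> path_edges xs \<Longrightarrow> e \<subseteq> set xs"
  by (induction xs rule: path_edges.induct) auto

lemma closing_edge_notin_path_edges:
  assumes "distinct xs" "3 \<le> length xs"
  shows "{last xs, hd xs} \<notin> path_edges xs"
proof -
  obtain x y z zs where xs: "xs = x # y # z # zs"
    using assms(2) by (auto simp: numeral_3_eq_3 Suc_le_length_iff)
  have "last xs \<in> set (z # zs)" unfolding xs by auto
  then have "last xs \<noteq> y" "last xs \<noteq> x" using assms(1) unfolding xs by auto
  then show ?thesis
    using assms(1) path_edges_subset_set[of "{last xs, hd xs}" "y # z # zs"] unfolding xs
    by (auto simp: doubleton_eq_iff)
qed

text \<open>An end of a longest path lies on one edge only: a further edge would prolong the path or
  close a cycle.\<close>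

lemma ex_leaf:
  assumes fin: "finite E" and two: "\<And>e. e \<in> E \<Longrightarrow> card e = 2" and ne: "E \<noteq> {}" and nc: "\<not> has_cycle E"
  obtains e v where "e \<in> E" "v \<in> e" "\<And>f. f \<in> E \<Longrightarrow> v \<in> f \<Longrightarrow> f = e"
proof -
  let ?P = "\<lambda>xs. distinct xs \<and> 2 \<le> length xs \<and> successively (\<lambda>a b. {a, b} \<in> E) xs"
  have finU: "finite (\<Union>E)" using fin two by (metis card.infinite finite_Union zero_neq_numeral)
  have sub: "set xs \<subseteq> \<Union>E" if "?P xs" for xs
  proof
    fix x assume "x \<in> set xs"
    then obtain ys zs where xs: "xs = ys @ x # zs" by (metis split_list)
    show "x \<in> \<Union>E"
    proof (cases zs)
      case (Cons z zs')
      then have "{x, z} \<in> E" using that xs by (auto simp: successively_append_iff)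
      then show ?thesis by blast
    next
      case Nil
      then have "ys \<noteq> []" using that xs by auto
      then have "{last ys, x} \<in> E" using that xs Nil by (auto simp: successively_append_iff)
      then show ?thesis by blast
    qed
  qed
  have bound: "length xs \<le> card (\<Union>E)" if "?P xs" for xs
    using card_mono[OF finU sub[OF that]] that by (simp add: distinct_card)
  obtain e0 where e0: "e0 \<in> E" using ne by blast
  obtain a b where ab: "e0 = {a, b}" "a \<noteq> b" using two[OF e0] by (meson card_2_iff)
  have "?P [a, b]" using e0 ab by simp
  then have "\<exists>xs. ?P xs \<and> (\<forall>ys. ?P ys \<longrightarrow> length ys \<le> length xs)"
    using bound by (intro ex_has_greatest_nat[of ?P "[a, b]" length "Suc (card (\<Union>E))"]) (auto simp: less_Suc_eq_le)
  then obtain xs where xs: "?P xs" and maxi: "\<And>ys. ?P ys \<Longrightarrow> length ys \<le> length xs" by blast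
  obtain x y ys where xy: "xs = x # y # ys" using xs by (auto simp: numeral_2_eq_2 Suc_le_length_iff)
  show ?thesis
  proof (rule that[of "{x, y}" x])
    show "{x, y} \<in> E" using xs xy by simp
    fix f assume f: "f \<in> E" "x \<in> f"
    obtain z where z: "f = {x, z}" "z \<noteq> x" using two[OF f(1)] f(2) by (metis card_2_iff doubleton_eq_iff insertE singletonD)
    show "f = {x, y}"
    proof (rule ccontr)
      assume "f \<noteq> {x, y}"
      then have zy: "z \<noteq> y" using z by auto
      show False
      proof (cases "z \<in> set xs")
        case False
        then have "?P (z # xs)" using xs f z xy by (auto simp: insert_commute)
        then show False using maxi[of "z # xs"] by simp
      next
        case True
        then have "z \<in> set ys" using z zy xy by auto
        then obtain us ws where ys: "ys = us @ z # ws" by (metis split_list)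
        have eq: "xs = (x # y # us @ [z]) @ ws" using xy ys by simp
        have "distinct (x # y # us @ [z])" "successively (\<lambda>a b. {a, b} \<in> E) (x # y # us @ [z])"
          using xs unfolding eq successively_append_iff distinct_append by blast+
        moreover have "{last (x # y # us @ [z]), hd (x # y # us @ [z])} \<in> E"
          using f z by (simp add: insert_commute)
        moreover have "3 \<le> length (x # y # us @ [z])" by simp
        ultimately show False using nc unfolding has_cycle_def by blast
      qed
    qed
  qed simp
qed

lemma forest_card:
  assumes "finite E" "\<And>e. e \<in> E \<Longrightarrow> card e = 2" "\<not> has_cycle E" "finite V" "\<Union>E \<subseteq> V" "V \<noteq> {}"
  shows "card E < card V"
  using assms
proof (induction "card E" arbitrary: E V)
  case 0
  then show ?case by (simp add: card_gt_0_iff)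
next
  case (Suc m)
  then have "E \<noteq> {}" by auto
  then obtain e v where e: "e \<in> E" "v \<in> e" "\<And>f. f \<in> E \<Longrightarrow> v \<in> f \<Longrightarrow> f = e"
    using ex_leaf[of E] Suc.prems by blast
  have "card e = 2" using e Suc by blast
  then obtain a b where "e = {a, b}" "a \<noteq> b" by (meson card_2_iff)
  then have "\<exists>u\<in>e. u \<noteq> v" by auto
  then obtain u where u: "u \<in> e" "u \<noteq> v" by blast
  have "card (E - {e}) < card (V - {v})"
  proof (rule Suc.hyps(1))
    show "m = card (E - {e})" using Suc.hyps(2) e(1) by simp
    show "\<not> has_cycle (E - {e})" using Suc.prems(3) has_cycle_mono by blast
    show "\<Union> (E - {e}) \<subseteq> V - {v}" using Suc.prems(5) e by blast
    show "V - {v} \<noteq> {}" using u e Suc.prems(5) by blast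
  qed (use Suc.prems in auto)
  moreover have "v \<in> V" using e Suc.prems(5) by blast
  ultimately show ?case
    using card_Suc_Diff1[OF Suc.prems(1) e(1)] card_Suc_Diff1[OF Suc.prems(4), of v] by linarith
qed

lemma card_ge_4_if_long_cycle:
  assumes "distinct xs" "4 \<le> length xs" "successively (\<lambda>a b. {a, b} \<in> E) xs" "{last xs, hd xs} \<in> E" "finite E"
  shows "4 \<le> card E"
proof -
  obtain x y z w ws where xs: "xs = x # y # z # w # ws"
    using assms(2) by (auto simp: eval_nat_numeral Suc_le_length_iff)
  have l: "last xs \<in> set (w # ws)" unfolding xs by auto
  have "{{x, y}, {y, z}, {z, w}, {last xs, x}} \<subseteq> E" using assms unfolding xs by auto
  moreover have "last xs \<notin> {x, y, z}" using l assms(1) unfolding xs by auto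
  then have "card {{x, y}, {y, z}, {z, w}, {last xs, x}} = 4"
    using assms(1) unfolding xs by (auto simp: doubleton_eq_iff card_insert_if)
  ultimately show ?thesis using assms(5) by (metis card_mono)
qed

text \<open>To be applied to the boundary edges of a face: there are at least four of them unless
  they form a triangle.\<close>

lemma cycle_card:
  assumes "has_cycle E" "finite E"
  shows "3 \<le> card E"
    and "card E = 3 \<Longrightarrow> \<exists>a b c. a \<noteq> b \<and> b \<noteq> c \<and> a \<noteq> c \<and> E = {{a, b}, {b, c}, {a, c}}"
proof -
  obtain xs where xs: "distinct xs" "3 \<le> length xs" "successively (\<lambda>a b. {a, b} \<in> E) xs" "{last xs, hd xs} \<in> E"
    using assms unfolding has_cycle_def by blast
  have "3 \<le> card E \<and> (card E = 3 \<longrightarrow> (\<exists>a b c. a \<noteq> b \<and> b \<noteq> c \<and> a \<noteq> c \<and> E = {{a, b}, {b, c}, {a, c}}))"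
  proof (cases "4 \<le> length xs")
    case True
    then show ?thesis using card_ge_4_if_long_cycle[OF xs(1) True xs(3,4) assms(2)] by simp
  next
    case False
    then have "length xs = 3" using xs(2) by linarith
    then obtain a b c where abc: "xs = [a, b, c]" by (auto simp: numeral_3_eq_3 length_Suc_conv)
    have sub: "{{a, b}, {b, c}, {a, c}} \<subseteq> E" using xs unfolding abc by (auto simp: insert_commute)
    have c3: "card {{a, b}, {b, c}, {a, c}} = 3" using xs(1) unfolding abc by (auto simp: doubleton_eq_iff card_insert_if)
    have "3 \<le> card E" using card_mono[OF assms(2) sub] c3 by simp
    moreover have "E = {{a, b}, {b, c}, {a, c}}" if "card E = 3"
      using card_subset_eq[OF assms(2) sub] c3 that by simp
    moreover have "a \<noteq> b" "b \<noteq> c" "a \<noteq> c" using xs(1) unfolding abc by auto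
    ultimately show ?thesis by blast
  qed
  then show "3 \<le> card E"
    and "card E = 3 \<Longrightarrow> \<exists>a b c. a \<noteq> b \<and> b \<noteq> c \<and> a \<noteq> c \<and> E = {{a, b}, {b, c}, {a, c}}" by blast+
qed

lemma rtranclp_distinct_path:
  assumes "R\<^sup>*\<^sup>* u v"
  obtains xs where "distinct xs" "xs \<noteq> []" "hd xs = u" "last xs = v" "successively R xs"
proof -
  have "\<exists>xs. distinct xs \<and> xs \<noteq> [] \<and> hd xs = u \<and> last xs = v \<and> successively R xs"
    using assms
  proof (induction rule: rtranclp_induct)
    case base
    then show ?case by (intro exI[of _ "[u]"]) auto
  next
    case (step y z)
    then obtain xs where xs: "distinct xs" "xs \<noteq> []" "hd xs = u" "last xs = y" "successively R xs" by blast
    show ?case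
    proof (cases "z \<in> set xs")
      case True
      then obtain ys zs where eq: "xs = (ys @ [z]) @ zs" by (metis split_list append_Cons append_Nil append_assoc)
      have "successively R (ys @ [z])" "distinct (ys @ [z])"
        using xs unfolding eq successively_append_iff distinct_append by blast+
      moreover have "hd (ys @ [z]) = u" using xs unfolding eq by (cases ys) auto
      ultimately show ?thesis by (intro exI[of _ "ys @ [z]"]) auto
    next
      case False
      then show ?thesis using xs step by (intro exI[of _ "xs @ [z]"]) (auto simp: successively_append_iff)
    qed
  qed
  then show ?thesis using that by blast
qed

section \<open>Faces of a plane drawing\<close>

lemma open_meets_if_closure:
  assumes "open S" "z \<in> S" "z \<in> closure T"
  obtains w where "w \<in> S" "w \<in> T"
  using open_Int_closure_eq_empty[OF assms(1), of T] assms(2,3) by blast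

text \<open>The drawing of \<open>E0\<close> stays fixed while edges are deleted; the statements
  concern arbitrary subsets \<open>E\<close> of \<open>E0\<close>.\<close>

locale plane_graph =
  fixes V :: "'v set" and E0 :: "'v set set" and p :: "'v \<Rightarrow> complex" and \<gamma> :: "'v set \<Rightarrow> real \<Rightarrow> complex"
  assumes finite_V: "finite V" and edge_sub: "e \<in> E0 \<Longrightarrow> e \<subseteq> V" and card_edge: "e \<in> E0 \<Longrightarrow> card e = 2"
    and inj_p: "inj_on p V"
    and arc_edge: "e \<in> E0 \<Longrightarrow> arc (\<gamma> e)"
    and ends_edge: "e \<in> E0 \<Longrightarrow> {pathstart (\<gamma> e), pathfinish (\<gamma> e)} = p ` e"
    and edge_avoids_vertices: "e \<in> E0 \<Longrightarrow> (path_image (\<gamma> e) - p ` e) \<inter> p ` V = {}"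
    and edges_disjoint: "e \<in> E0 \<Longrightarrow> f \<in> E0 \<Longrightarrow> e \<noteq> f \<Longrightarrow> (path_image (\<gamma> e) - p ` e) \<inter> path_image (\<gamma> f) = {}"
begin

abbreviation img :: "'v set \<Rightarrow> complex set" where
  "img e \<equiv> path_image (\<gamma> e)"

definition drawn :: "'v set set \<Rightarrow> complex set" where
  "drawn E = (\<Union>e\<in>E. img e)"

abbreviation inner :: "'v set \<Rightarrow> complex set" where
  "inner e \<equiv> img e - p ` e"

lemma edge_other_end:
  assumes "e \<in> E0" "v \<in> e"
  obtains w where "e = {v, w}" "w \<noteq> v"
proof -
  obtain a b where "e = {a, b}" "a \<noteq> b" using card_edge[OF assms(1)] by (meson card_2_iff)
  then show ?thesis using assms(2) that[of a] that[of b] by (auto simp: insert_commute)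
qed

lemma finite_E0: "finite E0"
  by (rule finite_subset[of _ "Pow V"]) (use edge_sub finite_V in auto)

lemma finite_sub: "E \<subseteq> E0 \<Longrightarrow> finite E"
  using finite_E0 finite_subset by blast

lemma compact_drawn: "E \<subseteq> E0 \<Longrightarrow> compact (drawn E)"
  unfolding drawn_def using finite_sub arc_edge
  by (intro compact_UN) (auto intro: compact_arc_image)

lemma open_Compl_drawn: "E \<subseteq> E0 \<Longrightarrow> open (- drawn E)"
  using compact_drawn compact_imp_closed by blast

lemma ends_in_image:
  assumes "e \<in> E0"
  shows "p ` e \<subseteq> img e"
  unfolding ends_edge[OF assms, symmetric] by (simp add: pathstart_in_path_image pathfinish_in_path_image)

lemma connected_inner: "e \<in> E0 \<Longrightarrow> connected (inner e)"
  using connected_simple_path_endless[OF arc_imp_simple_path[OF arc_edge]] ends_edge by metis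

lemma inner_nonempty: "e \<in> E0 \<Longrightarrow> inner e \<noteq> {}"
  using nonempty_simple_path_endless[OF arc_imp_simple_path[OF arc_edge]] ends_edge by metis

lemma image_Int_image:
  assumes "e \<in> E0" "f \<in> E0" "e \<noteq> f"
  shows "img e \<inter> img f \<subseteq> p ` (e \<inter> f)"
proof -
  have "img e \<inter> img f \<subseteq> p ` e \<inter> p ` f"
    using edges_disjoint[OF assms] edges_disjoint[OF assms(2,1) assms(3)[symmetric]] by fast
  also have "\<dots> = p ` (e \<inter> f)"
    using inj_on_image_Int[OF inj_p edge_sub[OF assms(1)] edge_sub[OF assms(2)]] by simp
  finally show ?thesis .
qed

lemma image_Int_vertices:
  assumes "e \<in> E0" "U \<subseteq> V"
  shows "img e \<inter> p ` U \<subseteq> p ` (e \<inter> U)"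
proof -
  have "img e \<inter> p ` U \<subseteq> p ` e \<inter> p ` U"
    using edge_avoids_vertices[OF assms(1)] assms(2) by blast
  also have "\<dots> = p ` (e \<inter> U)"
    using inj_on_image_Int[OF inj_p edge_sub[OF assms(1)] assms(2)] by simp
  finally show ?thesis .
qed

lemma image_Int_drawn:
  assumes "e \<in> E0" "E \<subseteq> E0" "e \<notin> E"
  shows "img e \<inter> drawn E \<subseteq> p ` (e \<inter> \<Union>E)"
proof
  fix z assume "z \<in> img e \<inter> drawn E"
  then obtain f where f: "f \<in> E" "z \<in> img e \<inter> img f" unfolding drawn_def by blast
  then have "z \<in> p ` (e \<inter> f)" using image_Int_image[of e f] assms by blast
  then show "z \<in> p ` (e \<inter> \<Union>E)" using f by blast
qed

lemma inner_Int_drawn: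
  assumes "e \<in> E0" "E \<subseteq> E0" "e \<notin> E"
  shows "inner e \<inter> drawn E = {}"
  using image_Int_drawn[OF assms] by blast

lemma drawn_insert: "drawn (insert e E) = img e \<union> drawn E"
  by (simp add: drawn_def)

lemma drawn_remove: "e \<in> E \<Longrightarrow> drawn E = img e \<union> drawn (E - {e})"
  using drawn_insert[of e "E - {e}"] by (simp add: insert_absorb)

lemma oriented_edge:
  assumes "{x, y} \<in> E0"
  obtains g where "arc g" "pathstart g = p x" "pathfinish g = p y" "path_image g = img {x, y}"
proof (cases "pathstart (\<gamma> {x, y}) = p x")
  case True
  have "pathfinish (\<gamma> {x, y}) \<noteq> pathstart (\<gamma> {x, y})" using arc_edge[OF assms] by (rule arc_distinct_ends)
  then have "pathfinish (\<gamma> {x, y}) = p y" using ends_edge[OF assms] True by (auto simp: doubleton_eq_iff)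
  then show ?thesis using that[of "\<gamma> {x, y}"] True arc_edge[OF assms] by simp
next
  case False
  then have "pathfinish (\<gamma> {x, y}) = p x" "pathstart (\<gamma> {x, y}) = p y"
    using ends_edge[OF assms] by (auto simp: doubleton_eq_iff)
  then show ?thesis using that[of "reversepath (\<gamma> {x, y})"] arc_edge[OF assms]
    by (simp add: arc_reversepath)
qed

lemma path_arc:
  assumes "distinct xs" "2 \<le> length xs" "path_edges xs \<subseteq> E0"
  obtains g where "arc g" "pathstart g = p (hd xs)" "pathfinish g = p (last xs)" "path_image g = drawn (path_edges xs)"
proof -
  have "\<exists>g. arc g \<and> pathstart g = p (hd xs) \<and> pathfinish g = p (last xs) \<and> path_image g = drawn (path_edges xs)"
    using assms
  proof (induction xs rule: path_edges.induct)
    case (1 x y ys)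
    have xy: "{x, y} \<in> E0" using 1 by simp
    obtain h where h: "arc h" "pathstart h = p x" "pathfinish h = p y" "path_image h = img {x, y}"
      using oriented_edge[OF xy] by blast
    show ?case
    proof (cases "ys = []")
      case True
      then show ?thesis using h by (intro exI[of _ h]) (simp add: drawn_def)
    next
      case False
      then have "2 \<le> length (y # ys)" by (cases ys) auto
      then obtain g where g: "arc g" "pathstart g = p y" "pathfinish g = p (last (y # ys))"
          "path_image g = drawn (path_edges (y # ys))"
        using 1 by auto
      have "{x, y} \<notin> path_edges (y # ys)"
        using path_edges_subset_set[of "{x, y}" "y # ys"] 1(2) by auto
      then have "path_image h \<inter> path_image g \<subseteq> p ` ({x, y} \<inter> \<Union> (path_edges (y # ys)))"
        unfolding h(4) g(4) using 1 xy by (intro image_Int_drawn) auto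
      also have "\<dots> \<subseteq> {p y}" using path_edges_subset_set[of _ "y # ys"] 1(2) by auto
      finally have "arc (h +++ g)" using h g by (intro arc_join) auto
      moreover have "path_image (h +++ g) = drawn (path_edges (x # y # ys))"
        using h g by (simp add: path_image_join drawn_insert)
      ultimately show ?thesis using h g by (intro exI[of _ "h +++ g"]) auto
    qed
  qed auto
  then show ?thesis using that by blast
qed

text \<open>The curve is presented as one edge plus a connected rest: the rest will be its
  intersection with the drawing without that edge, and Janiszewski's theorem wants a connected
  intersection.\<close>

lemma jordan_cycle:
  assumes xs: "distinct xs" "2 \<le> length xs" "path_edges xs \<subseteq> E0 - {e}" and e: "e \<in> E0" "e = {hd xs, last xs}"
  obtains c where "simple_path c" "pathfinish c = pathstart c"
    "path_image c = img e \<union> drawn (path_edges xs)" "connected (drawn (path_edges xs))"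
    "p ` e \<subseteq> drawn (path_edges xs)"
proof -
  obtain g where g: "arc g" "pathstart g = p (hd xs)" "pathfinish g = p (last xs)" "path_image g = drawn (path_edges xs)"
    using path_arc[OF xs(1,2)] xs(3) by blast
  have "{last xs, hd xs} \<in> E0" using e by (simp add: insert_commute)
  then obtain h where h: "arc h" "pathstart h = p (last xs)" "pathfinish h = p (hd xs)" "path_image h = img {last xs, hd xs}"
    using oriented_edge by blast
  have h': "path_image h = img e" using h e by (simp add: insert_commute)
  have "path_image g \<inter> path_image h \<subseteq> p ` e"
    unfolding h' g(4) using image_Int_drawn[of e "path_edges xs"] e xs by blast
  then have "simple_path (g +++ h)" using g h e by (intro simple_path_join_loop) auto
  moreover have "path_image (g +++ h) = img e \<union> drawn (path_edges xs)"
    using g h h' by (simp add: path_image_join Un_commute)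
  moreover have "connected (drawn (path_edges xs))" using g(1,4) connected_arc_image by metis
  moreover have "p ` e \<subseteq> drawn (path_edges xs)"
    using g e pathstart_in_path_image[of g] pathfinish_in_path_image[of g] by auto
  ultimately show ?thesis using that[of "g +++ h"] g h by simp
qed

section \<open>Faces as components of the complement, and their number\<close>

abbreviation linked :: "'v set set \<Rightarrow> complex \<Rightarrow> complex \<Rightarrow> bool" where
  "linked E \<equiv> connected_component (- drawn E)"

lemma linked_mono: "linked E a b \<Longrightarrow> E' \<subseteq> E \<Longrightarrow> linked E' a b"
  by (rule connected_component_of_subset) (auto simp: drawn_def)

lemma linked_sym: "linked E a b \<Longrightarrow> linked E b a"
  by (rule connected_component_sym)

lemma linked_trans: "linked E a b \<Longrightarrow> linked E b c \<Longrightarrow> linked E a c"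
  by (rule connected_component_trans)

lemma linked_inner:
  assumes "e \<in> E0" "E \<subseteq> E0" "e \<notin> E" "a \<in> inner e" "b \<in> inner e"
  shows "linked E a b"
  unfolding connected_component_def
  using connected_inner[OF assms(1)] inner_Int_drawn[OF assms(1-3)] assms(4,5) by blast

text \<open>Every point of a Jordan curve is a limit of both its inside and its outside. The face
  around \<open>z\<close> that remains after deleting \<open>e\<close> is open and therefore reaches
  both sides, which the curve separates.\<close>

lemma split_face:
  assumes xs: "distinct xs" "2 \<le> length xs" "path_edges xs \<subseteq> E - {e}" and e: "e \<in> E" "e = {hd xs, last xs}"
    and E: "E \<subseteq> E0" and z: "z \<in> inner e"
  obtains a b where "linked (E - {e}) z a" "linked (E - {e}) z b" "a \<notin> drawn E" "b \<notin> drawn E" "\<not> linked E a b"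
    "p ` e \<subseteq> drawn (E - {e})"
proof -
  have prem: "path_edges xs \<subseteq> E0 - {e}" "e \<in> E0" using xs(3) e(1) E by auto
  obtain c where c: "simple_path c" "pathfinish c = pathstart c"
    "path_image c = img e \<union> drawn (path_edges xs)" "connected (drawn (path_edges xs))"
    "p ` e \<subseteq> drawn (path_edges xs)"
    by (rule jordan_cycle[OF xs(1,2) prem e(2)])
  note J = Jordan_inside_outside[OF c(1,2)]
  have cE: "path_image c \<subseteq> drawn E" unfolding c(3) using xs(3) e by (auto simp: drawn_def)
  have zc: "z \<in> path_image c" using z c by blast
  let ?f = "connected_component_set (- drawn (E - {e})) z"
  have "z \<in> - drawn (E - {e})" using inner_Int_drawn[of e "E - {e}"] z e E by blast
  then have zf: "z \<in> ?f" by (simp add: connected_component_refl)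
  have "open ?f" using open_Compl_drawn[of "E - {e}"] E by (intro open_connected_component) auto
  have "z \<in> closure (inside (path_image c))" "z \<in> closure (outside (path_image c))"
    using J zc by (auto simp: frontier_def)
  note cl = this
  obtain a where a: "a \<in> ?f" "a \<in> inside (path_image c)"
    by (rule open_meets_if_closure[OF \<open>open ?f\<close> zf cl(1)])
  obtain b where b: "b \<in> ?f" "b \<in> outside (path_image c)"
    by (rule open_meets_if_closure[OF \<open>open ?f\<close> zf cl(2)])
  note ab = a b
  have io: "open (inside (path_image c))" "open (outside (path_image c))"
      "inside (path_image c) \<inter> outside (path_image c) = {}"
      "inside (path_image c) \<union> outside (path_image c) = - path_image c" using J by simp_all
  have notin: "w \<notin> drawn E" if "w \<in> ?f" "w \<notin> path_image c" for w
  proof -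
    have "w \<notin> drawn (E - {e})" using that connected_component_in by fastforce
    moreover have "w \<notin> img e" using that c by blast
    ultimately show ?thesis using drawn_remove[OF e(1)] by blast
  qed
  have nc: "a \<notin> path_image c" "b \<notin> path_image c" using ab io(4) by blast+
  have "\<not> linked E a b"
  proof
    assume "linked E a b"
    then obtain T where T: "connected T" "T \<subseteq> - drawn E" "a \<in> T" "b \<in> T" unfolding connected_component_def by blast
    have "T \<subseteq> inside (path_image c) \<union> outside (path_image c)" using T(2) cE io(4) by blast
    then show False
      using connectedD[OF T(1) io(1,2)] io(3) T(3,4) ab by blast
  qed
  moreover have "p ` e \<subseteq> drawn (E - {e})" using c(5) xs(3) by (auto simp: drawn_def)
  ultimately show ?thesis using that[of a b] ab notin nc by simp
qed

text \<open>Euler's formula as a lower bound on the number of faces; a face is represented by a point.\<close>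

lemma ex_face_points:
  assumes "E \<subseteq> E0" "\<Union>E \<subseteq> U" "finite U" "U \<noteq> {}"
  obtains P where "finite P" "P \<inter> drawn E = {}" "\<And>a b. a \<in> P \<Longrightarrow> b \<in> P \<Longrightarrow> linked E a b \<Longrightarrow> a = b"
    "card E + 2 \<le> card P + card U"
proof -
  have "\<exists>P. finite P \<and> P \<inter> drawn E = {} \<and> (\<forall>a\<in>P. \<forall>b\<in>P. linked E a b \<longrightarrow> a = b) \<and> card E + 2 \<le> card P + card U"
    using assms(1,2)
  proof (induction "card E" arbitrary: E rule: less_induct)
    case less
    have fin: "finite E" using finite_sub less by blast
    show ?case
    proof (cases "has_cycle E")
      case False
      \<comment> \<open>A forest needs only one face, and any point off the drawing represents
        it.\<close>
      have "card E < card U" using forest_card[OF fin _ False assms(3)] card_edge less assms(4) by blast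
      moreover have "drawn E \<noteq> UNIV"
        using compact_imp_bounded[OF compact_drawn[OF less(2)]] not_bounded_UNIV by metis
      then obtain a where "a \<notin> drawn E" by blast
      ultimately show ?thesis by (intro exI[of _ "{a}"]) auto
    next
      case True
      then obtain xs where xs: "distinct xs" "3 \<le> length xs" "path_edges xs \<subseteq> E" "{last xs, hd xs} \<in> E"
        unfolding has_cycle_def path_edges_subset_iff by blast
      define e where "e = {hd xs, last xs}"
      have e: "e \<in> E" using xs by (simp add: e_def insert_commute)
      have ne: "path_edges xs \<subseteq> E - {e}"
        using closing_edge_notin_path_edges[OF xs(1,2)] xs(3) by (auto simp: e_def insert_commute)
      have sub1: "E - {e} \<subseteq> E0" "\<Union> (E - {e}) \<subseteq> U" using less.prems by auto
      obtain P where P: "finite P" "P \<inter> drawn (E - {e}) = {}" "\<And>a b. a \<in> P \<Longrightarrow> b \<in> P \<Longrightarrow> linked (E - {e}) a b \<Longrightarrow> a = b"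
          "card (E - {e}) + 2 \<le> card P + card U"
        using less.hyps[OF card_Diff1_less[OF fin e] sub1] by blast
      obtain z where z: "z \<in> inner e" using inner_nonempty[of e] e less.prems by blast
      have len: "2 \<le> length xs" using xs by linarith
      obtain a b where ab: "linked (E - {e}) z a" "linked (E - {e}) z b" "a \<notin> drawn E" "b \<notin> drawn E" "\<not> linked E a b"
          and pe: "p ` e \<subseteq> drawn (E - {e})"
        by (rule split_face[OF xs(1) len ne e e_def less.prems(1) z])
      \<comment> \<open>At most one representative lies in the face of \<open>z\<close>, which
        \<open>e\<close> splits; it gives way to \<open>a\<close> and \<open>b\<close>, so the new
        edge is paid for by a new face.\<close>
      define Q where "Q = {q \<in> P. \<not> linked (E - {e}) z q}"
      let ?P = "Q \<union> {a, b}"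
      have sub: "E - {e} \<subseteq> E" by blast
      \<comment> \<open>The inner points of \<open>e\<close> lie in the face of \<open>z\<close> and
        its ends on the remaining drawing, so \<open>e\<close> hits no point of
        \<open>Q\<close>.\<close>
      have Qout: "Q \<inter> drawn E = {}"
      proof -
        have "q \<notin> drawn E" if "q \<in> Q" for q
        proof -
          have "q \<notin> drawn (E - {e})" "\<not> linked (E - {e}) z q" using that P(2) by (auto simp: Q_def)
          moreover have "q \<notin> inner e"
            using linked_inner[of e "E - {e}" z q] calculation(2) z e less.prems(1) by blast
          ultimately show ?thesis using drawn_remove[OF e] pe by blast
        qed
        then show ?thesis by blast
      qed
      have ab_ne: "a \<noteq> b" using ab connected_component_refl[of a "- drawn E"] by auto
      have abQ: "a \<notin> Q" "b \<notin> Q" using ab by (auto simp: Q_def)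
      have finQ: "finite Q" using P(1) by (simp add: Q_def)
      have "card P \<le> card Q + 1"
      proof -
        have "card (P - Q) \<le> 1"
        proof (rule ccontr)
          assume "\<not> ?thesis"
          then obtain q q' where q: "q \<in> P - Q" "q' \<in> P - Q" "q \<noteq> q'"
            using card_le_Suc0_iff_eq[of "P - Q"] P(1) by auto
          then have "linked (E - {e}) z q" "linked (E - {e}) z q'" by (auto simp: Q_def)
          then have "linked (E - {e}) q q'" using linked_sym linked_trans by blast
          then show False using P(3)[of q q'] q by blast
        qed
        moreover have "card P = card Q + card (P - Q)"
          using P(1) finQ by (subst card_Un_disjoint[symmetric]) (auto simp: Q_def intro: arg_cong[where f = card])
        ultimately show ?thesis by simp
      qed
      moreover have "card ?P = card Q + 2"
        using finQ abQ ab_ne by simp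
      moreover have "card E = card (E - {e}) + 1" using e fin by (metis Suc_eq_plus1 card_Suc_Diff1)
      ultimately have cardP: "card E + 2 \<le> card ?P + card U" using P(4) by linarith
      have outP: "?P \<inter> drawn E = {}" using Qout ab by blast
      have uniqP: "x = y" if x: "x \<in> ?P" and y: "y \<in> ?P" and xy: "linked E x y" for x y
      proof -
        have xy': "linked (E - {e}) x y" using linked_mono[OF xy sub] .
        have zab: "linked (E - {e}) z w" if "w \<in> {a, b}" for w using that ab by blast
        show ?thesis
        proof (cases "x \<in> {a, b}")
          case True
          then have "linked (E - {e}) z y" using zab xy' linked_trans by blast
          then have "y \<in> {a, b}" using y by (auto simp: Q_def)
          then show ?thesis using True xy ab(5) linked_sym by blast
        next
          case False
          then have xQ: "x \<in> Q" using x by blast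
          then have "\<not> linked (E - {e}) z x" by (simp add: Q_def)
          then have "y \<notin> {a, b}" using zab xy' linked_trans linked_sym by blast
          then show ?thesis using xQ y P(3) xy' by (auto simp: Q_def)
        qed
      qed
      show ?thesis
      proof (intro exI[of _ ?P] conjI ballI impI)
        show "finite ?P" using finQ by simp
      qed (fact outP, erule (2) uniqP, fact cardP)
    qed
  qed
  then show ?thesis using that by blast
qed

text \<open>The boundary edges of the face of \<open>a\<close>. Only inner points of
  \<open>e\<close> count, so a face that meets \<open>e\<close> just at a vertex is
  excluded.\<close>

definition touches :: "'v set set \<Rightarrow> complex \<Rightarrow> 'v set set" where
  "touches E a = {e \<in> E. closure (connected_component_set (- drawn E) a) \<inter> inner e \<noteq> {}}"

text \<open>Without \<open>e\<close>, the component around a limit point on \<open>inner e\<close>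
  is open, hence meets the face of \<open>a\<close> and merges with it.\<close>

lemma touches_linked:
  assumes E: "E \<subseteq> E0" and e: "e \<in> touches E a" and z: "z \<in> inner e"
  shows "linked (E - {e}) z a"
proof -
  have eE: "e \<in> E" using e by (simp add: touches_def)
  then obtain w where w: "w \<in> closure (connected_component_set (- drawn E) a)" "w \<in> inner e"
    using e by (auto simp: touches_def)
  let ?f = "connected_component_set (- drawn (E - {e})) w"
  have "w \<in> - drawn (E - {e})" using inner_Int_drawn[of e "E - {e}"] w eE E by blast
  then have "w \<in> ?f" by (simp add: connected_component_refl)
  moreover have "open ?f" using open_Compl_drawn[of "E - {e}"] E by (intro open_connected_component) auto
  ultimately obtain b where "b \<in> ?f" "b \<in> connected_component_set (- drawn E) a"
    using open_meets_if_closure[of ?f w] w(1) by blast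
  then have b: "b \<in> ?f" "linked E a b" by simp_all
  have "linked (E - {e}) b a" using linked_mono[OF b(2), of "E - {e}"] linked_sym by blast
  moreover have "linked (E - {e}) w b" using b(1) by simp
  moreover have "linked (E - {e}) z w" using linked_inner[of e "E - {e}" z w] eE E z w by blast
  ultimately show ?thesis using linked_trans by blast
qed

section \<open>Edges border at most two faces, and face boundaries contain cycles\<close>

lemma connected_subset_singleton: "S \<subseteq> {x} \<Longrightarrow> connected (S :: complex set)"
  by (metis connected_empty connected_sing subset_singletonD)

lemma linked_arc:
  assumes "e \<in> E0" "a \<notin> img e" "b \<notin> img e"
  shows "connected_component (- img e) a b"
proof -
  have "connected (- img e)" using connected_arc_complement[OF arc_edge[OF assms(1)]] by simp
  then show ?thesis using assms by (auto simp: connected_component_def)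
qed

text \<open>Janiszewski's theorem twice: the drawing \<open>E1\<close> on the side of
  \<open>u\<close>, the arc of \<open>e\<close>, and the rest \<open>E2\<close> are glued at no more
  than the single points \<open>p u\<close> and \<open>p v\<close>, so their union does not separate
  \<open>a\<close> from \<open>b\<close>.\<close>

lemma linked_across_bridge:
  assumes E: "E \<subseteq> E0" and e: "e \<in> E" "e = {u, v}"
    and bridge: "\<not> (\<lambda>a b. {a, b} \<in> E - {e})\<^sup>*\<^sup>* u v"
    and ab: "linked (E - {e}) a b" "a \<notin> drawn E" "b \<notin> drawn E"
  shows "linked E a b"
proof -
  let ?R = "(\<lambda>a b. {a, b} \<in> E - {e})\<^sup>*\<^sup>*"
  define C where "C = {w. ?R u w}"
  define E1 where "E1 = {f \<in> E - {e}. f \<inter> C \<noteq> {}}"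
  define E2 where "E2 = {f \<in> E - {e}. f \<inter> C = {}}"
  have uC: "u \<in> C" "v \<notin> C" using bridge by (auto simp: C_def)
  have E1C: "f \<subseteq> C" if "f \<in> E1" for f
  proof -
    have f: "f \<in> E - {e}" "f \<inter> C \<noteq> {}" using that by (auto simp: E1_def)
    then obtain x y where xy: "f = {x, y}" using card_edge E by (metis Diff_iff card_2_iff subsetD)
    have "{y, x} \<in> E - {e}" "{x, y} \<in> E - {e}" using f xy by (auto simp: insert_commute)
    then have "x \<in> C \<Longrightarrow> y \<in> C" "y \<in> C \<Longrightarrow> x \<in> C"
      unfolding C_def by (auto intro: rtranclp.rtrancl_into_rtrancl)
    then show ?thesis using f xy by auto
  qed
  have sub: "E1 \<subseteq> E0" "E2 \<subseteq> E0" "e \<notin> E1" "e \<notin> E2" "E1 \<subseteq> E - {e}" "E2 \<subseteq> E - {e}" using E by (auto simp: E1_def E2_def)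
  have eE0: "e \<in> E0" using e E by blast
  have un: "drawn E = (drawn E1 \<union> img e) \<union> drawn E2"
  proof -
    have "E = insert e (E1 \<union> E2)" using e(1) by (auto simp: E1_def E2_def)
    then show ?thesis by (auto simp: drawn_def)
  qed
  have an: "a \<notin> img e" "b \<notin> img e" using ab un by blast+
  have l12: "linked E1 a b" "linked E2 a b" using linked_mono[OF ab(1)] sub by blast+
  have "drawn E1 \<inter> img e \<subseteq> {p u}"
    using image_Int_drawn[OF eE0 sub(1,3)] E1C uC e(2) by blast
  then have "connected_component (- (drawn E1 \<union> img e)) a b"
    by (rule Janiszewski[OF compact_drawn[OF sub(1)] closed_arc_image[OF arc_edge[OF eE0]]
          connected_subset_singleton l12(1) linked_arc[OF eE0 an]])
  moreover have "compact (drawn E1 \<union> img e)"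
    using compact_drawn[OF sub(1)] compact_arc_image[OF arc_edge[OF eE0]] by (rule compact_Un)
  moreover have "(drawn E1 \<union> img e) \<inter> drawn E2 \<subseteq> {p v}"
  proof -
    have "drawn E1 \<inter> drawn E2 = {}"
    proof -
      have "img f \<inter> img g = {}" if fg: "f \<in> E1" "g \<in> E2" for f g
      proof -
        have d: "f \<inter> g = {}" using E1C[OF fg(1)] fg(2) by (auto simp: E2_def)
        have "f \<noteq> {}" using fg by (auto simp: E1_def)
        then have "f \<noteq> g" using d by auto
        then show ?thesis using image_Int_image[of f g] fg sub d by blast
      qed
      then show ?thesis unfolding drawn_def by blast
    qed
    moreover have "img e \<inter> drawn E2 \<subseteq> {p v}"
    proof -
      have "e \<inter> \<Union>E2 \<subseteq> {v}" using uC e(2) by (auto simp: E2_def)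
      then have "p ` (e \<inter> \<Union>E2) \<subseteq> {p v}" by (auto dest!: subsetD)
      with image_Int_drawn[OF eE0 sub(2,4)] show ?thesis by (rule order_trans)
    qed
    ultimately show ?thesis by blast
  qed
  moreover have "closed (drawn E2)" using compact_drawn[OF sub(2)] compact_imp_closed by blast
  ultimately show ?thesis
    unfolding un by (intro Janiszewski[OF _ _ connected_subset_singleton _ l12(2)])
qed

text \<open>A bridge has at most one face. Otherwise \<open>e\<close> lies on a Jordan curve, and
  faces touching \<open>e\<close> from the same side of it coincide by Janiszewski's theorem,
  because the curve meets the drawing without \<open>e\<close> in a connected path.\<close>

lemma card_touches_le_2:
  assumes E: "E \<subseteq> E0" and P: "finite P" "P \<inter> drawn E = {}" "\<And>a b. a \<in> P \<Longrightarrow> b \<in> P \<Longrightarrow> linked E a b \<Longrightarrow> a = b"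
    and e: "e \<in> E"
  shows "card {a \<in> P. e \<in> touches E a} \<le> 2"
proof -
  let ?Q = "{a \<in> P. e \<in> touches E a}"
  have eE0: "e \<in> E0" using e E by blast
  obtain z where z: "z \<in> inner e" using inner_nonempty[OF eE0] by blast
  have lk: "linked (E - {e}) a b" if "a \<in> ?Q" "b \<in> ?Q" for a b
    using touches_linked[OF E _ z] that linked_sym linked_trans by blast
  obtain u v where uv: "e = {u, v}" "u \<noteq> v" using card_edge[OF eE0] by (meson card_2_iff)
  show ?thesis
  proof (cases "(\<lambda>a b. {a, b} \<in> E - {e})\<^sup>*\<^sup>* u v")
    case False
    have "a = b" if "a \<in> ?Q" "b \<in> ?Q" for a b
    proof -
      have "linked E a b" using linked_across_bridge[OF E e uv(1) False lk[OF that]] that P(2) by blast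
      then show ?thesis using P(3) that by blast
    qed
    then have "card ?Q \<le> 1" using P(1) by (simp add: card_le_Suc0_iff_eq)
    then show ?thesis by simp
  next
    case True
    obtain xs where xs: "distinct xs" "xs \<noteq> []" "hd xs = u" "last xs = v" "successively (\<lambda>a b. {a, b} \<in> E - {e}) xs"
      using rtranclp_distinct_path[OF True] by blast
    have pe: "path_edges xs \<subseteq> E - {e}" using xs(5) by (simp add: path_edges_subset_iff)
    have len: "2 \<le> length xs"
    proof (cases xs)
      case (Cons x ys)
      then show ?thesis using xs uv by (cases ys) auto
    qed (use xs in auto)
    have prem: "path_edges xs \<subseteq> E0 - {e}" using pe E by blast
    have eq: "e = {hd xs, last xs}" using uv xs by simp
    obtain c where c: "simple_path c" "pathfinish c = pathstart c"
        "path_image c = img e \<union> drawn (path_edges xs)" "connected (drawn (path_edges xs))"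
        "p ` e \<subseteq> drawn (path_edges xs)"
      by (rule jordan_cycle[OF xs(1) len prem eE0 eq])
    note J = Jordan_inside_outside[OF c(1,2)]
    have side: "a = b" if ab: "a \<in> ?Q" "b \<in> ?Q" and S: "S \<in> {inside (path_image c), outside (path_image c)}" "a \<in> S" "b \<in> S" for a b S
    proof -
      have "connected S" "S \<subseteq> - path_image c" using S J by blast+
      then have 1: "connected_component (- path_image c) a b" using S unfolding connected_component_def by blast
      have "path_image c \<inter> drawn (E - {e}) = drawn (path_edges xs)"
      proof
        show "drawn (path_edges xs) \<subseteq> path_image c \<inter> drawn (E - {e})" using pe c(3) by (auto simp: drawn_def)
        have "img e \<inter> drawn (E - {e}) \<subseteq> p ` e" using image_Int_drawn[OF eE0, of "E - {e}"] E by blast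
        then show "path_image c \<inter> drawn (E - {e}) \<subseteq> drawn (path_edges xs)" using c(3,5) by blast
      qed
      then have 2: "connected (path_image c \<inter> drawn (E - {e}))" using c(4) by simp
      have 3: "compact (path_image c)" using c(1) by (rule compact_simple_path_image)
      have 4: "closed (drawn (E - {e}))" using compact_drawn[of "E - {e}"] E compact_imp_closed by blast
      have "path_image c \<union> drawn (E - {e}) = drawn E"
        using c(3) pe drawn_remove[OF e] by (auto simp: drawn_def)
      then have "linked E a b" using Janiszewski[OF 3 4 2 1 lk[OF ab]] by simp
      then show ?thesis using P(3) ab by blast
    qed
    have cE: "path_image c \<subseteq> drawn E" using c(3) pe e by (auto simp: drawn_def)
    let ?i = "inside (path_image c)" and ?o = "outside (path_image c)"
    have "?i \<union> ?o = - path_image c" using J by simp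
    then have Q: "?Q = (?Q \<inter> ?i) \<union> (?Q \<inter> ?o)" using P(2) cE by blast
    have "card ?Q \<le> card (?Q \<inter> ?i) + card (?Q \<inter> ?o)"
      by (rule order_trans[OF eq_refl[OF arg_cong[OF Q, of card]] card_Un_le])
    moreover have "card (?Q \<inter> S) \<le> 1" if "S \<in> {?i, ?o}" for S
    proof -
      have "finite (?Q \<inter> S)" using P(1) by simp
      moreover have "\<forall>a\<in>?Q \<inter> S. \<forall>b\<in>?Q \<inter> S. a = b" using side[OF _ _ that] by blast
      ultimately show ?thesis by (simp add: card_le_Suc0_iff_eq)
    qed
    then have "card (?Q \<inter> ?i) \<le> 1" "card (?Q \<inter> ?o) \<le> 1" by simp_all
    ultimately show ?thesis by linarith
  qed
qed

text \<open>The arc of a leaf edge meets the rest in at most one point, so the two connected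
  complements combine by Janiszewski's theorem. The extra vertices \<open>U\<close> allow the whole
  vertex set to be removed as well.\<close>

lemma connected_Compl_forest:
  assumes "E \<subseteq> E0" "\<not> has_cycle E" "U \<subseteq> V"
  shows "connected (- (drawn E \<union> p ` U))"
  using assms
proof (induction "card E" arbitrary: E U)
  case 0
  then have "E = {}" using finite_sub by auto
  moreover have "finite U" using 0 finite_V finite_subset by blast
  ultimately show ?case
    using connected_open_diff_countable[of UNIV "p ` U"] by (simp add: drawn_def Compl_eq_Diff_UNIV countable_finite connected_UNIV)
next
  case (Suc m)
  have fin: "finite E" using Suc finite_sub by blast
  have "E \<noteq> {}" using Suc by auto
  then obtain e v where e: "e \<in> E" "v \<in> e" "\<And>f. f \<in> E \<Longrightarrow> v \<in> f \<Longrightarrow> f = e"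
    using ex_leaf[OF fin] Suc.prems card_edge by blast
  have eE0: "e \<in> E0" using e Suc by blast
  obtain u where "e = {v, u}" by (rule edge_other_end[OF eE0 e(2)])
  then have u: "e = {u, v}" by (simp add: insert_commute)
  let ?S = "drawn (E - {e}) \<union> p ` (U - {v})"
  have "connected (- ?S)"
  proof (rule Suc.hyps(1))
    show "m = card (E - {e})" using Suc.hyps(2) e(1) by simp
    show "\<not> has_cycle (E - {e})" using Suc.prems(2) has_cycle_mono by blast
  qed (use Suc.prems in auto)
  moreover have "connected (- img e)" using connected_arc_complement[OF arc_edge[OF eE0]] by simp
  moreover have "compact ?S"
  proof (rule compact_Un)
    show "compact (drawn (E - {e}))" using compact_drawn Suc.prems(1) by blast
    show "compact (p ` (U - {v}))" using finite_V Suc.prems(3) by (meson finite_Diff finite_imageI finite_imp_compact finite_subset)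
  qed
  moreover have "?S \<inter> img e \<subseteq> {p u}"
  proof -
    have "e \<inter> \<Union> (E - {e}) \<subseteq> {u}" using e(3) u by blast
    then have "p ` (e \<inter> \<Union> (E - {e})) \<subseteq> {p u}" by (auto dest!: subsetD)
    moreover have "img e \<inter> drawn (E - {e}) \<subseteq> p ` (e \<inter> \<Union> (E - {e}))"
      using Suc.prems(1) by (intro image_Int_drawn[OF eE0]) auto
    ultimately have 1: "img e \<inter> drawn (E - {e}) \<subseteq> {p u}" by (rule order_trans[rotated])
    have "img e \<inter> p ` (U - {v}) \<subseteq> p ` (e \<inter> (U - {v}))"
      using Suc.prems(3) by (intro image_Int_vertices[OF eE0]) auto
    moreover have "p ` (e \<inter> (U - {v})) \<subseteq> {p u}" using u by auto
    ultimately have 2: "img e \<inter> p ` (U - {v}) \<subseteq> {p u}" by (rule order_trans)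
    show ?thesis unfolding Int_Un_distrib2 using 1 2 by (simp add: Int_commute)
  qed
  then have "connected (?S \<inter> img e)" by (rule connected_subset_singleton)
  moreover have "closed (img e)" using closed_arc_image[OF arc_edge[OF eE0]] .
  ultimately have "connected (- (?S \<union> img e))" 
    using Janiszewski_connected[of ?S "img e"] by blast
  moreover have "p v \<in> img e" using ends_in_image[OF eE0] e(2) by blast
  then have "?S \<union> img e = drawn E \<union> p ` U" using drawn_remove[OF e(1)] by auto
  ultimately show ?case by simp
qed

text \<open>Otherwise the complement of the edges touched by the face is connected, so the face fills it.\<close>

lemma has_cycle_touches:
  assumes E: "E \<subseteq> E0" "has_cycle E" and a: "a \<notin> drawn E"
  shows "has_cycle (touches E a)"
proof (rule ccontr)
  assume nc: "\<not> has_cycle (touches E a)"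
  let ?g = "connected_component_set (- drawn E) a"
  let ?Y = "drawn (touches E a) \<union> p ` V"
  have sub: "touches E a \<subseteq> E" by (auto simp: touches_def)
  have con: "connected (- ?Y)" using connected_Compl_forest[OF _ nc] sub E by blast
  have ag: "a \<in> ?g" using a by (simp add: connected_component_refl)
  have og: "open ?g" using open_Compl_drawn[OF E(1)] by (rule open_connected_component)
  have gX: "?g \<subseteq> - drawn E" by (rule connected_component_subset)
  have fr: "frontier ?g \<subseteq> ?Y"
  proof
    fix z assume z: "z \<in> frontier ?g"
    have "frontier ?g \<subseteq> frontier (- drawn E)"
      using open_Compl_drawn[OF E(1)] by (intro frontier_of_connected_component_subset)
    then have "z \<in> drawn E" using z compact_imp_closed[OF compact_drawn[OF E(1)]]
      by (metis frontier_complement frontier_subset_closed subsetD)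
    then obtain e where e: "e \<in> E" "z \<in> img e" by (auto simp: drawn_def)
    show "z \<in> ?Y"
    proof (cases "z \<in> p ` e")
      case True
      then show ?thesis using edge_sub e E by blast
    next
      case False
      then have "e \<in> touches E a" using e z unfolding touches_def frontier_def by blast
      then show ?thesis using e by (auto simp: drawn_def)
    qed
  qed
  show False
  proof (cases "?g \<inter> - ?Y = {}")
    case True
    moreover have "drawn (touches E a) \<subseteq> drawn E" using sub unfolding drawn_def by (rule UN_mono) simp
    ultimately have "?g \<subseteq> p ` V" using gX by blast
    then have "finite ?g" using finite_V finite_subset by blast
    then show False using finite_imp_not_open[OF _ og] ag by blast
  next
    case False
    then have "- ?Y \<inter> ?g \<noteq> {}" by (simp add: Int_commute)
    moreover have "- ?Y \<inter> frontier ?g = {}" using fr by blast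
    ultimately have "- ?Y - ?g = {}" using connected_Int_frontier[OF con] by blast
    then have "- ?Y \<subseteq> ?g" by (simp only: Diff_eq_empty_iff)
    \<comment> \<open>\<open>E\<close> has a cycle and the touched edges have none, so some edge is
      untouched; its interior would lie in the face and thus off the drawing.\<close>
    moreover have "E \<noteq> touches E a" using nc E(2) by auto
    then obtain e where e: "e \<in> E" "e \<notin> touches E a" using sub by blast
    then have eE0: "e \<in> E0" using E by blast
    have "touches E a \<subseteq> E0" using sub E by blast
    then have "inner e \<subseteq> - ?Y"
      using inner_Int_drawn[OF eE0 _ e(2)] edge_avoids_vertices[OF eE0] by fast
    ultimately have "inner e \<subseteq> - drawn E" using gX by blast
    moreover have "inner e \<subseteq> drawn E" using e(1) by (auto simp: drawn_def)
    ultimately show False using inner_nonempty[OF eE0] by blast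
  qed
qed

text \<open>Of F faces, each has at least four boundary edges, except for T triangles with three,
  and an edge is counted at most twice: 4 F - T <= 2 |E|. Combine this with |E| + 2 <= F + |V|. The
  points of \<open>P\<close> represent the T triangles only.\<close>

theorem many_triangles:
  assumes E: "E \<subseteq> E0" "has_cycle E"
  obtains P :: "complex set" and B :: "complex \<Rightarrow> 'v set set"
  where "finite P" "2 * card E + 8 \<le> card P + 4 * card (\<Union>E)"
    "\<And>a. a \<in> P \<Longrightarrow> B a \<subseteq> E \<and> (\<exists>x y z. x \<noteq> y \<and> y \<noteq> z \<and> x \<noteq> z \<and> B a = {{x, y}, {y, z}, {x, z}})"
    "\<And>e. e \<in> E \<Longrightarrow> card {a \<in> P. e \<in> B a} \<le> 2"
proof -
  have fin: "finite E" using finite_sub E by blast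
  have "\<Union>E \<subseteq> V" using edge_sub E by blast
  then have finU: "finite (\<Union>E)" using finite_V by (rule finite_subset)
  have "E \<noteq> {}" using E(2) unfolding has_cycle_def by auto
  then obtain e where "e \<in> E" "card e = 2" using card_edge E(1) by blast
  then have neU: "\<Union>E \<noteq> {}" by force
  obtain P where P: "finite P" "P \<inter> drawn E = {}" "\<And>a b. a \<in> P \<Longrightarrow> b \<in> P \<Longrightarrow> linked E a b \<Longrightarrow> a = b"
      "card E + 2 \<le> card P + card (\<Union>E)"
    by (rule ex_face_points[OF E(1) subset_refl finU neU]) (rule that; blast)
  let ?B = "touches E"
  have Bsub: "?B a \<subseteq> E" for a by (auto simp: touches_def)
  have cyc: "has_cycle (?B a)" if "a \<in> P" for a using has_cycle_touches[OF E] that P(2) by blast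
  have finB: "finite (?B a)" for a using Bsub fin by (rule finite_subset)
  define Q where "Q = {a \<in> P. card (?B a) = 3}"
  have "(\<Sum>a\<in>P. 4 - (if a \<in> Q then 1 else 0)) \<le> (\<Sum>a\<in>P. card (?B a))"
  proof (rule sum_mono)
    fix a assume "a \<in> P"
    then show "4 - (if a \<in> Q then 1 else 0) \<le> card (?B a)"
      using cycle_card(1)[OF cyc finB] by (fastforce simp: Q_def)
  qed
  also have "\<dots> = (\<Sum>a\<in>P. card {e \<in> E. e \<in> ?B a})"
  proof (rule sum.cong[OF refl])
    fix a
    have "{e \<in> E. e \<in> ?B a} = ?B a" using Bsub by blast
    then show "card (?B a) = card {e \<in> E. e \<in> ?B a}" by simp
  qed
  also have "\<dots> = (\<Sum>e\<in>E. card {a \<in> P. e \<in> ?B a})" using P(1) fin by (rule sum_card_swap)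
  also have "\<dots> \<le> (\<Sum>e\<in>E. 2)"
    by (intro sum_mono card_touches_le_2[OF E(1) P(1,2,3)])
  finally have "(\<Sum>a\<in>P. 4 - (if a \<in> Q then 1 else 0)) \<le> 2 * card E" by simp
  moreover have "(\<Sum>a\<in>P. 4 - (if a \<in> Q then 1 else 0)) + card Q = 4 * card P"
  proof -
    have "(\<Sum>a\<in>P. 4 - (if a \<in> Q then 1 else 0)) + (\<Sum>a\<in>P. if a \<in> Q then 1 else 0) = (\<Sum>a\<in>P. 4::nat)"
      unfolding sum.distrib[symmetric] by (rule sum.cong) auto
    moreover have "P \<inter> Q = Q" by (auto simp: Q_def)
    then have "(\<Sum>a\<in>P. if a \<in> Q then 1 else 0) = card Q"
      using P(1) by (simp add: sum.If_cases Int_def)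
    ultimately show ?thesis by simp
  qed
  ultimately have cardQ: "2 * card E + 8 \<le> card Q + 4 * card (\<Union>E)" using P(4) by linarith
  show ?thesis
  proof (rule that[of Q ?B])
    show "finite Q" using P(1) by (simp add: Q_def)
    show "2 * card E + 8 \<le> card Q + 4 * card (\<Union>E)" by (rule cardQ)
    show "?B a \<subseteq> E \<and> (\<exists>x y z. x \<noteq> y \<and> y \<noteq> z \<and> x \<noteq> z \<and> ?B a = {{x, y}, {y, z}, {x, z}})" if "a \<in> Q" for a
      using cycle_card(2)[OF cyc finB, of a] that Bsub[of a] by (simp add: Q_def)
    show "card {a \<in> Q. e \<in> ?B a} \<le> 2" if "e \<in> E" for e
    proof -
      have "card {a \<in> Q. e \<in> ?B a} \<le> card {a \<in> P. e \<in> ?B a}"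
        using P(1) by (intro card_mono) (auto simp: Q_def)
      then show ?thesis using card_touches_le_2[OF E(1) P(1,2,3) that] by linarith
    qed
  qed
qed

end

section \<open>Discharging\<close>

definition edge_degree :: "'v set set \<Rightarrow> 'v \<Rightarrow> nat" where
  "edge_degree E v = card {e \<in> E. v \<in> e}"

definition edge_adj :: "'v set \<Rightarrow> 'v set \<Rightarrow> bool" where
  "edge_adj e f \<longleftrightarrow> e \<noteq> f \<and> e \<inter> f \<noteq> {}"

interpretation edge_adj: sym_adj edge_adj
  by unfold_locales (auto simp: edge_adj_def)

lemma edge_degree_mono: "finite E \<Longrightarrow> E' \<subseteq> E \<Longrightarrow> edge_degree E' v \<le> edge_degree E v"
  unfolding edge_degree_def by (intro card_mono) auto

lemma sum_if_const:
  fixes r :: "'b::comm_semiring_1"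
  assumes "finite A"
  shows "(\<Sum>x\<in>A. if Q x then r else 0) = r * of_nat (card {x \<in> A. Q x})"
  using sum.inter_filter[OF assms, of "\<lambda>_. r" Q] by (simp add: mult.commute)

lemma card_edge_neighbors:
  assumes E: "finite E" "{u, v} \<in> E" "u \<noteq> v"
  shows "card {f \<in> E. edge_adj {u, v} f} + 2 \<le> edge_degree E u + edge_degree E v"
proof -
  let ?A = "{f \<in> E. u \<in> f} - {{u, v}}" and ?B = "{f \<in> E. v \<in> f} - {{u, v}}"
  have "card {f \<in> E. edge_adj {u, v} f} \<le> card (?A \<union> ?B)"
    using E by (intro card_mono) (auto simp: edge_adj_def)
  also have "\<dots> \<le> card ?A + card ?B" by (rule card_Un_le)
  finally have "card {f \<in> E. edge_adj {u, v} f} \<le> card ?A + card ?B" .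
  moreover have "Suc (card ?A) = edge_degree E u" "Suc (card ?B) = edge_degree E v"
    unfolding edge_degree_def using E by (intro card_Suc_Diff1; auto)+
  ultimately show ?thesis by linarith
qed

text \<open>The share a vertex of degree \<open>d\<close> can give to each incident triangle.\<close>

definition weight :: "nat \<Rightarrow> real" where
  "weight d = (if d \<le> 4 then 0 else if d = 5 then 1/5 else if d = 6 then 1/3 else if d = 7 then 3/7 else 1/2)"

lemma weight_nonneg: "0 \<le> weight d"
  by (simp add: weight_def)

text \<open>If the least degree is at most 4, equal to 5, or at least 6, then the other two are at
  least 8, 7 or 6, which yields 1/2 + 1/2, 1/5 + 3/7 + 3/7 > 1, or three times 1/3.\<close>

lemma weight_triangle:
  assumes "12 \<le> a + b" "12 \<le> b + c" "12 \<le> a + c"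
  shows "1 \<le> weight a + weight b + weight c"
proof -
  have *: "1 \<le> weight a + weight b + weight c" if "12 \<le> a + b" "12 \<le> a + c" "a \<le> b" "a \<le> c" for a b c
  proof -
    have b7: "3/7 \<le> weight b" if "7 \<le> b" for b using that by (auto simp: weight_def)
    have b6: "1/3 \<le> weight b" if "6 \<le> b" for b using that by (auto simp: weight_def)
    have b8: "1/2 \<le> weight b" if "8 \<le> b" for b using that by (auto simp: weight_def)
    consider "a \<le> 4" | "a = 5" | "a \<ge> 6" by linarith
    then show ?thesis
    proof cases
      case 1
      then show ?thesis using b8[of b] b8[of c] that weight_nonneg[of a] by linarith
    next
      case 2
      then have "weight a = 1/5" by (simp add: weight_def)
      then show ?thesis using b7[of b] b7[of c] that 2 by linarith
    next
      case 3
      then show ?thesis using b6[of a] b6[of b] b6[of c] that by linarith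
    qed
  qed
  consider "a \<le> b" "a \<le> c" | "b \<le> a" "b \<le> c" | "c \<le> a" "c \<le> b" by linarith
  then show ?thesis
    by cases (use *[of a b c] *[of b a c] *[of c a b] assms in \<open>simp_all add: algebra_simps\<close>)
qed

text \<open>From 4 to 8 the weight is (d - 4) / d, so at one triangle per edge a vertex gives away
  exactly its charge. Beyond 8 the cap 1/2 leaves d / 2 - 4, which is 1/2 at d = 9.\<close>

lemma weight_excess:
  assumes "3 \<le> d" "d \<le> D" "9 \<le> D"
  shows "(if d = D then 1/2 else 0) - (if d = 3 then 1 else 0) \<le> real d - 4 - weight d * real d"
proof -
  consider "d = 3" | "d = 4" | "d = 5" | "d = 6" | "d = 7" | "d \<ge> 8" using assms by linarith
  then show ?thesis
  proof cases
    case 6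
    then have w: "weight d = 1/2" by (simp add: weight_def)
    show ?thesis unfolding w using 6 assms by (cases "d = D") simp_all
  qed (use assms in \<open>auto simp: weight_def\<close>)
qed

lemma cycle_function:
  assumes "has_cycle E"
  obtains n :: int and w :: "int \<Rightarrow> 'v" where "n \<ge> 3" "\<And>i. {w i, w (i + 1)} \<in> E" "\<And>i j. w i = w j \<longleftrightarrow> n dvd i - j"
proof -
  obtain xs where xs: "distinct xs" "3 \<le> length xs" "successively (\<lambda>a b. {a, b} \<in> E) xs" "{last xs, hd xs} \<in> E"
    using assms unfolding has_cycle_def by blast
  let ?n = "int (length xs)"
  let ?w = "\<lambda>i. xs ! nat (i mod ?n)"
  have n: "?n \<ge> 3" using xs(2) by linarith
  have b: "nat (i mod ?n) < length xs" for i
    using n pos_mod_bound[of ?n i] pos_mod_sign[of ?n i] by linarith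
  have nn: "0 \<le> i mod ?n" for i using pos_mod_sign[of ?n i] n by linarith
  show ?thesis
  proof (rule that[of ?n ?w])
    show "?n \<ge> 3" by (rule n)
    show "?w i = ?w j \<longleftrightarrow> ?n dvd i - j" for i j
    proof -
      have "?w i = ?w j \<longleftrightarrow> nat (i mod ?n) = nat (j mod ?n)" using nth_eq_iff_index_eq[OF xs(1) b b] .
      also have "\<dots> \<longleftrightarrow> i mod ?n = j mod ?n" by (rule eq_nat_nat_iff[OF nn nn])
      finally show ?thesis by (simp add: mod_eq_dvd_iff)
    qed
    show "{?w i, ?w (i + 1)} \<in> E" for i
    proof (cases "i mod ?n = ?n - 1")
      case True
      then have "(i + 1) mod ?n = 0" by (metis diff_add_cancel mod_add_left_eq mod_self)
      moreover have "nat (i mod ?n) = length xs - 1" using True n by simp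
      moreover have "xs \<noteq> []" using xs(2) by auto
      ultimately show ?thesis using xs(4) by (simp add: last_conv_nth hd_conv_nth)
    next
      case False
      then have lt: "i mod ?n < ?n - 1" using n pos_mod_bound[of ?n i] by linarith
      then have "(i mod ?n + 1) mod ?n = i mod ?n + 1" using n nn[of i] by (intro mod_pos_pos_trivial) linarith+
      then have "(i + 1) mod ?n = i mod ?n + 1" by (metis mod_add_left_eq)
      then have "nat ((i + 1) mod ?n) = Suc (nat (i mod ?n))" using nn[of i] by linarith
      moreover have "Suc (nat (i mod ?n)) < length xs" using lt nn[of i] by linarith
      ultimately show ?thesis using xs(3) by (simp add: successively_conv_nth)
    qed
  qed
qed

context plane_graph
begin

text \<open>At vertices of \<open>Z\<close> the degree is read as if one deleted edge were still
  there. The correction in \<open>heavy\<close> is 1 even if both ends lie in \<open>Z\<close>,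
  matching the single color by which the list of such an edge is shortened. A forest would contain
  too few edges to meet the three edges at each vertex of degree 3.\<close>

lemma has_cycle_three_edges:
  fixes E :: "'v set set" and Z :: "'v set" and D :: nat
  defines "s \<equiv> \<lambda>v. if v \<in> Z then 1 else 0 :: nat"
  assumes E: "E \<subseteq> E0" "E \<noteq> {}" and Z: "finite Z" "card Z \<le> 4" and D: "9 \<le> D"
    and deg: "\<And>v. v \<in> \<Union>E \<Longrightarrow> edge_degree E v + s v \<le> D"
    and heavy: "\<And>u v. {u, v} \<in> E \<Longrightarrow> u \<noteq> v \<Longrightarrow>
      D + 3 \<le> edge_degree E u + edge_degree E v + (if {u, v} \<inter> Z = {} then 0 else 1)"
  shows "has_cycle {e \<in> E. \<exists>x\<in>e. edge_degree E x + s x = 3}"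
proof (rule ccontr)
  let ?B = "{e \<in> E. \<exists>x\<in>e. edge_degree E x + s x = 3}"
  assume nc: "\<not> has_cycle ?B"
  let ?U = "\<Union>E"
  let ?d = "\<lambda>v. edge_degree E v + s v"
  have finE: "finite E" using finite_sub E by blast
  have "?U \<subseteq> V" using edge_sub E by blast
  then have finU: "finite ?U" using finite_V by (rule finite_subset)
  have two: "card e = 2" if "e \<in> E" for e using card_edge E that by blast
  have pair: "\<exists>w. e = {v, w} \<and> w \<noteq> v" if e: "e \<in> E" "v \<in> e" for e v
    using edge_other_end[of e v] e E by blast
  have sum12: "D + 3 \<le> ?d u + ?d v" if "{u, v} \<in> E" "u \<noteq> v" for u v
    using heavy[OF that] by (auto simp: s_def split: if_splits)
  have deg2: "2 \<le> edge_degree E v" and d3: "3 \<le> ?d v" if v: "v \<in> ?U" for v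
  proof -
    obtain e where "e \<in> E" "v \<in> e" using v by blast
    then obtain w where w: "{v, w} \<in> E" "w \<noteq> v" using pair by blast
    have "edge_degree E w + s w \<le> D" using deg[of w] w by blast
    then show "2 \<le> edge_degree E v" "3 \<le> ?d v"
      using heavy[OF w(1)] w(2) by (auto simp: s_def split: if_splits)
  qed
  have cyc: "has_cycle E"
  proof (rule ccontr)
    assume "\<not> has_cycle E"
    then obtain e v where e: "e \<in> E" "v \<in> e" "\<And>f. f \<in> E \<Longrightarrow> v \<in> f \<Longrightarrow> f = e"
      using ex_leaf[OF finE two E(2)] by blast
    then have "{f \<in> E. v \<in> f} \<subseteq> {e}" by blast
    then have "edge_degree E v \<le> card {e}" unfolding edge_degree_def by (intro card_mono) auto
    moreover have "v \<in> ?U" using e(1,2) by blast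
    ultimately show False using deg2[of v] by simp
  qed
  obtain P :: "complex set" and B :: "complex \<Rightarrow> 'v set set" where PB: "finite P" "2 * card E + 8 \<le> card P + 4 * card ?U"
      "\<And>a. a \<in> P \<Longrightarrow> B a \<subseteq> E \<and> (\<exists>x y z. x \<noteq> y \<and> y \<noteq> z \<and> x \<noteq> z \<and> B a = {{x, y}, {y, z}, {x, z}})"
      "\<And>e. e \<in> E \<Longrightarrow> card {a \<in> P. e \<in> B a} \<le> 2"
  proof (rule many_triangles[OF E(1) cyc])
    fix P :: "complex set" and B :: "complex \<Rightarrow> 'v set set"
    assume 1: "finite P" and 2: "2 * card E + 8 \<le> card P + 4 * card ?U"
      and 3: "\<And>a. a \<in> P \<Longrightarrow> B a \<subseteq> E \<and> (\<exists>x y z. x \<noteq> y \<and> y \<noteq> z \<and> x \<noteq> z \<and> B a = {{x, y}, {y, z}, {x, z}})"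
      and 4: "\<And>e. e \<in> E \<Longrightarrow> card {a \<in> P. e \<in> B a} \<le> 2"
    show thesis by (rule that[of P B]) (fact 1, fact 2, erule 3, erule 4)
  qed
  define t where "t v = card {a \<in> P. v \<in> \<Union> (B a)}" for v
  \<comment> \<open>Each triangle at \<open>v\<close> uses two edges at \<open>v\<close>, and each
    edge belongs to at most two triangles.\<close>
  have t_le: "t v \<le> edge_degree E v" for v
  proof -
    let ?Ev = "{e \<in> E. v \<in> e}"
    have "2 * t v = (\<Sum>a\<in>{a \<in> P. v \<in> \<Union> (B a)}. 2)" by (simp add: t_def)
    also have "\<dots> \<le> (\<Sum>a\<in>{a \<in> P. v \<in> \<Union> (B a)}. card {e \<in> ?Ev. e \<in> B a})"
    proof (rule sum_mono)
      fix a assume a: "a \<in> {a \<in> P. v \<in> \<Union> (B a)}"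
      then obtain x y z where xyz: "x \<noteq> y" "y \<noteq> z" "x \<noteq> z" "B a = {{x, y}, {y, z}, {x, z}}" and sub: "B a \<subseteq> E"
        using PB(3)[of a] by blast
      have v: "v \<in> {x, y, z}" using a xyz by auto
      have "\<exists>p q. p \<noteq> q \<and> {p, q} \<subseteq> {e \<in> B a. v \<in> e}"
      proof -
        consider "v = x" | "v = y" | "v = z" using v by blast
        then show ?thesis
        proof cases
          case 1
          then show ?thesis using xyz by (intro exI[of _ "{x, y}"] exI[of _ "{x, z}"]) (auto simp: doubleton_eq_iff)
        next
          case 2
          then show ?thesis using xyz by (intro exI[of _ "{x, y}"] exI[of _ "{y, z}"]) (auto simp: doubleton_eq_iff)
        next
          case 3
          then show ?thesis using xyz by (intro exI[of _ "{y, z}"] exI[of _ "{x, z}"]) (auto simp: doubleton_eq_iff)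
        qed
      qed
      then obtain p q where pq: "p \<noteq> q" "{p, q} \<subseteq> {e \<in> B a. v \<in> e}" by blast
      then have "{p, q} \<subseteq> {e \<in> ?Ev. e \<in> B a}" using sub by blast
      then have "card {p, q} \<le> card {e \<in> ?Ev. e \<in> B a}" using finE by (intro card_mono) auto
      then show "2 \<le> card {e \<in> ?Ev. e \<in> B a}" using pq(1) by simp
    qed
    also have "\<dots> \<le> (\<Sum>a\<in>P. card {e \<in> ?Ev. e \<in> B a})"
      using PB(1) by (intro sum_mono2) auto
    also have "\<dots> = (\<Sum>e\<in>?Ev. card {a \<in> P. e \<in> B a})"
      using PB(1) finE by (intro sum_card_swap) auto
    also have "\<dots> \<le> (\<Sum>e\<in>?Ev. 2)" using PB(4) by (intro sum_mono) auto
    also have "\<dots> = 2 * edge_degree E v" by (simp add: edge_degree_def)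
    finally show ?thesis by simp
  qed
  \<comment> \<open>Every triangle collects at least 1 from its three vertices; after exchanging the
    sums, each vertex pays its weight at most once per incident edge.\<close>
  have "real (card P) \<le> (\<Sum>a\<in>P. \<Sum>v\<in>?U. if v \<in> \<Union> (B a) then weight (?d v) else 0)"
  proof -
    have "(\<Sum>a\<in>P. 1::real) \<le> (\<Sum>a\<in>P. \<Sum>v\<in>?U. if v \<in> \<Union> (B a) then weight (?d v) else 0)"
    proof (rule sum_mono)
      fix a assume "a \<in> P"
      then obtain x y z where xyz: "x \<noteq> y" "y \<noteq> z" "x \<noteq> z" "B a = {{x, y}, {y, z}, {x, z}}" and sub: "B a \<subseteq> E"
        using PB(3)[of a] by blast
      have "12 \<le> ?d x + ?d y" "12 \<le> ?d y + ?d z" "12 \<le> ?d x + ?d z"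
        using sum12[of x y] sum12[of y z] sum12[of x z] xyz sub D by auto
      then have "1 \<le> weight (?d x) + weight (?d y) + weight (?d z)" by (rule weight_triangle)
      also have "\<dots> = (\<Sum>v\<in>{x, y, z}. weight (?d v))" using xyz(1-3) by simp
      also have "{x, y, z} = ?U \<inter> \<Union> (B a)" using sub xyz(4) by auto
      also have "(\<Sum>v\<in>?U \<inter> \<Union> (B a). weight (?d v)) = (\<Sum>v\<in>?U. if v \<in> \<Union> (B a) then weight (?d v) else 0)"
        using finU by (rule sum.inter_restrict)
      finally show "1 \<le> (\<Sum>v\<in>?U. if v \<in> \<Union> (B a) then weight (?d v) else 0)" .
    qed
    then show ?thesis by simp
  qed
  also have "\<dots> = (\<Sum>v\<in>?U. \<Sum>a\<in>P. if v \<in> \<Union> (B a) then weight (?d v) else 0)" by (rule sum.swap)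
  also have "\<dots> = (\<Sum>v\<in>?U. weight (?d v) * real (t v))"
  proof (rule sum.cong[OF refl])
    fix v
    have "(\<Sum>a\<in>P. if v \<in> \<Union> (B a) then weight (?d v) else 0) = (\<Sum>a\<in>{a \<in> P. v \<in> \<Union> (B a)}. weight (?d v))"
      using sum.inter_filter[OF PB(1), of "\<lambda>_. weight (?d v)" "\<lambda>a. v \<in> \<Union> (B a)"] by simp
    then show "(\<Sum>a\<in>P. if v \<in> \<Union> (B a) then weight (?d v) else 0) = weight (?d v) * real (t v)"
      by (simp add: t_def)
  qed
  also have "\<dots> \<le> (\<Sum>v\<in>?U. weight (?d v) * real (edge_degree E v))"
    using t_le weight_nonneg by (intro sum_mono mult_left_mono) auto
  finally have upper: "real (card P) \<le> (\<Sum>v\<in>?U. weight (?d v) * real (edge_degree E v))" .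
  have "(\<Sum>v\<in>?U. edge_degree E v) = (\<Sum>e\<in>E. card {v \<in> ?U. v \<in> e})"
    unfolding edge_degree_def using finU finE by (rule sum_card_swap)
  also have "\<dots> = (\<Sum>e\<in>E. 2)"
  proof (rule sum.cong[OF refl])
    fix e assume "e \<in> E"
    then have "{v \<in> ?U. v \<in> e} = e" by blast
    then show "card {v \<in> ?U. v \<in> e} = 2" using two[OF \<open>e \<in> E\<close>] by simp
  qed
  finally have handshake: "(\<Sum>v\<in>?U. real (edge_degree E v)) = 2 * real (card E)"
    by (simp flip: of_nat_sum)
  let ?N3 = "{v \<in> ?U. ?d v = 3}" and ?ND = "{v \<in> ?U. ?d v = D}"
  \<comment> \<open>Weights refer to the degree with \<open>s v\<close> added, the charge to the
    actual degree. The difference costs at most \<open>s v\<close>, hence at most 4 over all of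
    \<open>Z\<close>.\<close>
  have charge: "(if ?d v = D then 1/2 else 0) - (if ?d v = 3 then 1 else 0) - real (s v)
      \<le> real (edge_degree E v) - 4 - weight (?d v) * real (edge_degree E v)" if v: "v \<in> ?U" for v
  proof -
    have "(if ?d v = D then 1/2 else 0) - (if ?d v = 3 then 1 else 0) \<le> real (?d v) - 4 - weight (?d v) * real (?d v)"
      using weight_excess[OF d3[OF v] deg[OF v] D] .
    moreover have "0 \<le> weight (?d v) * real (s v)" using weight_nonneg by simp
    ultimately show ?thesis by (simp add: algebra_simps)
  qed
  have sumif: "(\<Sum>v\<in>?U. if Q v then r else (0::real)) = r * real (card {v \<in> ?U. Q v})" for Q r
    using finU by (rule sum_if_const)
  have "(\<Sum>v\<in>?U. (if ?d v = D then 1/2 else 0) - (if ?d v = 3 then 1 else 0) - real (s v))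
      \<le> (\<Sum>v\<in>?U. real (edge_degree E v) - 4 - weight (?d v) * real (edge_degree E v))"
    using charge by (rule sum_mono)
  also have "\<dots> = 2 * real (card E) - 4 * real (card ?U) - (\<Sum>v\<in>?U. weight (?d v) * real (edge_degree E v))"
    by (simp add: sum_subtractf handshake)
  also have "\<dots> \<le> - 8" using upper PB(2) by linarith
  finally have "real (card ?ND) / 2 - real (card ?N3) - (\<Sum>v\<in>?U. real (s v)) \<le> - 8"
    by (simp add: sum_subtractf sumif)
  moreover have "(\<Sum>v\<in>?U. real (s v)) \<le> 4"
  proof -
    have sr: "real (s v) = (if v \<in> Z then 1 else 0)" for v by (simp add: s_def)
    have "(\<Sum>v\<in>?U. real (s v)) = real (card {v \<in> ?U. v \<in> Z})"
      using sumif[of "\<lambda>v. v \<in> Z" 1] by (simp only: sr mult_1)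
    also have "card {v \<in> ?U. v \<in> Z} \<le> card Z" using Z(1) by (intro card_mono) auto
    finally show ?thesis using Z(2) by linarith
  qed
  ultimately have key: "real (card ?ND) / 2 + 4 \<le> real (card ?N3)" by linarith
  have finB: "finite ?B" using finE by simp
  have finN: "finite ?N3" "finite ?ND"
    using finite_subset[OF _ finU, of ?N3] finite_subset[OF _ finU, of ?ND] by blast+
  have far: "?d y = D" if "{x, y} \<in> E" "x \<noteq> y" "?d x = 3" for x y
    using sum12[OF that(1,2)] deg[of y] that by auto
  have "\<Union>?B \<subseteq> ?N3 \<union> ?ND"
  proof
    fix v assume "v \<in> \<Union>?B"
    then obtain e x where e: "e \<in> E" "v \<in> e" "x \<in> e" "?d x = 3" by blast
    show "v \<in> ?N3 \<union> ?ND"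
    proof (cases "v = x")
      case False
      obtain w where "e = {x, w}" "w \<noteq> x" using pair[OF e(1,3)] by blast
      then have "e = {x, v}" using False e by auto
      then show ?thesis using far[of x v] e False by auto
    qed (use e in auto)
  qed
  moreover have "?N3 \<noteq> {}"
  proof
    assume "?N3 = {}"
    then have "card ?N3 = 0" by (simp only: card.empty)
    then show False using key by simp
  qed
  then have "?N3 \<union> ?ND \<noteq> {}" by blast
  ultimately have "card ?B < card (?N3 \<union> ?ND)"
    using finB finN two nc by (intro forest_card) auto
  also have "\<dots> \<le> card ?N3 + card ?ND" by (rule card_Un_le)
  finally have forest: "card ?B < card ?N3 + card ?ND" .
  \<comment> \<open>Both ends of an edge cannot have degree 3, as their degrees add up to at least
    12; so each edge of \<open>?B\<close> is counted at most once.\<close>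
  have "(\<Sum>x\<in>?N3. edge_degree E x) = (\<Sum>x\<in>?N3. card {e \<in> ?B. x \<in> e})"
  proof (rule sum.cong[OF refl])
    fix x assume "x \<in> ?N3"
    then have "{e \<in> E. x \<in> e} = {e \<in> ?B. x \<in> e}" by blast
    then show "edge_degree E x = card {e \<in> ?B. x \<in> e}" by (simp only: edge_degree_def)
  qed
  also have "\<dots> = (\<Sum>e\<in>?B. card {x \<in> ?N3. x \<in> e})" using finN(1) finB by (rule sum_card_swap)
  also have "\<dots> \<le> (\<Sum>e\<in>?B. 1)"
  proof (rule sum_mono)
    fix e assume e: "e \<in> ?B"
    have "x = y" if xy: "x \<in> e" "y \<in> e" "?d x = 3" "?d y = 3" for x y
    proof (rule ccontr)
      assume "x \<noteq> y"
      moreover obtain w where "e = {x, w}" "w \<noteq> x" using pair[of e x] e xy by blast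
      ultimately have "e = {x, y}" using xy by auto
      then have "?d y = D" using far[of x y] e \<open>x \<noteq> y\<close> xy by auto
      then show False using xy D by simp
    qed
    then have "\<forall>a\<in>{x \<in> ?N3. x \<in> e}. \<forall>b\<in>{x \<in> ?N3. x \<in> e}. a = b" by blast
    moreover have "finite {x \<in> ?N3. x \<in> e}" by (rule finite_subset[OF _ finN(1)]) blast
    ultimately show "card {x \<in> ?N3. x \<in> e} \<le> 1" by (simp only: card_le_Suc0_iff_eq One_nat_def)
  qed
  finally have "(\<Sum>x\<in>?N3. edge_degree E x) \<le> card ?B" by simp
  moreover have "3 * card ?N3 = (\<Sum>x\<in>?N3. edge_degree E x) + (\<Sum>x\<in>?N3. s x)"
    by (simp flip: sum.distrib)
  moreover have "(\<Sum>x\<in>?N3. s x) \<le> 4"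
  proof -
    have "(\<Sum>x\<in>?N3. s x) = (\<Sum>x\<in>?N3. if x \<in> Z then 1 else 0)" by (simp only: s_def)
    also have "\<dots> = card {v \<in> ?N3. v \<in> Z}"
      using sum_if_const[OF finN(1), of "\<lambda>v. v \<in> Z" "1::nat"] by (simp only: mult_1 of_nat_id)
    also have "\<dots> \<le> card Z" using Z(1) by (intro card_mono) auto
    finally show ?thesis using Z(2) by linarith
  qed
  ultimately have "3 * card ?N3 \<le> card ?B + 4" by linarith
  \<comment> \<open>3 n3 <= |B| + 4 < n3 + nD + 4 contradicts nD + 8 <= 2 n3.\<close>
  then show False using forest key by linarith
qed

end

section \<open>Reducing to a smaller graph\<close>

context kempe_cycle
begin

text \<open>A neighbor \<open>g\<close> whose color is outside the list or repeated on another
  neighbor blocks nothing of its own, which improves the count in \<open>card_avail\<close> by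
  one.\<close>

lemma avail_slack:
  assumes g: "g \<in> W'" "adj (v i) g"
    and "\<phi> g \<notin> L (v i) \<or> (\<exists>h\<in>W'. adj (v i) h \<and> h \<noteq> g \<and> \<phi> h = \<phi> g)"
  shows "3 \<le> card (avail \<phi> (v i))"
proof -
  let ?N = "{u \<in> W'. adj (v i) u}"
  have fin: "finite ?N" using finite_W' by simp
  have gN: "g \<in> ?N" using g by simp
  have "avail \<phi> (v i) = L (v i) - \<phi> ` (?N - {g})"
    using assms(3)
  proof
    assume "\<phi> g \<notin> L (v i)"
    then show ?thesis unfolding avail_def by auto
  next
    assume "\<exists>h\<in>W'. adj (v i) h \<and> h \<noteq> g \<and> \<phi> h = \<phi> g"
    then obtain h where "h \<in> ?N - {g}" "\<phi> h = \<phi> g" by blast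
    then have "\<phi> g \<in> \<phi> ` (?N - {g})" by (metis imageI)
    then have "\<phi> ` ?N = \<phi> ` (?N - {g})" using gN by blast
    then show ?thesis unfolding avail_def by simp
  qed
  moreover have "card (L (v i)) - card (\<phi> ` (?N - {g})) \<le> card (L (v i) - \<phi> ` (?N - {g}))"
    using fin by (intro diff_card_le_card_Diff) auto
  moreover have "card (\<phi> ` (?N - {g})) \<le> card (?N - {g})" using fin by (intro card_image_le) auto
  moreover have "Suc (card (?N - {g})) = card ?N" using card_Suc_Diff1[OF fin gN] .
  ultimately show ?thesis using degree_le[of i] by simp
qed

end

context plane_graph
begin

text \<open>Every edge of the cycle found has an end of degree 3 (with \<open>s\<close> added) but
  never two, so such vertices alternate with others and the length is even. Its edges form an
  induced cycle of the line graph.\<close>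

lemma kempe_cycle_exists:
  fixes E :: "'v set set" and Z :: "'v set" and D :: nat and L :: "'v set \<Rightarrow> 'c set"
  defines "s \<equiv> \<lambda>v. if v \<in> Z then 1 else 0 :: nat"
  assumes E: "E \<subseteq> E0" "E \<noteq> {}" and Z: "finite Z" "card Z \<le> 4" and D: "9 \<le> D"
    and deg: "\<And>v. v \<in> \<Union>E \<Longrightarrow> edge_degree E v + s v \<le> D"
    and heavy: "\<And>u v. {u, v} \<in> E \<Longrightarrow> u \<noteq> v \<Longrightarrow>
      D + 3 \<le> edge_degree E u + edge_degree E v + (if {u, v} \<inter> Z = {} then 0 else 1)"
    and L: "\<And>e. e \<in> E \<Longrightarrow> finite (L e)" "\<And>e. e \<in> E \<Longrightarrow> D + 1 \<le> card (L e) + (if e \<inter> Z = {} then 0 else 1)"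
  obtains n :: int and w :: "int \<Rightarrow> 'v" and v where
    "kempe_cycle edge_adj n v (E - range v) L" "range v \<subseteq> E" "v = (\<lambda>i. {w i, w (i + 1)})"
    "\<And>i j. w i = w j \<longleftrightarrow> n dvd i - j" "edge_degree E (w 0) + s (w 0) = 3" "n \<ge> 4"
proof -
  let ?B = "{e \<in> E. \<exists>x\<in>e. edge_degree E x + s x = 3}"
  let ?d = "\<lambda>v. edge_degree E v + s v"
  have finE: "finite E" using finite_sub E by blast
  have "has_cycle ?B"
    unfolding s_def using E Z D deg[unfolded s_def] heavy by (rule has_cycle_three_edges)
  then obtain n :: int and w0 :: "int \<Rightarrow> 'v" where n3: "n \<ge> 3" and w0B: "\<And>i. {w0 i, w0 (i + 1)} \<in> ?B"
    and w0: "\<And>i j. w0 i = w0 j \<longleftrightarrow> n dvd i - j"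
    by (rule cycle_function) blast
  have "\<exists>k. ?d (w0 k) = 3" using w0B[of 0] by auto
  then obtain k where k: "?d (w0 k) = 3" by blast
  \<comment> \<open>The shift puts a vertex of degree 3 at index 0.\<close>
  define w where "w i = w0 (i + k)" for i
  have wB: "{w i, w (i + 1)} \<in> ?B" for i using w0B[of "i + k"] by (simp add: w_def add.commute add.left_commute)
  have w: "w i = w j \<longleftrightarrow> n dvd i - j" for i j unfolding w_def w0 by simp
  have k0: "?d (w 0) = 3" using k by (simp add: w_def)
  have small: "\<not> n dvd a" if "0 < a" "a < n" for a using that zdvd_not_zless by blast
  have nd1: "\<not> n dvd 1" "\<not> n dvd 2" using small[of 1] small[of 2] n3 by auto
  have wne: "w i \<noteq> w (i + 1)" for i unfolding w using nd1 by simp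
  have sum_d: "D + 3 \<le> ?d (w i) + ?d (w (i + 1))" for i
    using heavy[of "w i" "w (i + 1)"] wB[of i] wne[of i] by (auto simp: s_def split: if_splits)
  have alt: "?d (w (i + 1)) = 3 \<longleftrightarrow> ?d (w i) \<noteq> 3" for i
    using wB[of i] sum_d[of i] D by auto
  have par: "?d (w (int m)) = 3 \<longleftrightarrow> even m" for m
  proof (induction m)
    case (Suc m)
    then show ?case using alt[of "int m"] by (simp add: add.commute)
  qed (use k0 in simp)
  have "w n = w 0" unfolding w by simp
  then have "even (nat n)" using par[of "nat n"] k0 n3 by simp
  then have n_even: "even n" using n3 by (simp add: even_nat_iff)
  then have n4: "n \<ge> 4" using n3 by (cases "n = 3") auto
  define v where "v = (\<lambda>i. {w i, w (i + 1)})"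
  have vE: "range v \<subseteq> E" using wB by (auto simp: v_def)
  have v_eq: "v i = v j \<longleftrightarrow> n dvd i - j" for i j
  proof
    assume "v i = v j"
    then consider "w i = w j" | "w i = w (j + 1)" "w (i + 1) = w j" by (auto simp: v_def doubleton_eq_iff)
    then show "n dvd i - j"
    proof cases
      case 2
      then have "n dvd i - (j + 1)" "n dvd i + 1 - j" unfolding w by auto
      then have "n dvd (i + 1 - j) - (i - (j + 1))" using dvd_diff by blast
      then show ?thesis using nd1 by simp
    qed (simp add: w)
  next
    assume "n dvd i - j"
    then have "w i = w j" "w (i + 1) = w (j + 1)" unfolding w by simp_all
    then show "v i = v j" by (simp add: v_def)
  qed
  have adjv: "edge_adj (v i) (v j) \<longleftrightarrow> v j = v (i + 1) \<or> v j = v (i - 1)" for i j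
  proof
    assume a: "edge_adj (v i) (v j)"
    then have "\<not> n dvd i - j" using v_eq by (auto simp: edge_adj_def)
    moreover have "w i = w j \<or> w i = w (j + 1) \<or> w (i + 1) = w j \<or> w (i + 1) = w (j + 1)"
      using a by (auto simp: edge_adj_def v_def)
    ultimately have "n dvd i - (j + 1) \<or> n dvd i + 1 - j" unfolding w by auto
    then have "n dvd j - (i - 1) \<or> n dvd j - (i + 1)"

      using dvd_diff_commute[of n i "j + 1"] dvd_diff_commute[of n "i + 1" j] by (auto simp: algebra_simps)
    then show "v j = v (i + 1) \<or> v j = v (i - 1)" unfolding v_eq by blast
  next
    assume a: "v j = v (i + 1) \<or> v j = v (i - 1)"
    have "v i \<noteq> v (i + 1)" "v i \<noteq> v (i - 1)" unfolding v_eq using nd1 by auto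
    moreover have "v i \<inter> v (i + 1) \<noteq> {}" "v i \<inter> v (i - 1) \<noteq> {}" by (auto simp: v_def)
    ultimately show "edge_adj (v i) (v j)" using a by (auto simp: edge_adj_def)
  qed
  have "kempe_cycle edge_adj n v (E - range v) L"
  proof unfold_locales
    show "even n" "n \<ge> 4" by fact+
    show "v (i + n) = v i" for i unfolding v_eq by simp
    show "inj_on v {0..<n}"
    proof (rule inj_onI)
      fix i j assume ij: "i \<in> {0..<n}" "j \<in> {0..<n}" "v i = v j"
      then have "n dvd i - j" "n dvd j - i" using v_eq by metis+
      then show "i = j" using small[of "i - j"] small[of "j - i"] ij by (cases "i < j"; cases "j < i") auto
    qed
    show "edge_adj (v i) (v j) \<longleftrightarrow> v j = v (i + 1) \<or> v j = v (i - 1)" for i j by (rule adjv)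
    show "v i \<notin> E - range v" for i by simp
    show "finite (E - range v)" using finE by simp
    show "finite (L (v i))" for i using L vE by blast
    \<comment> \<open>The degrees at the ends of \<open>v i\<close> add up to at most D + 3, so
      \<open>v i\<close> has at most D + 1 neighbors, two of them on the cycle; an end in
      \<open>Z\<close> lowers this by one and so makes up for the shortened list.\<close>
    show "card {u \<in> E - range v. edge_adj (v i) u} + 2 \<le> card (L (v i))" for i
    proof -
      let ?N = "{f \<in> E. edge_adj (v i) f}"
      have vi: "v i \<in> E" using vE by blast
      have 1: "card ?N + 2 \<le> edge_degree E (w i) + edge_degree E (w (i + 1))"
        using card_edge_neighbors[OF finE, of "w i" "w (i + 1)"] vi wne[of i] by (simp add: v_def)
      have "w i \<in> \<Union>E" "w (i + 1) \<in> \<Union>E" using vi unfolding v_def by blast+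
      then have "?d (w i) \<le> D" "?d (w (i + 1)) \<le> D" using deg by blast+
      moreover have "?d (w i) = 3 \<or> ?d (w (i + 1)) = 3" using alt[of i] by blast
      ultimately have 2: "edge_degree E (w i) + edge_degree E (w (i + 1)) + (if v i \<inter> Z = {} then 0 else 1) \<le> D + 3"
        by (auto simp: s_def v_def split: if_splits)
      have "v (i + 1) \<noteq> v (i - 1)" unfolding v_eq using nd1 by simp
      then have two: "card {v (i + 1), v (i - 1)} = 2" by simp
      have sub: "{v (i + 1), v (i - 1)} \<subseteq> ?N" using vE adjv by auto
      have "card {u \<in> E - range v. edge_adj (v i) u} \<le> card (?N - {v (i + 1), v (i - 1)})"
        using finE by (intro card_mono) auto
      also have "\<dots> = card ?N - 2" using finE sub two by (subst card_Diff_subset) auto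
      finally have 3: "card {u \<in> E - range v. edge_adj (v i) u} \<le> card ?N - 2" .
      have "2 \<le> card ?N" using card_mono[OF _ sub] finE two by simp
      then show ?thesis using 1 2 3 L(2)[OF vi] by (auto split: if_splits)
    qed
  qed
  then show ?thesis using that[of n v w] vE v_def w k0 n4 by blast
qed

text \<open>The deletions are those of the main reduction, a light edge or an even cycle, but to
  extend a coloring over the cycle two colors per position suffice. \<open>Z\<close> stays fixed
  while \<open>E\<close> shrinks, which preserves the hypotheses.\<close>

lemma ex_edge_coloring:
  fixes E :: "'v set set" and Z :: "'v set" and D :: nat and L :: "'v set \<Rightarrow> 'c set"
  assumes "E \<subseteq> E0" and Z: "finite Z" "card Z \<le> 4" and D: "9 \<le> D"
    and "\<And>v. v \<in> \<Union>E \<Longrightarrow> edge_degree E v + (if v \<in> Z then 1 else 0) \<le> D"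
    and "\<And>e. e \<in> E \<Longrightarrow> finite (L e)" "\<And>e. e \<in> E \<Longrightarrow> D + 1 \<le> card (L e) + (if e \<inter> Z = {} then 0 else 1)"
  shows "\<exists>\<phi>. coloring edge_adj E L \<phi>"
  using assms(1,5-7)
proof (induction "card E" arbitrary: E rule: less_induct)
  case (less E)
  have finE: "finite E" using finite_sub less.prems by blast
  have IH: "\<exists>\<phi>. coloring edge_adj E' L \<phi>" if E': "E' \<subset> E" for E'
  proof (rule less.hyps)
    show "card E' < card E" using finE E' by (rule psubset_card_mono)
    show "E' \<subseteq> E0" using E' less.prems by blast
    show "edge_degree E' v + (if v \<in> Z then 1 else 0) \<le> D" if "v \<in> \<Union>E'" for v
    proof -
      have "v \<in> \<Union>E" using that E' by blast
      then show ?thesis using less.prems(2)[of v] edge_degree_mono[OF finE, of E' v] E' by fastforce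
    qed
    show "finite (L e)" if "e \<in> E'" for e using less.prems(3)[of e] that E' by blast
    show "D + 1 \<le> card (L e) + (if e \<inter> Z = {} then 0 else 1)" if "e \<in> E'" for e
      using less.prems(4)[of e] that E' by blast
  qed
  show ?case
  proof (cases "E = {}")
    case True
    then show ?thesis by (intro exI[of _ "\<lambda>_. undefined"]) (simp add: coloring_def)
  next
    case ne: False
    show ?thesis
    proof (cases "\<exists>u v. {u, v} \<in> E \<and> u \<noteq> v \<and> edge_degree E u + edge_degree E v + (if {u, v} \<inter> Z = {} then 0 else 1) < D + 3")
      case True
      then obtain u v where uv: "{u, v} \<in> E" "u \<noteq> v"
          "edge_degree E u + edge_degree E v + (if {u, v} \<inter> Z = {} then 0 else 1) < D + 3" by blast
      let ?e = "{u, v}"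
      obtain \<phi> where \<phi>: "coloring edge_adj (E - {?e}) L \<phi>" using IH[of "E - {?e}"] uv by blast
      let ?N = "{f \<in> E. edge_adj ?e f}"
      have "card (\<phi> ` ?N) \<le> card ?N" using finE by (intro card_image_le) auto
      also have "\<dots> < card (L ?e)"
        using card_edge_neighbors[OF finE uv(1,2)] uv(3) less.prems(4)[OF uv(1)] by (auto split: if_splits)
      finally have "\<not> L ?e \<subseteq> \<phi> ` ?N" using finE card_mono[of "\<phi> ` ?N" "L ?e"] by fastforce
      then obtain c where c: "c \<in> L ?e" "c \<notin> \<phi> ` ?N" by blast
      have cN: "\<phi> f \<noteq> c" if "f \<in> E" "edge_adj ?e f" for f using c(2) that by blast
      have "coloring edge_adj E L (\<phi>(?e := c))"
        unfolding coloring_def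
      proof (intro conjI ballI impI)
        show "\<phi>(?e := c) \<in> (\<Pi>\<^sub>E f\<in>E. L f)"
          using \<phi> c(1) uv(1) by (auto simp: coloring_def PiE_def Pi_def extensional_def)
        fix f g assume fg: "f \<in> E" "g \<in> E" "edge_adj f g"
        show "(\<phi>(?e := c)) f \<noteq> (\<phi>(?e := c)) g"
        proof (cases "f = ?e")
          case True
          then have "g \<noteq> ?e" using fg(3) edge_adj.adj_irrefl by blast
          then show ?thesis using cN[of g] fg True by simp
        next
          case False
          show ?thesis
          proof (cases "g = ?e")
            case True
            then show ?thesis using cN[of f] fg False edge_adj.adj_sym[of f ?e] by simp
          next
            case False
            then show ?thesis using coloring_neq[OF \<phi>, of f g] fg \<open>f \<noteq> ?e\<close> by simp
          qed
        qed
      qed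
      then show ?thesis by blast
    next
      case False
      then have heavy: "D + 3 \<le> edge_degree E u + edge_degree E v + (if {u, v} \<inter> Z = {} then 0 else 1)"
        if "{u, v} \<in> E" "u \<noteq> v" for u v using that by (meson not_le)
      obtain n :: int and w :: "int \<Rightarrow> 'v" and v where v: "kempe_cycle edge_adj n v (E - range v) L" "range v \<subseteq> E"
        by (rule kempe_cycle_exists[where L = L, OF less.prems(1) ne Z D less.prems(2) heavy less.prems(3,4)])
      interpret kempe_cycle edge_adj n v "E - range v" L by (rule v(1))
      have "E - range v \<subset> E" using v(2) by blast
      then obtain \<phi> where "coloring edge_adj (E - range v) L \<phi>" using IH by blast
      then have "\<exists>\<eta>. coloring edge_adj (E - range v \<union> range v) L \<eta>" by (rule ex_coloring_cycle)
      moreover have "E - range v \<union> range v = E" using v(2) by blast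
      ultimately show ?thesis by simp
    qed
  qed
qed

text \<open>Give the edges of \<open>P\<close> the color \<open>c\<close> and delete
  \<open>c\<close> from the lists of all edges meeting them. Their at most four ends form
  \<open>Z\<close>: each has lost an edge, and each remaining edge there at most one color.\<close>

lemma ex_coloring_precolored:
  fixes E P :: "'v set set" and D :: nat and L :: "'v set \<Rightarrow> 'c set"
  assumes E: "E \<subseteq> E0" and D: "9 \<le> D" and deg: "\<And>v. v \<in> \<Union>E \<Longrightarrow> edge_degree E v \<le> D"
    and L: "\<And>e. e \<in> E \<Longrightarrow> finite (L e)" "\<And>e. e \<in> E \<Longrightarrow> D + 1 \<le> card (L e)"
    and P: "P \<subseteq> E" "card P \<le> 2" "\<And>e f. e \<in> P \<Longrightarrow> f \<in> P \<Longrightarrow> e \<noteq> f \<Longrightarrow> e \<inter> f = {}" "\<And>e. e \<in> P \<Longrightarrow> c \<in> L e"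
  shows "\<exists>\<phi>. coloring edge_adj E L \<phi> \<and> (\<forall>e\<in>P. \<phi> e = c)"
proof -
  have finE: "finite E" using finite_sub E by blast
  have finP: "finite P" using P(1) finE by (rule finite_subset)
  have two: "card e = 2" if "e \<in> P" for e using card_edge E P(1) that by blast
  let ?Z = "\<Union>P"
  define L' where "L' e = L e - (if e \<inter> ?Z = {} then {} else {c})" for e
  have "finite e" if "e \<in> P" for e using two[OF that] by (metis card.infinite zero_neq_numeral)
  then have finZ: "finite ?Z" using finP by blast
  have "card ?Z \<le> (\<Sum>e\<in>P. card e)" using card_Union_le_sum_card by blast
  also have "\<dots> = 2 * card P" using two by simp
  finally have cardZ: "card ?Z \<le> 4" using P(2) by linarith
  have "\<exists>\<phi>. coloring edge_adj (E - P) L' \<phi>"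
  proof (rule ex_edge_coloring[OF _ finZ cardZ D])
    show "E - P \<subseteq> E0" using E by blast
    show "edge_degree (E - P) v + (if v \<in> ?Z then 1 else 0) \<le> D" if v: "v \<in> \<Union> (E - P)" for v
    proof -
      have d1: "edge_degree E v \<le> D" using v deg by blast
      have d2: "edge_degree (E - P) v \<le> edge_degree E v" using edge_degree_mono[OF finE] by blast
      have d3: "edge_degree (E - P) v < edge_degree E v" if vZ: "v \<in> ?Z"
      proof -
        obtain e where e: "e \<in> P" "v \<in> e" using vZ by blast
        then have "{f \<in> E - P. v \<in> f} \<subset> {f \<in> E. v \<in> f}" using P(1) by blast
        then show ?thesis unfolding edge_degree_def using finE by (intro psubset_card_mono) auto
      qed
      show ?thesis
      proof (cases "v \<in> ?Z")
        case True
        then show ?thesis using d1 d3[OF True] by (simp only: if_True)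
      next
        case False
        then show ?thesis using d1 d2 by (simp only: if_False)
      qed
    qed
    show "finite (L' e)" if "e \<in> E - P" for e using L(1) that by (simp add: L'_def)
    show "D + 1 \<le> card (L' e) + (if e \<inter> ?Z = {} then 0 else 1)" if e: "e \<in> E - P" for e
    proof -
      have "D + 1 \<le> card (L e)" using L(2) e by blast
      moreover have "card (L e) \<le> card (L e - {c}) + 1"
        using card_Diff1_le[of "L e" c] card_Suc_Diff1[of "L e" c] L(1)[of e] e by (cases "c \<in> L e") auto
      ultimately show ?thesis by (auto simp: L'_def)
    qed
  qed
  then obtain \<psi> where \<psi>: "coloring edge_adj (E - P) L' \<psi>" by blast
  let ?\<phi> = "\<lambda>e. if e \<in> P then c else \<psi> e"
  have "coloring edge_adj E L ?\<phi>"
    unfolding coloring_def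
  proof (intro conjI ballI impI)
    have "?\<phi> e \<in> L e" if "e \<in> E" for e
      using that P(4) coloring_in[OF \<psi>, of e] by (auto simp: L'_def)
    moreover have "?\<phi> e = undefined" if "e \<notin> E" for e
      using that P(1) \<psi> by (auto simp: coloring_def)
    ultimately show "?\<phi> \<in> (\<Pi>\<^sub>E e\<in>E. L e)" by (auto simp: PiE_def extensional_def)
    fix e f assume ef: "e \<in> E" "f \<in> E" "edge_adj e f"
    have mixed: "\<psi> b \<noteq> c" if "a \<in> P" "b \<in> E" "b \<notin> P" "a \<inter> b \<noteq> {}" for a b
    proof -
      have "b \<inter> ?Z \<noteq> {}" using that by blast
      then show ?thesis using coloring_in[OF \<psi>, of b] that by (auto simp: L'_def)
    qed
    have i: "e \<inter> f \<noteq> {}" "f \<inter> e \<noteq> {}" "e \<noteq> f" using ef(3) by (auto simp: edge_adj_def)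
    consider "e \<in> P" "f \<in> P" | "e \<in> P" "f \<notin> P" | "e \<notin> P" "f \<in> P" | "e \<notin> P" "f \<notin> P" by blast
    then show "?\<phi> e \<noteq> ?\<phi> f"
    proof cases
      case 1
      then show ?thesis using P(3)[of e f] i by blast
    next
      case 2
      then show ?thesis using mixed[of e f] ef i by auto
    next
      case 3
      then show ?thesis using mixed[of f e] ef i by auto
    next
      case 4
      then show ?thesis using coloring_neq[OF \<psi>, of e f] ef by auto
    qed
  qed
  then show ?thesis by (intro exI[of _ ?\<phi>]) simp
qed

theorem swappable_edges:
  fixes E :: "'v set set" and D :: nat and L :: "'v set \<Rightarrow> 'c set"
  assumes "E \<subseteq> E0" and D: "9 \<le> D" and "\<And>v. v \<in> \<Union>E \<Longrightarrow> edge_degree E v \<le> D"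
    and "\<And>e. e \<in> E \<Longrightarrow> finite (L e)" "\<And>e. e \<in> E \<Longrightarrow> card (L e) = D + 1"
  shows "swappable edge_adj E L"
  using assms(1,3-5)
proof (induction "card E" arbitrary: E rule: less_induct)
  case (less E)
  have finE: "finite E" using finite_sub less.prems by blast
  have IH: "swappable edge_adj E' L" if E': "E' \<subset> E" for E'
  proof (rule less.hyps)
    show "card E' < card E" using finE E' by (rule psubset_card_mono)
    show "E' \<subseteq> E0" using E' less.prems by blast
    show "edge_degree E' v \<le> D" if "v \<in> \<Union>E'" for v
    proof -
      have "v \<in> \<Union>E" using that E' by blast
      then show ?thesis using less.prems(2)[of v] edge_degree_mono[OF finE, of E' v] E' by fastforce
    qed
    show "finite (L e)" if "e \<in> E'" for e using less.prems(3)[of e] that E' by blast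
    show "card (L e) = D + 1" if "e \<in> E'" for e using less.prems(4)[of e] that E' by blast
  qed
  show ?case
  proof (cases "E = {}")
    case True
    then show ?thesis by (auto simp: swappable_def coloring_def)
  next
    case ne: False
    show ?thesis
    proof (cases "\<exists>u v. {u, v} \<in> E \<and> u \<noteq> v \<and> edge_degree E u + edge_degree E v < D + 3")
      case True
      then obtain u v where uv: "{u, v} \<in> E" "u \<noteq> v" "edge_degree E u + edge_degree E v < D + 3" by blast
      let ?e = "{u, v}"
      have "swappable edge_adj (insert ?e (E - {?e})) L"
      proof (rule edge_adj.swappable_insert)
        have "card {f \<in> E - {?e}. edge_adj ?e f \<and> L f \<inter> L ?e \<noteq> {}} \<le> card {f \<in> E. edge_adj ?e f}"
          using finE by (intro card_mono) auto
        then show "card {f \<in> E - {?e}. edge_adj ?e f \<and> L f \<inter> L ?e \<noteq> {}} < card (L ?e)"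
          using card_edge_neighbors[OF finE uv(1,2)] uv(3) less.prems(4)[OF uv(1)] by linarith
        show "swappable edge_adj (E - {?e}) L" using IH uv(1) by blast
      qed (use finE less.prems(3) uv in auto)
      then show ?thesis using uv(1) by (simp add: insert_absorb)
    next
      case False
      then have heavy: "D + 3 \<le> edge_degree E u + edge_degree E v + (if {u, v} \<inter> {} = {} then 0 else 1)"
        if "{u, v} \<in> E" "u \<noteq> v" for u v using that by (simp add: not_less) blast
      have deg0: "edge_degree E v + (if v \<in> {} then 1 else 0) \<le> D" if "v \<in> \<Union>E" for v using less.prems(2)[OF that] by simp
      have L0: "D + 1 \<le> card (L e) + (if e \<inter> {} = {} then 0 else 1)" if "e \<in> E" for e using less.prems(4)[OF that] by simp
      obtain n :: int and w :: "int \<Rightarrow> 'v" and v where v: "kempe_cycle edge_adj n v (E - range v) L" "range v \<subseteq> E"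
          "v = (\<lambda>i. {w i, w (i + 1)})" and w: "\<And>i j. w i = w j \<longleftrightarrow> n dvd i - j"
          and w3: "edge_degree E (w 0) + (if w 0 \<in> {} then 1 else 0) = 3" and n4: "n \<ge> 4"
        by (rule kempe_cycle_exists[where L = L, OF less.prems(1) ne finite.emptyI _ D deg0 heavy less.prems(3) L0]) auto
      interpret kempe_cycle edge_adj n v "E - range v" L by (rule v(1))
      have un: "E - range v \<union> range v = E" using v(2) by blast
      have nd: "\<not> n dvd 1" using zdvd_not_zless[of 1 n] n4 by auto
      define x y where "x = w 0" and "y = w 1"
      have xy: "x \<noteq> y" using w[of 0 1] nd by (auto simp: x_def y_def)
      have v0: "v 0 = {x, y}" by (simp add: v(3) x_def y_def)
      have v0E: "v 0 \<in> E" using v(2) by blast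
      have x3: "edge_degree E x = 3" using w3 by (simp add: x_def)
      have yD: "9 \<le> edge_degree E y" using heavy[of x y] v0 v0E xy x3 D by auto
      have atx: "e \<in> {v 0, v (- 1)}" if e: "e \<in> range v" "x \<in> e" for e
      proof -
        obtain i where i: "e = v i" using e(1) by blast
        then have "w 0 = w i \<or> w 0 = w (i + 1)" using e(2) by (auto simp: v(3) x_def)
        then have "n dvd i - 0 \<or> n dvd i - (- 1)" 
          unfolding w using dvd_diff_commute[of n 0 i] dvd_diff_commute[of n 0 "i + 1"] by auto
        then show ?thesis using i v_eq_iff by auto
      qed
      have aty: "e \<in> {v 0, v 1}" if e: "e \<in> range v" "y \<in> e" for e
      proof -
        obtain i where i: "e = v i" using e(1) by blast
        then have "w 1 = w i \<or> w 1 = w (i + 1)" using e(2) by (auto simp: v(3) y_def)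
        then have "n dvd i - 1 \<or> n dvd i - 0" 
          unfolding w using dvd_diff_commute[of n 1 i] dvd_diff_commute[of n 1 "i + 1"] by auto
        then show ?thesis using i v_eq_iff by auto
      qed
      have pick: "\<exists>e\<in>A. e \<notin> F" if "card F < card A" "finite F" for A F :: "'v set set"
        using that card_mono[of F A] by (meson not_le subsetI)
      \<comment> \<open>\<open>x\<close> has degree 3 and only two edges on the cycle, so a third
        edge \<open>g\<close> leaves the cycle at \<open>x\<close>.\<close>
      have "card {v 0, v (- 1)} < card {e \<in> E. x \<in> e}"
        using x3 unfolding edge_degree_def by (simp add: card_insert_if)
      then have "\<exists>e\<in>{e \<in> E. x \<in> e}. e \<notin> {v 0, v (- 1)}" by (rule pick) simp
      then obtain g where g: "g \<in> E" "x \<in> g" "g \<notin> {v 0, v (- 1)}" by auto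
      have gr: "g \<notin> range v" using atx g by blast
      have E0: "g \<in> E0" using g(1) less.prems(1) by blast
      obtain z where z: "g = {x, z}" "z \<noteq> x" by (rule edge_other_end[OF E0 g(2)])
      have zy: "z \<noteq> y" using z g(3) v0 by auto
      \<comment> \<open>\<open>h\<close> must avoid the cycle and also the edge from
        \<open>y\<close> to the far end of \<open>g\<close>, so that \<open>g\<close> and
        \<open>h\<close> are disjoint and may get the same color; the degree of \<open>y\<close>, at
        least 9, leaves room.\<close>
      have "card {v 0, v 1, {y, z}} \<le> 3" by (simp add: card_insert_if)
      then have "card {v 0, v 1, {y, z}} < card {e \<in> E. y \<in> e}"
        using yD unfolding edge_degree_def by linarith
      then have "\<exists>e\<in>{e \<in> E. y \<in> e}. e \<notin> {v 0, v 1, {y, z}}" by (rule pick) simp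
      then obtain h where h: "h \<in> E" "y \<in> h" "h \<notin> {v 0, v 1, {y, z}}" by auto
      have hr: "h \<notin> range v" using aty h by blast
      have E0: "h \<in> E0" using h(1) less.prems(1) by blast
      obtain u where u: "h = {y, u}" "u \<noteq> y" by (rule edge_other_end[OF E0 h(2)])
      have gh: "g \<inter> h = {}" using z u zy xy h(3) v0 by (auto simp: insert_commute)
      have adjg: "edge_adj (v 0) g" and adjh: "edge_adj (v 0) h"
        using g h v0 by (auto simp: edge_adj_def)
      have degC: "edge_degree (E - range v) v' \<le> D" if "v' \<in> \<Union> (E - range v)" for v'
      proof -
        have "v' \<in> \<Union>E" using that by blast
        then show ?thesis using less.prems(2)[of v'] edge_degree_mono[OF finE, of "E - range v" v'] by fastforce
      qed
      have subC: "E - range v \<subseteq> E0" using less.prems(1) by blast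
      have LC: "finite (L e)" "D + 1 \<le> card (L e)" if "e \<in> E - range v" for e
        using less.prems(3,4)[of e] that by auto
      have ext: "\<exists>\<phi>. coloring edge_adj (E - range v) L \<phi> \<and> (\<forall>e\<in>P. \<phi> e = c)"
        if P: "P \<subseteq> {g, h}" and c: "\<And>e. e \<in> P \<Longrightarrow> c \<in> L e" for P c
      proof (rule ex_coloring_precolored[OF subC D degC LC])
        have "g \<noteq> h" using gh z by auto
        then show "card P \<le> 2" using card_mono[OF _ P] by simp
        show "P \<subseteq> E - range v" using P g h gr hr by blast
        show "e \<inter> f = {}" if "e \<in> P" "f \<in> P" "e \<noteq> f" for e f
          using that P gh by blast
      qed (use c in auto)
      have mem: "g \<in> E - range v" "h \<in> E - range v" using g h gr hr by auto
      \<comment> \<open>Slack at \<open>v 0\<close> comes from a color outside its list on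
        \<open>g\<close> or on \<open>h\<close>; if neither has one, all three lists are equal by
        size, and the same color is put on both.\<close>
      have "\<exists>\<phi>. coloring edge_adj (E - range v) L \<phi> \<and> 3 \<le> card (avail \<phi> (v 0))"
      proof (cases "L g \<subseteq> L (v 0)")
        case False
        then obtain c where c: "c \<in> L g" "c \<notin> L (v 0)" by blast
        obtain \<phi> where \<phi>: "coloring edge_adj (E - range v) L \<phi>" "\<phi> g = c" using ext[of "{g}" c] c by auto
        then show ?thesis using avail_slack[OF mem(1) adjg, of \<phi>] c by blast
      next
        case Lg: True
        show ?thesis
        proof (cases "L h \<subseteq> L (v 0)")
          case False
          then obtain c where c: "c \<in> L h" "c \<notin> L (v 0)" by blast
          obtain \<phi> where \<phi>: "coloring edge_adj (E - range v) L \<phi>" "\<phi> h = c" using ext[of "{h}" c] c by auto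
          then show ?thesis using avail_slack[OF mem(2) adjh, of \<phi>] c by blast
        next
          case Lh: True
          have eq: "L g = L (v 0)" "L h = L (v 0)"
            using card_subset_eq[OF less.prems(3)[OF v0E]] Lg Lh less.prems(4) v0E g(1) h(1) by auto
          have "L (v 0) \<noteq> {}" using less.prems(4)[OF v0E] by auto
          then obtain c where c: "c \<in> L g" "c \<in> L h" using eq by auto
          obtain \<phi> where \<phi>: "coloring edge_adj (E - range v) L \<phi>" "\<phi> g = c" "\<phi> h = c"
            using ext[of "{g, h}" c] c by auto
          have "h \<noteq> g" using gh z by auto
          then show ?thesis using avail_slack[OF mem(1) adjg, of \<phi>] \<phi> mem(2) adjh by metis
        qed
      qed
      then obtain \<phi> where \<phi>: "coloring edge_adj (E - range v) L \<phi>" "3 \<le> card (avail \<phi> (v 0))" by blast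
      have "E - range v \<subset> E" using v(2) by blast
      then have "swappable edge_adj (E - range v) L" by (rule IH)
      then have "swappable edge_adj (E - range v \<union> range v) L" using \<phi> by (rule swappable_cycle)
      then show ?thesis using un by simp
    qed
  qed
qed

end

text \<open>A closed set is a union of components, and peeling them off one at a time gives single
  swaps. Each of these is valid, because at every stage a vertex has either its old or its final
  color.\<close>

lemma (in sym_adj) kempe_step_imp_L_equivalent:
  assumes H: "finite (verts H)" "\<And>u v. {u, v} \<in> edges H \<longleftrightarrow> u \<in> verts H \<and> v \<in> verts H \<and> adj u v"
    and step: "kempe_step adj (verts H) L \<phi> \<psi>"
  shows "L_equivalent H L \<phi> \<psi>"
proof -
  let ?W = "verts H"
  have lc: "list_coloring H L \<eta> \<longleftrightarrow> coloring adj ?W L \<eta>" for \<eta>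
    unfolding list_coloring_def coloring_def H(2) by blast
  have main: "L_equivalent H L \<eta> (swap_on \<alpha> \<beta> K \<eta>)"
    if "coloring adj ?W L \<eta>" "kempe_closed adj ?W \<eta> \<alpha> \<beta> K" "\<And>v. v \<in> K \<Longrightarrow> swap_on \<alpha> \<beta> K \<eta> v \<in> L v" "\<alpha> \<noteq> \<beta>" for \<eta> \<alpha> \<beta> K
    using that
  proof (induction "card K" arbitrary: K \<eta> rule: less_induct)
    case (less K \<eta>)
    have KW: "K \<subseteq> ?W" using less.prems(2) by (auto simp: kempe_closed_def)
    have finK: "finite K" using KW H(1) by (rule finite_subset)
    show ?case
    proof (cases "K = {}")
      case True
      then have "swap_on \<alpha> \<beta> K \<eta> = \<eta>" by (auto simp: swap_on_def)
      then show ?thesis by (simp add: L_equivalent_def)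
    next
      case False
      then obtain v where v: "v \<in> K" by blast
      define S where "S = {v \<in> ?W. \<eta> v \<in> {\<alpha>, \<beta>}}"
      define I where "I = induced_subgraph H S"
      define R where "R = {(x, y). {x, y} \<in> edges I}"
      \<comment> \<open>The Kempe component of \<open>v\<close>, which lies in \<open>K\<close>
        because \<open>K\<close> is closed.\<close>
      define K0 where "K0 = {w \<in> verts I. (v, w) \<in> R\<^sup>*}"
      have KS: "K \<subseteq> S" using less.prems(2) by (auto simp: kempe_closed_def S_def)
      have R: "(x, y) \<in> R \<longleftrightarrow> x \<in> S \<and> y \<in> S \<and> adj x y" for x y
        by (auto simp: R_def I_def S_def induced_subgraph_def H(2))
      have vI: "verts I = S" by (auto simp: I_def S_def induced_subgraph_def)
      have reach: "w \<in> K" if "(v, w) \<in> R\<^sup>*" for w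
        using that
      proof (induction rule: rtrancl_induct)
        case (step a b)
        then have "b \<in> S" "adj a b" using R by blast+
        then show ?case using less.prems(2) step(3) unfolding kempe_closed_def S_def by blast
      qed (rule v)
      have K0K: "K0 \<subseteq> K" using reach by (auto simp: K0_def)
      have vK0: "v \<in> K0" unfolding K0_def vI using v KS by blast
      have comp: "K0 \<in> graph_components I"
        unfolding graph_components_def K0_def R_def using v KS vI by blast
      have closed0: "b \<in> K0" if "a \<in> K0" "b \<in> ?W" "adj a b" "\<eta> b \<in> {\<alpha>, \<beta>}" for a b
      proof -
        have a: "a \<in> S" "(v, a) \<in> R\<^sup>*" using that(1) by (auto simp: K0_def vI)
        have b: "b \<in> S" using that by (simp add: S_def)
        have "(a, b) \<in> R" unfolding R using a b that(3) by blast
        with a(2) have "(v, b) \<in> R\<^sup>*" by (rule rtrancl_into_rtrancl)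
        then show ?thesis unfolding K0_def vI using b by blast
      qed
      have kc0: "kempe_closed adj ?W \<eta> \<alpha> \<beta> K0"
        unfolding kempe_closed_def using K0K KS closed0 unfolding S_def by blast
      let ?\<eta>0 = "swap_on \<alpha> \<beta> K0 \<eta>"
      have lists0: "?\<eta>0 w \<in> L w" if "w \<in> K0" for w
        using less.prems(3)[of w] that K0K by (auto simp: swap_on_def)
      have c0: "coloring adj ?W L ?\<eta>0" using less.prems(1) kc0 lists0 by (rule coloring_swap_on)
      have "kempe_swap H \<eta> ?\<eta>0"
        unfolding kempe_swap_def swap_on_def using less.prems(4) comp[unfolded I_def S_def] by blast
      then have "valid_kempe_swap H L \<eta> ?\<eta>0"
        unfolding valid_kempe_swap_def lc using less.prems(1) c0 by blast
      moreover have "L_equivalent H L ?\<eta>0 (swap_on \<alpha> \<beta> (K - K0) ?\<eta>0)"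
      proof (rule less.hyps)
        show "card (K - K0) < card K" using finK v vK0 by (intro psubset_card_mono) auto
        show "coloring adj ?W L ?\<eta>0" by (rule c0)
        have "kempe_closed adj ?W \<eta> \<alpha> \<beta> (K - K0)"
          unfolding kempe_closed_def
        proof (intro conjI ballI impI)
          show "K - K0 \<subseteq> {v \<in> ?W. \<eta> v \<in> {\<alpha>, \<beta>}}" using KS unfolding S_def by blast
          fix a b assume ab: "a \<in> K - K0" "b \<in> ?W" "adj a b \<and> \<eta> b \<in> {\<alpha>, \<beta>}"
          then have "b \<in> K" using less.prems(2) unfolding kempe_closed_def by blast
          moreover have "b \<notin> K0"
          proof
            assume "b \<in> K0"
            moreover have "a \<in> ?W" "\<eta> a \<in> {\<alpha>, \<beta>}" using ab(1) KS by (auto simp: S_def)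
            ultimately show False using closed0[of b a] ab adj_sym by blast
          qed
          ultimately show "b \<in> K - K0" by blast
        qed
        then show "kempe_closed adj ?W ?\<eta>0 \<alpha> \<beta> (K - K0)" by (rule kempe_closed_swap_on)
        show "swap_on \<alpha> \<beta> (K - K0) ?\<eta>0 w \<in> L w" if "w \<in> K - K0" for w
          using less.prems(3)[of w] that by (auto simp: swap_on_def)
        show "\<alpha> \<noteq> \<beta>" by (rule less.prems(4))
      qed
      moreover have "swap_on \<alpha> \<beta> (K - K0) ?\<eta>0 = swap_on \<alpha> \<beta> K \<eta>"
        using K0K by (auto simp: swap_on_def fun_eq_iff)
      ultimately show ?thesis unfolding L_equivalent_def by (simp add: converse_rtranclp_into_rtranclp)
    qed
  qed
  obtain \<alpha> \<beta> K where K: "kempe_closed adj ?W \<phi> \<alpha> \<beta> K" "\<psi> = swap_on \<alpha> \<beta> K \<phi>"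
      "coloring adj ?W L \<phi>" "coloring adj ?W L \<psi>"
    using step unfolding kempe_step_def by blast
  show ?thesis
  proof (cases "\<alpha> = \<beta>")
    case True
    then have "\<psi> = \<phi>" using K(2) by (auto simp: swap_on_def)
    then show ?thesis by (simp add: L_equivalent_def)
  next
    case False
    have "K \<subseteq> ?W" using K(1) by (auto simp: kempe_closed_def)
    then show ?thesis using main[OF K(3,1) _ False] K(2) coloring_in[OF K(4)] by blast
  qed
qed

theorem theorem1:
  fixes G :: "'v ugraph" and H :: "'v set ugraph" and L :: "'v set \<Rightarrow> 'c set"
    and \<phi> \<psi> :: "'v set \<Rightarrow> 'c"
  assumes "simple_graph G" and "planar G" and "max_degree G \<ge> 9"
    and "H = line_graph G"
    and "k_assignment H (max_degree G + 1) L"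
    and "list_coloring H L \<phi>" and "list_coloring H L \<psi>"
  shows "L_equivalent H L \<phi> \<psi>"
proof -
  obtain p \<gamma> where d: "plane_drawing G p \<gamma>" using assms(2) unfolding planar_def by blast
  interpret plane_graph "verts G" "edges G" p \<gamma>
    by unfold_locales (use assms(1) d in \<open>simp_all add: simple_graph_def plane_drawing_def\<close>)
  have vH: "verts H = edges G" by (simp add: assms(4) line_graph_def)
  have eH: "{e, f} \<in> edges H \<longleftrightarrow> e \<in> verts H \<and> f \<in> verts H \<and> edge_adj e f" for e f
    unfolding assms(4) line_graph_def edge_adj_def by (auto simp: doubleton_eq_iff)
  have lc: "list_coloring H L \<eta> \<longleftrightarrow> coloring edge_adj (edges G) L \<eta>" for \<eta>
    unfolding list_coloring_def coloring_def eH vH by blast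
  have "edge_degree (edges G) v \<le> max_degree G" if "v \<in> \<Union> (edges G)" for v
  proof -
    have "v \<in> verts G" using that edge_sub by blast
    then have "vertex_degree G v \<le> max_degree G"
      unfolding max_degree_def using finite_V by (intro Max_ge) auto
    then show ?thesis by (simp add: edge_degree_def vertex_degree_def)
  qed
  then have "swappable edge_adj (edges G) L"
    using assms(3,5) vH by (intro swappable_edges[OF subset_refl, of "max_degree G"]) (auto simp: k_assignment_def)
  then have "kempe_equiv edge_adj (edges G) L \<phi> \<psi>"
    using assms(6,7) unfolding lc swappable_def by blast
  then show ?thesis
  proof (induction rule: rtranclp_induct)
    case base
    then show ?case by (simp add: L_equivalent_def)
  next
    case (step \<eta> \<eta>')
    have "L_equivalent H L \<eta> \<eta>'"
      by (rule edge_adj.kempe_step_imp_L_equivalent[OF _ eH]) (use step(2) vH finite_E0 in auto)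
    then show ?case using step(3) unfolding L_equivalent_def by (rule rtranclp_trans[rotated])
  qed
qed

end
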